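(* Let $a\ge b\ge1$ be integers. Let $r_1=1/4$ and $r_n=\frac{1}{2n}$ for $n\ge2$, and set $p_n=\frac12+r_n$ for $n\ge1$. Then, as $n\to\infty$, $$\frac{|C(a,b)\cap[1,n]|}{2^{-a}\binom{a-1}{b-1}\log n}\xrightarrow{d}S,\qquad \frac{|C( *,a)\cap[1,n]|}{\log n}\xrightarrow{d}S,\qquad \frac{|C_w\cap[1,n]|}{2\log n}\xrightarrow{d}S,$$ where $S$ is a random variable with $\mathbb P(S>t)=e^{-t}$ for $t>0$ and $\xrightarrow{d}$ denotes convergence in distribution.
   Context: Let $p_0=1$, $q_0=0$, $q_n=1-p_n$ for $n\ge1$, and let $X=(X_k)_{k\ge0}$ be the Markov chain on $\mathbb Z_+$ with $X_0=0$, $\mathbb P(X_{k+1}=n+1\mid X_k=n)=p_n$, $\mathbb P(X_{k+1}=n-1\mid X_k=n)=q_n$. Let $\xi(x)=\sum_{k\ge0}1_{\{X_k=x\}}$ and $\xi(x,\uparrow)=\sum_{k\ge0}1_{\{X_k=x,X_{k+1}=x+1\}}$. Let $C(a,b)=\{x\in\mathbb Z_+:\xi(x)=a,\ \xi(x,\uparrow)=b\}$ and $C( *,a)=\{x\in\mathbb Z_+:\xi(x,\uparrow)=a\}$. A site $R$ is a weak cutpoint if for some $k$, $X_k=R$, $X_i\le R$ for $0\le i\le k-1$ and $X_i\ge R$ for all $i\ge k+1$; $C_w$ is the set of weak cutpoints. *)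

theory Defs
  imports "HOL-Probability.Probability"
begin

definition r_seq :: "nat \<Rightarrow> real" where
  "r_seq n = (if n = 1 then 1/4 else 1 / (2 * real n))"

definition p_seq :: "nat \<Rightarrow> real" where
  "p_seq n = (if n = 0 then 1 else 1/2 + r_seq n)"

definition bd_chain :: "'w measure \<Rightarrow> (nat \<Rightarrow> real) \<Rightarrow> (nat \<Rightarrow> 'w \<Rightarrow> nat) \<Rightarrow> bool" where
  "bd_chain M p X \<longleftrightarrow>
     prob_space M \<and>
     (\<forall>k. X k \<in> measurable M (count_space UNIV)) \<and>
     measure M {\<omega> \<in> space M. X 0 \<omega> = 0} = 1 \<and>
     (\<forall>k (h :: nat \<Rightarrow> nat).
        measure M {\<omega> \<in> space M. (\<forall>i\<le>k. X i \<omega> = h i) \<and> X (Suc k) \<omega> = h k + 1}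
          = p (h k) * measure M {\<omega> \<in> space M. \<forall>i\<le>k. X i \<omega> = h i}) \<and>
     (\<forall>k (h :: nat \<Rightarrow> nat). 0 < h k \<longrightarrow>
        measure M {\<omega> \<in> space M. (\<forall>i\<le>k. X i \<omega> = h i) \<and> X (Suc k) \<omega> = h k - 1}
          = (1 - p (h k)) * measure M {\<omega> \<in> space M. \<forall>i\<le>k. X i \<omega> = h i})"

definition visits :: "(nat \<Rightarrow> nat) \<Rightarrow> nat \<Rightarrow> nat set" where
  "visits w x = {k. w k = x}"

definition upvisits :: "(nat \<Rightarrow> nat) \<Rightarrow> nat \<Rightarrow> nat set" where
  "upvisits w x = {k. w k = x \<and> w (Suc k) = x + 1}"

definition Cab :: "(nat \<Rightarrow> nat) \<Rightarrow> nat \<Rightarrow> nat \<Rightarrow> nat set" where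
  "Cab w a b = {x. finite (visits w x) \<and> card (visits w x) = a \<and>
                   finite (upvisits w x) \<and> card (upvisits w x) = b}"

definition Cstar :: "(nat \<Rightarrow> nat) \<Rightarrow> nat \<Rightarrow> nat set" where
  "Cstar w a = {x. finite (upvisits w x) \<and> card (upvisits w x) = a}"

definition Cw :: "(nat \<Rightarrow> nat) \<Rightarrow> nat set" where
  "Cw w = {R. \<exists>k. w k = R \<and> (\<forall>i<k. w i \<le> R) \<and> (\<forall>i>k. w i \<ge> R)}"

definition Exp1 :: "real measure" where
  "Exp1 = density lborel (exponential_density 1)"

end

theory Submission
  imports Defs "HOL-Real_Asymp.Real_Asymp"
begin

text \<open>
Record at every site \<open>y\<close> the list of exits (up or down) that the walk makes from it. By transience
this list is finite and ends with an up-step, and the number of down-steps from \<open>y + 1\<close> is one less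
than the number of up-steps from \<open>y\<close>. Conversely every family of lists that is consistent in this
sense below a level \<open>L\<close> is executed by exactly one path up to the hitting time of \<open>L\<close>, which gives
its probability; \<open>L \<rightarrow> \<infinity>\<close> yields the joint law of the lists. Write \<open>V y\<close> for the number of up-steps
from \<open>y\<close> minus one. For \<open>p y = 1/2 + 1/(2y)\<close>, given the lists up to \<open>y \<ge> 1\<close>, the list at \<open>y + 1\<close>
equals any given admissible list \<open>t\<close> with probability \<open>2 ^ - length t\<close>. Hence \<open>V\<close> is a homogeneous
Markov chain with \<open>P(i, j) = (i + j choose i) 2 ^ -(i + j + 1)\<close>, and \<open>m P\<^sup>m(i, j) \<rightarrow> 1\<close> for all \<open>i\<close>, \<open>j\<close>.

Each of the three random sets is described by the lists: \<open>x \<in> C(*, a)\<close> iff \<open>V x = a - 1\<close>;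
\<open>x \<in> C(a, b)\<close> iff \<open>V (x - 1) = a - b\<close> and \<open>V x = b - 1\<close>; and \<open>x\<close> is a weak cutpoint iff in the list
at \<open>x\<close> all down-steps precede all up-steps. All three are delayed renewal sets whose renewal
sequence satisfies \<open>u(1) + \<dots> + u(n) \<sim> c ln n\<close>. Therefore the \<open>k\<close>-th binomial moment of the number of
points up to \<open>n\<close> is asymptotic to \<open>(c ln n) ^ k\<close>, that is, the moments of the normalised count
converge to \<open>k!\<close>, the moments of the exponential law, which they determine.
\<close>

section \<open>Method of moments for the exponential law\<close>

text \<open>The weight \<open>2 ^ - length t\<close> comes from a fair coin hidden in the walk. The
  function \<open>1 / y\<close> is harmonic at \<open>y \<ge> 2\<close>, so return and escape
  probabilities are explicit; charging each exit with the chance of the excursion that it starts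
  turns every up- and every down-step into a factor 1/2.

  The limit 1 is the same for all pairs of states because \<open>P\<close> is symmetric, so that
  counting measure is invariant.

  Two obstacles shape the proof. Transience and the balance of crossings are not argued path by
  path: lower bounds for the lists are proved, and they already exhaust the mass 1. And only partial
  sums of the renewal sequences are controlled; this is enough because the logarithm varies slowly,
  so that replacing \<open>n\<close> by \<open>n div 2\<close> is invisible in the limit.\<close>

lemma taylor_bound_fourier_moment:
  fixes N :: "real measure" and t h :: real
  assumes "real_distribution N" and nonneg: "AE x in N. 0 \<le> x"
    and int: "\<And>k. integrable N (\<lambda>x. x ^ k)"
  shows "cmod ((CLINT x|N. of_real (x ^ k) * iexp ((t + h) * x))
           - (\<Sum>j\<le>m. (\<i> * of_real h) ^ j / fact j * (CLINT x|N. of_real (x ^ (k + j)) * iexp (t * x))))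
         \<le> \<bar>h\<bar> ^ Suc m / fact (Suc m) * (\<integral>x. x ^ (k + Suc m) \<partial>N)"
proof -
  interpret real_distribution N by fact
  \<comment> \<open>Up to a power of the imaginary unit, the integral of \<open>F l s\<close> is the
    derivative of order \<open>l\<close> of the characteristic function at \<open>s\<close>.
    Expanding about an arbitrary \<open>t\<close>, not only about 0, is what allows convergence to
    be continued along the line.\<close>
  define F where "F l s x = of_real (x ^ l) * iexp (s * x)" for l s and x :: real
  define D where "D x = F k (t + h) x - (\<Sum>j\<le>m. (\<i> * of_real h) ^ j / fact j * F (k + j) t x)" for x
  have ci: "complex_integrable N (F l s)" for l s
    unfolding F_def
    by (rule Bochner_Integration.integrable_bound[OF int[of l]])
       (auto simp: norm_mult norm_power simp del: of_real_power of_real_mult)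
  have Di: "complex_integrable N D"
    unfolding D_def by (intro Bochner_Integration.integrable_diff Bochner_Integration.integrable_sum
          Bochner_Integration.integrable_mult_right ci)
  have bound: "cmod (D x) \<le> \<bar>h\<bar> ^ Suc m / fact (Suc m) * x ^ (k + Suc m)" if "0 \<le> x" for x
  proof -
    have "D x = of_real (x ^ k) * iexp (t * x) * (iexp (h * x) - (\<Sum>j\<le>m. (\<i> * of_real (h * x)) ^ j / fact j))"
      unfolding D_def F_def
      by (simp add: algebra_simps exp_add sum_distrib_left power_add power_mult_distrib)
    then have "cmod (D x) = x ^ k * cmod (iexp (h * x) - (\<Sum>j\<le>m. (\<i> * of_real (h * x)) ^ j / fact j))"
      using that by (simp add: norm_mult norm_power)
    also have "\<dots> \<le> x ^ k * (\<bar>h * x\<bar> ^ Suc m / fact (Suc m))"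
      using that by (intro mult_left_mono iexp_approx1) auto
    also have "\<dots> = \<bar>h\<bar> ^ Suc m / fact (Suc m) * x ^ (k + Suc m)"
      using that by (simp add: abs_mult power_mult_distrib power_add)
    finally show ?thesis .
  qed
  have 1: "(CLINT x|N. F k (t + h) x)
           - (\<Sum>j\<le>m. (\<i> * of_real h) ^ j / fact j * (CLINT x|N. F (k + j) t x)) = (CLINT x|N. D x)"
    unfolding D_def using ci
    by (subst Bochner_Integration.integral_diff) (auto intro!: Bochner_Integration.integrable_sum)
  have 2: "cmod (CLINT x|N. D x) \<le> (\<integral>x. cmod (D x) \<partial>N)"
    by (rule integral_norm_bound)
  have 3: "(\<integral>x. cmod (D x) \<partial>N) \<le> (\<integral>x. \<bar>h\<bar> ^ Suc m / fact (Suc m) * x ^ (k + Suc m) \<partial>N)"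
    using nonneg bound
    by (intro integral_mono_AE integrable_norm Di Bochner_Integration.integrable_mult_right int) auto
  show ?thesis
    using order_trans[OF 2 3] unfolding 1[symmetric] F_def by (simp only: integral_mult_right_zero)
qed

text \<open>With moments of size \<open>fact k\<close>, this makes the Taylor remainder of order
  \<open>m\<close> geometric in \<open>m\<close>, with ratio twice the step width.\<close>

lemma fact_ratio_le: "fact (k + m) / fact m \<le> (fact k * 2 ^ (k + m) :: real)"
proof -
  have "fact (k + m) = (fact k * fact m * real ((k + m) choose k) :: real)"
    by (simp add: binomial_fact)
  moreover have "real ((k + m) choose k) \<le> 2 ^ (k + m)"
    using binomial_le_pow2[of "k+m" k] by (metis of_nat_le_iff of_nat_numeral of_nat_power)
  ultimately show ?thesis by (simp add: field_simps)
qed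

text \<open>Levy's theorem reduces the claim to characteristic functions. What is carried along the
  line is the convergence of all derivatives \<open>G (\<mu> n) k t\<close> at once, because the
  expansion at \<open>t\<close> uses every one of them.\<close>

lemma weak_conv_m_method_of_moments:
  fixes \<mu> :: "nat \<Rightarrow> real measure" and \<nu> :: "real measure"
  assumes \<mu>: "\<And>n. real_distribution (\<mu> n)" "\<And>n. AE x in \<mu> n. 0 \<le> x" "\<And>n k. integrable (\<mu> n) (\<lambda>x. x ^ k)"
    and \<nu>: "real_distribution \<nu>" "AE x in \<nu>. 0 \<le> x" "\<And>k. integrable \<nu> (\<lambda>x. x ^ k)"
    and growth: "\<And>k. (\<integral>x. x ^ k \<partial>\<nu>) \<le> fact k"
    and lim: "\<And>k. (\<lambda>n. \<integral>x. x ^ k \<partial>\<mu> n) \<longlonglongrightarrow> (\<integral>x. x ^ k \<partial>\<nu>)"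
  shows "weak_conv_m \<mu> \<nu>"
proof -
  define G where "G N k t = (CLINT x|N. of_real (x ^ k) * iexp (t * x))" for N k t
  \<comment> \<open>The moments are only bounded by \<open>k!\<close>, so the Taylor series has radius of convergence 1;
    convergence at \<open>t\<close> is therefore carried to \<open>t + h\<close> in small steps.\<close>
  have step: "(\<lambda>n. G (\<mu> n) k (t + h)) \<longlonglongrightarrow> G \<nu> k (t + h)"
    if H: "\<And>k. (\<lambda>n. G (\<mu> n) k t) \<longlonglongrightarrow> G \<nu> k t" and h: "\<bar>h\<bar> \<le> 1/4" for k t h
  proof -
    define S where "S N m = (\<Sum>j\<le>m. (\<i> * of_real h) ^ j / fact j * G N (k + j) t)" for N m
    define R where "R N m = \<bar>h\<bar> ^ Suc m / fact (Suc m) * (\<integral>x. x ^ (k + Suc m) \<partial>N)" for N m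
    have T: "cmod (G N k (t + h) - S N m) \<le> R N m"
      if "real_distribution N" "AE x in N. 0 \<le> x" "\<And>k. integrable N (\<lambda>x. x ^ k)" for N m
      using taylor_bound_fourier_moment[OF that, of k t h m] unfolding G_def S_def R_def .
    \<comment> \<open>The step width contributes 1/4 per order and \<open>fact_ratio_le\<close> a
      factor 2, so the ratio 1/2 remains.\<close>
    have Rle: "R \<nu> m \<le> fact k * 2 ^ k * (1/2) ^ Suc m" for m
    proof -
      have "R \<nu> m \<le> \<bar>h\<bar> ^ Suc m / fact (Suc m) * fact (k + Suc m)"
        unfolding R_def by (intro mult_left_mono growth) auto
      also have "\<dots> = \<bar>h\<bar> ^ Suc m * (fact (k + Suc m) / fact (Suc m))" by simp
      also have "\<dots> \<le> (1/4) ^ Suc m * (fact k * 2 ^ (k + Suc m))"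
        using h by (intro mult_mono power_mono fact_ratio_le) auto
      also have "\<dots> = fact k * 2 ^ k * ((1/4) ^ Suc m * 2 ^ Suc m)"
        by (simp add: power_add)
      also have "((1/4) ^ Suc m * 2 ^ Suc m :: real) = (1/2) ^ Suc m"
        unfolding power_mult_distrib[symmetric] by simp
      finally show ?thesis .
    qed
    show ?thesis
    proof (rule metric_LIMSEQ_I)
      fix e :: real assume e: "0 < e"
      have "(\<lambda>m. fact k * 2 ^ k * (1/2) ^ Suc m) \<longlonglongrightarrow> (fact k * 2 ^ k * 0 :: real)"
        by (intro tendsto_mult tendsto_const LIMSEQ_Suc LIMSEQ_power_zero) auto
      then have "eventually (\<lambda>m. fact k * 2 ^ k * (1/2) ^ Suc m < e/4) sequentially"
        by (rule order_tendstoD(2)) (use e in auto)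
      then obtain m where m: "fact k * 2 ^ k * (1/2) ^ Suc m < e/4"
        by (auto simp: eventually_sequentially)
      have "(\<lambda>n. S (\<mu> n) m) \<longlonglongrightarrow> S \<nu> m"
        unfolding S_def by (intro tendsto_sum tendsto_mult tendsto_const H)
      then have ev1: "eventually (\<lambda>n. dist (S (\<mu> n) m) (S \<nu> m) < e/4) sequentially"
        using e by (intro tendstoD) auto
      \<comment> \<open>The factorial bound is assumed for \<open>\<nu>\<close> only. For fixed
        \<open>m\<close> the remainder contains a single moment of \<open>\<mu> n\<close>, and that
        moment converges.\<close>
      have "(\<lambda>n. R (\<mu> n) m) \<longlonglongrightarrow> R \<nu> m"
        unfolding R_def by (intro tendsto_mult tendsto_const lim)
      moreover have "R \<nu> m < e/4" using Rle[of m] m by simp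
      ultimately have ev2: "eventually (\<lambda>n. R (\<mu> n) m < e/4) sequentially"
        by (intro order_tendstoD(2))
      have "eventually (\<lambda>n. dist (G (\<mu> n) k (t + h)) (G \<nu> k (t + h)) < e) sequentially"
        using ev1 ev2
      proof eventually_elim
        case (elim n)
        have "cmod (G (\<mu> n) k (t + h) - S (\<mu> n) m) < e/4"
          using T[OF \<mu>, of n m] elim by simp
        moreover have "cmod (G \<nu> k (t + h) - S \<nu> m) < e/4"
          using T[OF \<nu>, of m] \<open>R \<nu> m < e/4\<close> by simp
        moreover have "dist (G (\<mu> n) k (t + h)) (G \<nu> k (t + h)) \<le> dist (G (\<mu> n) k (t + h)) (S (\<mu> n) m)
            + dist (S (\<mu> n) m) (S \<nu> m) + dist (G \<nu> k (t + h)) (S \<nu> m)"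
          using dist_triangle[of "G (\<mu> n) k (t + h)" "G \<nu> k (t + h)" "S (\<mu> n) m"]
            dist_triangle2[of "S (\<mu> n) m" "G \<nu> k (t + h)" "S \<nu> m"] by simp
        ultimately show ?case using elim(1) e unfolding dist_norm[symmetric] by linarith
      qed
      then show "\<exists>no. \<forall>n\<ge>no. dist (G (\<mu> n) k (t + h)) (G \<nu> k (t + h)) < e"
        by (simp add: eventually_sequentially)
    qed
  qed
  have iter: "(\<lambda>n. G (\<mu> n) k (real l * h)) \<longlonglongrightarrow> G \<nu> k (real l * h)" if h: "\<bar>h\<bar> \<le> 1/4" for k l h
  proof (induction l arbitrary: k)
    case 0
    have "G N k 0 = of_real (\<integral>x. x ^ k \<partial>N)" for N k
      unfolding G_def by (simp flip: of_real_power)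
    then show ?case using lim[of k] by (simp add: tendsto_of_real)
  next
    case (Suc l)
    show ?case using step[OF Suc h, of k] by (simp add: algebra_simps)
  qed
  have "(\<lambda>n. G (\<mu> n) 0 t) \<longlonglongrightarrow> G \<nu> 0 t" for t
  proof -
    obtain l :: nat where l: "4 * \<bar>t\<bar> < real l" using reals_Archimedean2 by blast
    then have l0: "real l > 0" by linarith
    have "\<bar>t / real l\<bar> \<le> 1/4" using l l0 by (simp add: field_simps)
    from iter[OF this, of 0 l] show ?thesis using l0 by simp
  qed
  then have "(\<lambda>n. char (\<mu> n) t) \<longlonglongrightarrow> char \<nu> t" for t
    by (simp add: G_def char_def)
  with \<mu>(1) \<nu>(1) show ?thesis by (rule levy_continuity)
qed

lemma Exp1_moments:
  shows "real_distribution Exp1" "AE x in Exp1. 0 \<le> x" "integrable Exp1 (\<lambda>x. x ^ k)"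
    "(\<integral>x. x ^ k \<partial>Exp1) = fact k"
proof -
  interpret prob_space Exp1
    unfolding Exp1_def by (rule prob_space_exponential_density) simp
  show "real_distribution Exp1" 
    using prob_space_axioms by (simp add: real_distribution_def real_distribution_axioms_def Exp1_def)
  have D: "distributed Exp1 lborel (\<lambda>x. x) (exponential_density 1)"
    unfolding distributed_def by (auto simp: Exp1_def distr_id2)
  show "integrable Exp1 (\<lambda>x. x ^ k)" by (rule erlang_ith_moment_integrable[OF _ D]) simp
  show "(\<integral>x. x ^ k \<partial>Exp1) = fact k" using erlang_ith_moment[OF _ D, of k] by simp
  show "AE x in Exp1. 0 \<le> x"
    unfolding Exp1_def by (subst AE_density) (auto simp: exponential_density_def)
qed

section \<open>Counting the points of a renewal set\<close>

text \<open>Trades one power of \<open>x\<close> for one more unit of binomial degree, with a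
  correction of lower order.\<close>

lemma real_mult_choose:
  "real x * real (x choose k) = real (Suc k) * real (x choose Suc k) + real k * real (x choose k)"
proof (cases "k \<le> x")
  case True
  have "(x - k) * (x choose k) = Suc k * (x choose Suc k)"
    using binomial_absorb_comp[of x k] binomial_absorption[of k x] by (metis mult.commute)
  then have "(real x - real k) * real (x choose k) = real (Suc k) * real (x choose Suc k)"
    using True by (metis of_nat_diff of_nat_mult)
  then show ?thesis by (simp add: algebra_simps)
qed (simp add: binomial_eq_0)

lemma (in prob_space) moments_of_binomial_moments:
  fixes N :: "nat \<Rightarrow> 'a \<Rightarrow> nat" and scale :: "nat \<Rightarrow> real"
  assumes N[measurable]: "\<And>n. N n \<in> measurable M (count_space UNIV)"
    and bound: "\<And>n \<omega>. N n \<omega> \<le> n"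
    and scale: "filterlim scale at_top sequentially"
    and lim: "\<And>k. (\<lambda>n. expectation (\<lambda>\<omega>. real (N n \<omega> choose k)) / scale n ^ k) \<longlonglongrightarrow> 1"
  shows "(\<lambda>n. expectation (\<lambda>\<omega>. (real (N n \<omega>) / scale n) ^ k)) \<longlonglongrightarrow> fact k"
proof -
  have int: "integrable M (\<lambda>\<omega>. real (N n \<omega>) ^ d * real (N n \<omega> choose k))" for n d k
  proof (rule integrable_const_bound)
    show "AE \<omega> in M. norm (real (N n \<omega>) ^ d * real (N n \<omega> choose k)) \<le> real n ^ d * 2 ^ n"
    proof (rule AE_I2)
      fix \<omega>
      have "real (N n \<omega> choose k) \<le> 2 ^ N n \<omega>"
        using binomial_le_pow2[of "N n \<omega>" k] by (metis of_nat_le_iff of_nat_numeral of_nat_power)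
      also have "\<dots> \<le> 2 ^ n" using bound[of n \<omega>] by (intro power_increasing) auto
      finally show "norm (real (N n \<omega>) ^ d * real (N n \<omega> choose k)) \<le> real n ^ d * 2 ^ n"
        using bound[of n \<omega>] by (auto intro!: mult_mono power_mono simp: norm_mult norm_power)
    qed
  qed simp
  \<comment> \<open>Mixed moments make the induction close: each step lowers the power
    \<open>d\<close> and raises the binomial degree, while the correction term lacks one factor
    \<open>scale n\<close> and vanishes. The case \<open>k = 0\<close> is the claim.\<close>
  have "(\<lambda>n. expectation (\<lambda>\<omega>. real (N n \<omega>) ^ d * real (N n \<omega> choose k)) / scale n ^ (d + k))
          \<longlonglongrightarrow> fact (d + k) / fact k" for d k
  proof (induction d arbitrary: k)
    case 0
    show ?case using lim[of k] by simp
  next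
    case (Suc d)
    have eq: "expectation (\<lambda>\<omega>. real (N n \<omega>) ^ Suc d * real (N n \<omega> choose k)) / scale n ^ (Suc d + k)
       = real (Suc k) * (expectation (\<lambda>\<omega>. real (N n \<omega>) ^ d * real (N n \<omega> choose Suc k)) / scale n ^ (d + Suc k))
         + real k * (expectation (\<lambda>\<omega>. real (N n \<omega>) ^ d * real (N n \<omega> choose k)) / scale n ^ (d + k)) * inverse (scale n)" for n
    proof -
      have "expectation (\<lambda>\<omega>. real (N n \<omega>) ^ Suc d * real (N n \<omega> choose k))
        = expectation (\<lambda>\<omega>. real (Suc k) * (real (N n \<omega>) ^ d * real (N n \<omega> choose Suc k))
            + real k * (real (N n \<omega>) ^ d * real (N n \<omega> choose k)))"
      proof (intro arg_cong[where f = expectation] ext)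
        fix \<omega>
        have "real (N n \<omega>) ^ Suc d * real (N n \<omega> choose k) = real (N n \<omega>) ^ d * (real (N n \<omega>) * real (N n \<omega> choose k))"
          by simp
        then show "real (N n \<omega>) ^ Suc d * real (N n \<omega> choose k) = real (Suc k) * (real (N n \<omega>) ^ d * real (N n \<omega> choose Suc k))
            + real k * (real (N n \<omega>) ^ d * real (N n \<omega> choose k))"
          unfolding real_mult_choose by (simp add: algebra_simps)
      qed
      also have "\<dots> = real (Suc k) * expectation (\<lambda>\<omega>. real (N n \<omega>) ^ d * real (N n \<omega> choose Suc k))
            + real k * expectation (\<lambda>\<omega>. real (N n \<omega>) ^ d * real (N n \<omega> choose k))"
        by (subst Bochner_Integration.integral_add) (auto intro!: int simp del: of_nat_Suc)
      finally show ?thesis by (simp add: add_divide_distrib divide_inverse algebra_simps)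
    qed
    have "(\<lambda>n. real (Suc k) * (expectation (\<lambda>\<omega>. real (N n \<omega>) ^ d * real (N n \<omega> choose Suc k)) / scale n ^ (d + Suc k))
         + real k * (expectation (\<lambda>\<omega>. real (N n \<omega>) ^ d * real (N n \<omega> choose k)) / scale n ^ (d + k)) * inverse (scale n))
       \<longlonglongrightarrow> real (Suc k) * (fact (d + Suc k) / fact (Suc k)) + real k * (fact (d + k) / fact k) * 0"
      by (intro tendsto_add tendsto_mult tendsto_const Suc tendsto_inverse_0_at_top scale)
    moreover have "real (Suc k) * (fact (d + Suc k) / fact (Suc k)) + real k * (fact (d + k) / fact k) * 0
       = (fact (Suc d + k) / fact k :: real)"
      using fact_Suc[of k, where ?'a = real] by (simp del: fact_Suc of_nat_Suc)
    ultimately show ?case unfolding eq by simp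
  qed
  from this[of k 0] show ?thesis by (simp add: power_divide)
qed

section \<open>Iterated convolutions on the logarithmic scale\<close>

lemma LIMSEQ_ln_div2: "(\<lambda>n. ln (real (n div 2)) / ln (real n)) \<longlonglongrightarrow> 1"
proof (rule tendsto_sandwich)
  show "\<forall>\<^sub>F n in sequentially. (ln (real n) - ln 4) / ln (real n) \<le> ln (real (n div 2)) / ln (real n)"
    using eventually_ge_at_top[of 4]
  proof eventually_elim
    case (elim n)
    have "real n / 4 \<le> real (n div 2)" using elim by linarith
    then have "ln (real n / 4) \<le> ln (real (n div 2))" using elim by (subst ln_le_cancel_iff) auto
    then show ?case using elim by (intro divide_right_mono) (auto simp: ln_div)
  qed
  show "\<forall>\<^sub>F n in sequentially. ln (real (n div 2)) / ln (real n) \<le> 1"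
    using eventually_ge_at_top[of 4]
  proof eventually_elim
    case (elim n)
    then show ?case by (auto simp: divide_le_eq_1)
  qed
  have "filterlim (\<lambda>n. ln (real n)) at_top sequentially"
    by (rule filterlim_compose[OF ln_at_top filterlim_real_sequentially])
  then have "(\<lambda>n. 1 - ln 4 * inverse (ln (real n))) \<longlonglongrightarrow> 1 - ln 4 * 0"
    by (intro tendsto_intros tendsto_inverse_0_at_top)
  moreover have "\<forall>\<^sub>F n in sequentially. 1 - ln 4 * inverse (ln (real n)) = (ln (real n) - ln 4) / ln (real n)"
    using eventually_ge_at_top[of 4] by eventually_elim (simp add: field_simps)
  ultimately show "(\<lambda>n. (ln (real n) - ln 4) / ln (real n)) \<longlonglongrightarrow> 1"
    by (simp add: filterlim_cong)
qed simp

lemma sum_convolution_swap: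
  fixes u e :: "nat \<Rightarrow> real"
  shows "(\<Sum>y = 2..n. \<Sum>x = 2..<y. u (y - x) * e x) = (\<Sum>x = 2..n. e x * (\<Sum>m = 1..n - x. u m))"
proof -
  have "(\<Sum>y = 2..n. \<Sum>x = 2..<y. u (y - x) * e x) = (\<Sum>y = 2..n. \<Sum>x = 2..n. if x < y then u (y - x) * e x else 0)"
    by (intro sum.cong refl sum.mono_neutral_cong_left) auto
  also have "\<dots> = (\<Sum>x = 2..n. \<Sum>y = 2..n. if x < y then u (y - x) * e x else 0)"
    by (rule sum.swap)
  also have "\<dots> = (\<Sum>x = 2..n. e x * (\<Sum>m = 1..n - x. u m))"
  proof (intro sum.cong refl)
    fix x assume x: "x \<in> {2..n}"
    have "(\<Sum>y = 2..n. if x < y then u (y - x) * e x else 0) = (\<Sum>y = x+1..n. u (y - x) * e x)"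
      using x by (intro sum.mono_neutral_cong_right) auto
    also have "\<dots> = (\<Sum>m = 1..n - x. u m * e x)"
      using x by (intro sum.reindex_bij_witness[of _ "\<lambda>m. m + x" "\<lambda>y. y - x"]) auto
    finally show "(\<Sum>y = 2..n. if x < y then u (y - x) * e x else 0) = e x * (\<Sum>m = 1..n - x. u m)"
      by (simp add: sum_distrib_left mult_ac)
  qed
  finally show ?thesis .
qed

text \<open>The convolution up to \<open>n\<close> sums over the triangle
  \<open>x + m \<le> n\<close>. This triangle contains the square of side \<open>n div 2\<close> and
  lies in the square of side \<open>n\<close>, and on squares the sum factorises. By
  \<open>LIMSEQ_ln_div2\<close> both products have the same limit, so no regularity of
  \<open>u\<close> itself enters.\<close>

lemma LIMSEQ_iterated_convolution:
  fixes u :: "nat \<Rightarrow> real" and e :: "nat \<Rightarrow> nat \<Rightarrow> real"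
  assumes u: "\<And>m. 0 \<le> u m" and e0: "\<And>x. 0 \<le> e 0 x"
    and eS: "\<And>k y. e (Suc k) y = (\<Sum>x = 2..<y. u (y - x) * e k x)"
    and U: "(\<lambda>n. (\<Sum>m = 1..n. u m) / ln (real n)) \<longlonglongrightarrow> c"
    and E0: "(\<lambda>n. (\<Sum>x = 2..n. e 0 x) / ln (real n)) \<longlonglongrightarrow> c"
  shows "(\<lambda>n. (\<Sum>x = 2..n. e k x) / ln (real n) ^ Suc k) \<longlonglongrightarrow> c ^ Suc k"
proof (induction k)
  case 0
  show ?case using E0 by simp
next
  case (Suc k)
  have e: "0 \<le> e k x" for k x
    by (induction k arbitrary: x) (auto simp: e0 eS intro!: sum_nonneg mult_nonneg_nonneg u)
  define F where "F n = (\<Sum>x = 2..n. e k x)" for n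
  define V where "V n = (\<Sum>m = 1..n. u m)" for n
  have V0: "0 \<le> V n" for n unfolding V_def by (intro sum_nonneg u)
  have Vmono: "V i \<le> V j" if "i \<le> j" for i j
    unfolding V_def using that by (intro sum_mono2) (auto intro: u)
  have eq: "(\<Sum>x = 2..n. e (Suc k) x) = (\<Sum>x = 2..n. e k x * V (n - x))" for n
    unfolding eS V_def by (rule sum_convolution_swap)
  have upper: "(\<Sum>x = 2..n. e (Suc k) x) \<le> F n * V n" for n
    unfolding eq F_def sum_distrib_right by (intro sum_mono mult_left_mono Vmono e) auto
  have lower: "F (n div 2) * V (n div 2) \<le> (\<Sum>x = 2..n. e (Suc k) x)" for n
  proof -
    have "F (n div 2) * V (n div 2) \<le> (\<Sum>x = 2..n div 2. e k x * V (n - x))"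
      unfolding F_def sum_distrib_right by (intro sum_mono mult_left_mono Vmono e) auto
    also have "\<dots> \<le> (\<Sum>x = 2..n. e k x * V (n - x))"
      by (intro sum_mono2) (auto intro!: mult_nonneg_nonneg e V0)
    finally show ?thesis unfolding eq .
  qed
  have lim: "(\<lambda>n. F n * V n / ln (real n) ^ Suc (Suc k)) \<longlonglongrightarrow> c ^ Suc (Suc k)"
    using tendsto_mult[OF Suc U] unfolding F_def V_def by (simp add: mult_ac)
  have div2: "filterlim (\<lambda>n::nat. n div 2) sequentially sequentially"
    unfolding filterlim_at_top
  proof
    fix Z :: nat
    show "\<forall>\<^sub>F n in sequentially. Z \<le> n div 2"
      using eventually_ge_at_top[of "2 * Z"] by eventually_elim auto
  qed
  have "(\<lambda>n. F (n div 2) * V (n div 2) / ln (real (n div 2)) ^ Suc (Suc k)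
        * (ln (real (n div 2)) / ln (real n)) ^ Suc (Suc k)) \<longlonglongrightarrow> c ^ Suc (Suc k) * 1 ^ Suc (Suc k)"
    by (intro tendsto_mult filterlim_compose[OF lim div2] tendsto_power LIMSEQ_ln_div2)
  moreover have "\<forall>\<^sub>F n in sequentially. F (n div 2) * V (n div 2) / ln (real (n div 2)) ^ Suc (Suc k)
        * (ln (real (n div 2)) / ln (real n)) ^ Suc (Suc k) = F (n div 2) * V (n div 2) / ln (real n) ^ Suc (Suc k)"
    using eventually_ge_at_top[of 4]
  proof eventually_elim
    case (elim n)
    then have "ln (real (n div 2)) \<noteq> 0" by (auto simp: ln_eq_zero_iff)
    then show ?case unfolding power_divide by simp
  qed
  ultimately have "(\<lambda>n. F (n div 2) * V (n div 2) / ln (real n) ^ Suc (Suc k)) \<longlonglongrightarrow> c ^ Suc (Suc k) * 1 ^ Suc (Suc k)"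
    by (rule Lim_transform_eventually)
  then have lim': "(\<lambda>n. F (n div 2) * V (n div 2) / ln (real n) ^ Suc (Suc k)) \<longlonglongrightarrow> c ^ Suc (Suc k)"
    by simp
  show ?case
  proof (rule tendsto_sandwich[OF _ _ lim' lim])
    show "\<forall>\<^sub>F n in sequentially. F (n div 2) * V (n div 2) / ln (real n) ^ Suc (Suc k) \<le> (\<Sum>x = 2..n. e (Suc k) x) / ln (real n) ^ Suc (Suc k)"
      using eventually_ge_at_top[of 1] by eventually_elim (intro divide_right_mono lower zero_le_power, auto)
    show "\<forall>\<^sub>F n in sequentially. (\<Sum>x = 2..n. e (Suc k) x) / ln (real n) ^ Suc (Suc k) \<le> F n * V n / ln (real n) ^ Suc (Suc k)"
      using eventually_ge_at_top[of 1] by eventually_elim (intro divide_right_mono upper zero_le_power, auto)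
  qed
qed

text \<open>A binomial moment counts subsets of points. Ordering a subset and applying
  \<open>renewal\<close> to consecutive points yields an iterated convolution with \<open>u\<close>.
  For this it is enough to know the past of \<open>x\<close> through the number of earlier
  points.\<close>

lemma (in prob_space) renewal_binomial_moments:
  fixes E :: "nat \<Rightarrow> 'a set" and u :: "nat \<Rightarrow> real"
  assumes E: "\<And>x. E x \<in> sets M" and u: "\<And>m. 0 \<le> u m" and c: "0 < c"
    and renewal: "\<And>x y r. 2 \<le> x \<Longrightarrow> x < y \<Longrightarrow>
      prob ({\<omega> \<in> space M. card {z \<in> {2..<x}. \<omega> \<in> E z} = r} \<inter> E x \<inter> E y)
        = prob ({\<omega> \<in> space M. card {z \<in> {2..<x}. \<omega> \<in> E z} = r} \<inter> E x) * u (y - x)"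
    and U: "(\<lambda>n. (\<Sum>m = 1..n. u m) / ln (real n)) \<longlonglongrightarrow> c"
    and U0: "(\<lambda>n. (\<Sum>x = 2..n. prob (E x)) / ln (real n)) \<longlonglongrightarrow> c"
  shows "(\<lambda>n. expectation (\<lambda>\<omega>. real (card {z \<in> {2..n}. \<omega> \<in> E z} choose k)) / (c * ln (real n)) ^ k) \<longlonglongrightarrow> 1"
proof -
  define N where "N x \<omega> = card {z \<in> {2..<x}. \<omega> \<in> E z}" for x \<omega>
  have N_eq: "N x \<omega> = (\<Sum>z = 2..<x. of_bool (\<omega> \<in> E z))" for x \<omega>
    unfolding N_def by (simp add: Int_def)
  have Nle: "N x \<omega> \<le> x" for x \<omega>
    unfolding N_def by (rule order_trans[OF card_mono[of "{2..<x}"]]) auto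
  have NS: "N (Suc y) \<omega> = N y \<omega> + of_bool (\<omega> \<in> E y)" if "2 \<le> y" for y \<omega>
    unfolding N_eq using that by simp
  note E[measurable]
  have N_meas[measurable]: "N x \<in> measurable M (count_space UNIV)" for x
    unfolding N_eq[abs_def] by measurable
  have int: "integrable M (\<lambda>\<omega>. indicator A \<omega> * real (N x \<omega> choose k) :: real)" if [measurable]: "A \<in> sets M" for A x k
  proof (rule integrable_const_bound)
    show "AE \<omega> in M. norm (indicator A \<omega> * real (N x \<omega> choose k)) \<le> 2 ^ x"
    proof (rule AE_I2)
      fix \<omega>
      have "real (N x \<omega> choose k) \<le> 2 ^ N x \<omega>"
        using binomial_le_pow2[of "N x \<omega>" k] by (metis of_nat_le_iff of_nat_numeral of_nat_power)
      also have "\<dots> \<le> 2 ^ x" using Nle[of x \<omega>] by (intro power_increasing) auto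
      finally show "norm (indicator A \<omega> * real (N x \<omega> choose k)) \<le> 2 ^ x"
        by (auto simp: indicator_def)
    qed
  qed measurable
  \<comment> \<open>Subsets of size \<open>Suc k\<close> are sorted by their largest element
    \<open>y\<close>.\<close>
  have choose_sum: "real (N (Suc n) \<omega> choose Suc k) = (\<Sum>y = 2..n. indicator (E y) \<omega> * real (N y \<omega> choose k))" for n k \<omega>
  proof (induction n)
    case (Suc n)
    show ?case
    proof (cases "2 \<le> Suc n")
      case True
      then show ?thesis using Suc NS[OF True, of \<omega>] by (cases "\<omega> \<in> E (Suc n)") auto
    qed (simp add: N_def)
  qed (simp add: N_def)
  define e where "e k x = expectation (\<lambda>\<omega>. indicator (E x) \<omega> * real (N x \<omega> choose k))" for k x
  \<comment> \<open>\<open>renewal\<close> speaks of events; summing over the value \<open>r\<close>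
    of the count transfers it to expectations.\<close>
  have decomp: "expectation (\<lambda>\<omega>. indicator A \<omega> * real (N x \<omega> choose k))
      = (\<Sum>r\<le>x. real (r choose k) * prob ({\<omega> \<in> space M. N x \<omega> = r} \<inter> A))" if [measurable]: "A \<in> sets M" for A x k
  proof -
    have "expectation (\<lambda>\<omega>. indicator A \<omega> * real (N x \<omega> choose k))
       = expectation (\<lambda>\<omega>. \<Sum>r\<le>x. real (r choose k) * indicator ({\<omega> \<in> space M. N x \<omega> = r} \<inter> A) \<omega>)"
    proof (rule Bochner_Integration.integral_cong[OF refl])
      fix \<omega> assume \<omega>: "\<omega> \<in> space M"
      have "(\<Sum>r\<le>x. real (r choose k) * indicator ({\<omega> \<in> space M. N x \<omega> = r} \<inter> A) \<omega>)
         = (\<Sum>r\<in>{N x \<omega>}. real (r choose k) * indicator ({\<omega> \<in> space M. N x \<omega> = r} \<inter> A) \<omega>)"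
        using Nle[of x \<omega>] by (intro sum.mono_neutral_right) (auto simp: indicator_def)
      then show "indicator A \<omega> * real (N x \<omega> choose k) = (\<Sum>r\<le>x. real (r choose k) * indicator ({\<omega> \<in> space M. N x \<omega> = r} \<inter> A) \<omega>)"
        using \<omega> by (simp add: indicator_def)
    qed
    also have "\<dots> = (\<Sum>r\<le>x. real (r choose k) * prob ({\<omega> \<in> space M. N x \<omega> = r} \<inter> A))"
      by (subst Bochner_Integration.integral_sum) (auto intro!: integrable_real_mult_indicator Bochner_Integration.integrable_mult_right simp: emeasure_eq_measure)
    finally show ?thesis .
  qed
  have eS: "e (Suc k) y = (\<Sum>x = 2..<y. u (y - x) * e k x)" for k y
  proof -
    have eS1: "expectation (\<lambda>\<omega>. indicator (E x \<inter> E y) \<omega> * real (N x \<omega> choose k)) = u (y - x) * e k x"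
      if "2 \<le> x" "x < y" for x
      unfolding e_def using that renewal[OF that, folded N_def]
      by (subst (1 2) decomp) (auto simp: sum_distrib_left mult_ac Int_assoc intro!: sum.cong)
    show ?thesis
    proof (cases "y = 0")
      case False
      then obtain n where n: "y = Suc n" using not0_implies_Suc by blast
      have "e (Suc k) y = expectation (\<lambda>\<omega>. \<Sum>x = 2..<y. indicator (E x \<inter> E y) \<omega> * real (N x \<omega> choose k))"
        unfolding e_def n choose_sum sum_distrib_left
        by (intro arg_cong[where f = expectation] ext sum.cong) (auto simp: indicator_def)
      also have "\<dots> = (\<Sum>x = 2..<y. expectation (\<lambda>\<omega>. indicator (E x \<inter> E y) \<omega> * real (N x \<omega> choose k)))"
        by (intro Bochner_Integration.integral_sum int) auto
      also have "\<dots> = (\<Sum>x = 2..<y. u (y - x) * e k x)"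
        using eS1 by (intro sum.cong) auto
      finally show ?thesis .
    qed (simp add: e_def N_def)
  qed
  have e0: "e 0 x = prob (E x)" for x
    unfolding e_def using E[of x] by (simp add: emeasure_eq_measure)
  have lim: "(\<lambda>n. (\<Sum>x = 2..n. e k x) / ln (real n) ^ Suc k) \<longlonglongrightarrow> c ^ Suc k" for k
    by (rule LIMSEQ_iterated_convolution[where u = u]) (use u U U0 eS in \<open>auto simp: e0\<close>)
  show ?thesis
  proof (cases k)
    case 0
    then show ?thesis by (simp add: prob_space)
  next
    case (Suc l)
    have "expectation (\<lambda>\<omega>. real (card {z \<in> {2..n}. \<omega> \<in> E z} choose k)) = (\<Sum>x = 2..n. e l x)" for n
    proof -
      have *: "card {z \<in> {2..n}. \<omega> \<in> E z} = N (Suc n) \<omega>" for \<omega>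
        unfolding N_def by (simp add: atLeastLessThanSuc_atLeastAtMost)
      show ?thesis
        unfolding Suc e_def * choose_sum by (intro Bochner_Integration.integral_sum int E)
    qed
    then have "(\<lambda>n. expectation (\<lambda>\<omega>. real (card {z \<in> {2..n}. \<omega> \<in> E z} choose k)) / (c * ln (real n)) ^ k)
       = (\<lambda>n. (\<Sum>x = 2..n. e l x) / ln (real n) ^ Suc l * (1 / c ^ Suc l))"
      by (auto simp: Suc power_mult_distrib field_simps)
    also have "\<dots> \<longlonglongrightarrow> c ^ Suc l * (1 / c ^ Suc l)"
      by (intro tendsto_mult lim tendsto_const)
    finally show ?thesis using c by simp
  qed
qed

section \<open>Averages with harmonic weights\<close>

lemma LIMSEQ_weighted_average_0:
  fixes w a :: "nat \<Rightarrow> real"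
  assumes w: "\<And>m. 0 \<le> w m" and S: "filterlim (\<lambda>n. \<Sum>m = 1..n. w m) at_top sequentially" and a: "a \<longlonglongrightarrow> 0"
  shows "(\<lambda>n. (\<Sum>m = 1..n. w m * a m) / (\<Sum>m = 1..n. w m)) \<longlonglongrightarrow> 0"
proof (rule LIMSEQ_I)
  fix e :: real assume e: "0 < e"
  obtain N where N: "\<And>m. m \<ge> N \<Longrightarrow> \<bar>a m\<bar> < e / 2"
    using LIMSEQ_D[OF a, of "e / 2"] e by auto
  \<comment> \<open>\<open>C\<close> is the share of the first \<open>N\<close> terms; it stays
    fixed while the total weight diverges, so it is eventually below half of the tolerance.\<close>
  define C where "C = (\<Sum>m = 1..N. w m * \<bar>a m\<bar>)"
  have "eventually (\<lambda>n. 2 * C / e + 1 \<le> (\<Sum>m = 1..n. w m)) sequentially"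
    using S unfolding filterlim_at_top by blast
  then obtain n0 where n0: "\<And>n. n \<ge> n0 \<Longrightarrow> 2 * C / e + 1 \<le> (\<Sum>m = 1..n. w m)"
    by (auto simp: eventually_sequentially)
  have C0: "0 \<le> C" unfolding C_def by (intro sum_nonneg mult_nonneg_nonneg w) auto
  show "\<exists>no. \<forall>n\<ge>no. norm ((\<Sum>m = 1..n. w m * a m) / (\<Sum>m = 1..n. w m) - 0) < e"
  proof (intro exI allI impI)
    fix n assume n: "max n0 N \<le> n"
    define T where "T = (\<Sum>m = 1..n. w m)"
    have T: "2 * C / e + 1 \<le> T" using n0[of n] n by (simp add: T_def)
    have T0: "0 < T" using T C0 e by (smt (verit) divide_nonneg_pos)
    have "\<bar>\<Sum>m = 1..n. w m * a m\<bar> \<le> (\<Sum>m = 1..n. w m * \<bar>a m\<bar>)"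
      by (rule order_trans[OF sum_abs]) (simp add: abs_mult w)
    also have "\<dots> \<le> (\<Sum>m = 1..n. (if m \<le> N then w m * \<bar>a m\<bar> else 0) + w m * (e / 2))"
    proof (intro sum_mono)
      fix m
      show "w m * \<bar>a m\<bar> \<le> (if m \<le> N then w m * \<bar>a m\<bar> else 0) + w m * (e / 2)"
        using N[of m] w[of m] e mult_left_mono[of "\<bar>a m\<bar>" "e / 2" "w m"] by auto
    qed
    also have "\<dots> = C + T * (e / 2)"
    proof -
      have "(\<Sum>m = 1..n. if m \<le> N then w m * \<bar>a m\<bar> else 0) = C"
        unfolding C_def using n by (intro sum.mono_neutral_cong_right) auto
      then show ?thesis by (simp add: sum.distrib T_def sum_distrib_right)
    qed
    finally have "\<bar>\<Sum>m = 1..n. w m * a m\<bar> \<le> C + T * (e / 2)" .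
    moreover have "C < T * (e / 2)"
    proof -
      have "2 * C / e < T" using T by simp
      then show ?thesis using e by (simp add: field_simps)
    qed
    ultimately have "\<bar>\<Sum>m = 1..n. w m * a m\<bar> < e * T" by (simp add: field_simps)
    then show "norm ((\<Sum>m = 1..n. w m * a m) / (\<Sum>m = 1..n. w m) - 0) < e"
      using T0 unfolding T_def[symmetric] by (simp add: abs_divide divide_less_eq)
  qed
qed

lemma LIMSEQ_inverse_ln: "(\<lambda>n. inverse (ln (real n))) \<longlonglongrightarrow> 0"
  by (rule tendsto_inverse_0_at_top) (rule filterlim_compose[OF ln_at_top filterlim_real_sequentially])

lemma LIMSEQ_sum_over_ln:
  fixes f :: "nat \<Rightarrow> real"
  assumes f: "(\<lambda>m. real (Suc m) * f m) \<longlonglongrightarrow> c"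
  shows "(\<lambda>n. (\<Sum>m = 1..n. f m) / ln (real n)) \<longlonglongrightarrow> c"
    and "(\<lambda>n. (\<Sum>m = 2..n. f m) / ln (real n)) \<longlonglongrightarrow> c"
proof -
  \<comment> \<open>Then \<open>f m\<close> is \<open>w m\<close> times a convergent sequence, and
    the weights have total \<open>harm (Suc n) - 1\<close>, which is asymptotic to
    \<open>ln n\<close> by the limit defining the Euler-Mascheroni constant.\<close>
  define w where "w m = 1 / real (Suc m)" for m
  define S where "S n = (\<Sum>m = 1..n. w m)" for n
  have Sharm: "S n = harm (Suc n) - 1" for n
    by (induction n) (simp_all add: S_def w_def harm_Suc harm_expand(1) inverse_eq_divide)
  have lnt: "filterlim (\<lambda>n. ln (real n)) at_top sequentially"
    by (rule filterlim_compose[OF ln_at_top filterlim_real_sequentially])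
  have "(\<lambda>n. (harm n - ln (real n)) * inverse (ln (real n)) + (inverse (real (Suc n)) - 1) * inverse (ln (real n)) + 1)
     \<longlonglongrightarrow> euler_mascheroni * 0 + (0 - 1) * 0 + 1"
    by (intro tendsto_intros euler_mascheroni_LIMSEQ LIMSEQ_inverse_ln LIMSEQ_inverse_real_of_nat)
  moreover have "\<forall>\<^sub>F n in sequentially. (harm n - ln (real n)) * inverse (ln (real n)) + (inverse (real (Suc n)) - 1) * inverse (ln (real n)) + 1
      = S n / ln (real n)"
    using eventually_ge_at_top[of 2]
  proof eventually_elim
    case (elim n)
    then have "ln (real n) \<noteq> 0" by simp
    moreover have "S n = harm n + inverse (real (Suc n)) - 1" unfolding Sharm by (simp add: harm_Suc)
    moreover have "(H - l) * inverse l + (i - 1) * inverse l + 1 = (H + i - 1) / l" if "l \<noteq> 0" for H l i :: real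
      using that by (simp add: field_simps)
    ultimately show ?case by (simp only:)
  qed
  ultimately have "(\<lambda>n. S n / ln (real n)) \<longlonglongrightarrow> euler_mascheroni * 0 + (0 - 1) * 0 + 1"
    by (rule Lim_transform_eventually)
  then have SL: "(\<lambda>n. S n / ln (real n)) \<longlonglongrightarrow> 1" by simp
  have St: "filterlim S at_top sequentially"
  proof -
    have "filterlim (\<lambda>n. S n / ln (real n) * ln (real n)) at_top sequentially"
      by (rule filterlim_tendsto_pos_mult_at_top[OF SL _ lnt]) simp
    moreover have "\<forall>\<^sub>F n in sequentially. S n / ln (real n) * ln (real n) = S n"
      using eventually_ge_at_top[of 2] by eventually_elim simp
    ultimately show ?thesis by (subst (asm) filterlim_cong[OF refl refl])
  qed
  have "(\<lambda>n. (\<Sum>m = 1..n. w m * (real (Suc m) * f m - c)) / S n) \<longlonglongrightarrow> 0"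
    unfolding S_def
  proof (rule LIMSEQ_weighted_average_0)
    show "(\<lambda>m. real (Suc m) * f m - c) \<longlonglongrightarrow> 0" using tendsto_diff[OF f tendsto_const[of c]] by simp
  qed (use St in \<open>auto simp: w_def S_def[abs_def]\<close>)
  then have "(\<lambda>n. ((\<Sum>m = 1..n. w m * (real (Suc m) * f m - c)) / S n + c) * (S n / ln (real n))) \<longlonglongrightarrow> (0 + c) * 1"
    by (intro tendsto_intros SL)
  moreover have "\<forall>\<^sub>F n in sequentially. ((\<Sum>m = 1..n. w m * (real (Suc m) * f m - c)) / S n + c) * (S n / ln (real n))
      = (\<Sum>m = 1..n. f m) / ln (real n)"
    using filterlim_at_top_dense[THEN iffD1, OF St, rule_format, of 0]
  proof eventually_elim
    case (elim n)
    have "w m * (real (Suc m) * f m - c) = f m - c * w m" for m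
      unfolding w_def by (simp add: field_simps)
    then have "(\<Sum>m = 1..n. w m * (real (Suc m) * f m - c)) = (\<Sum>m = 1..n. f m) - c * S n"
      by (simp add: sum_subtractf S_def sum_distrib_left)
    moreover have "((F - c * s) / s + c) * (s / l) = F / l" if "0 < s" for F s l :: real
      using that by (simp add: diff_divide_distrib)
    ultimately show ?case using elim by (simp only:)
  qed
  ultimately have "(\<lambda>n. (\<Sum>m = 1..n. f m) / ln (real n)) \<longlonglongrightarrow> (0 + c) * 1"
    by (rule Lim_transform_eventually)
  then show 1: "(\<lambda>n. (\<Sum>m = 1..n. f m) / ln (real n)) \<longlonglongrightarrow> c" by simp
  have "(\<lambda>n. (\<Sum>m = 1..n. f m) / ln (real n) - f 1 * inverse (ln (real n))) \<longlonglongrightarrow> c - f 1 * 0"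
    by (intro tendsto_intros 1 LIMSEQ_inverse_ln)
  moreover have "\<forall>\<^sub>F n in sequentially. (\<Sum>m = 1..n. f m) / ln (real n) - f 1 * inverse (ln (real n)) = (\<Sum>m = 2..n. f m) / ln (real n)"
    using eventually_ge_at_top[of 1]
  proof eventually_elim
    case (elim n)
    have "(\<Sum>m = 1..n. f m) = f 1 + (\<Sum>m = 2..n. f m)"
      using elim by (simp add: sum.atLeast_Suc_atMost numeral_2_eq_2)
    then show ?case by (simp add: divide_inverse distrib_right)
  qed
  ultimately have "(\<lambda>n. (\<Sum>m = 2..n. f m) / ln (real n)) \<longlonglongrightarrow> c - f 1 * 0"
    by (rule Lim_transform_eventually)
  then show "(\<lambda>n. (\<Sum>m = 2..n. f m) / ln (real n)) \<longlonglongrightarrow> c" by simp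
qed

text \<open>The renewal structure starts at site 2, because the list at a site has the homogeneous
  conditional law only from there on. Site 1 changes the count by at most one, which affects
  binomial moments only at lower order.\<close>

lemma (in prob_space) renewal_set_exponential_limit:
  fixes C :: "'a \<Rightarrow> nat set" and E :: "nat \<Rightarrow> 'a set" and u :: "nat \<Rightarrow> real"
  assumes C: "\<And>x. {\<omega> \<in> space M. x \<in> C \<omega>} \<in> sets M"
    and CE: "AE \<omega> in M. \<forall>x\<ge>2. x \<in> C \<omega> \<longleftrightarrow> \<omega> \<in> E x"
    and E: "\<And>x. E x \<in> sets M" and u: "\<And>m. 0 \<le> u m" and c: "0 < c"
    and renewal: "\<And>x y r. 2 \<le> x \<Longrightarrow> x < y \<Longrightarrow>
      prob ({\<omega> \<in> space M. card {z \<in> {2..<x}. \<omega> \<in> E z} = r} \<inter> E x \<inter> E y)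
        = prob ({\<omega> \<in> space M. card {z \<in> {2..<x}. \<omega> \<in> E z} = r} \<inter> E x) * u (y - x)"
    and U: "(\<lambda>n. (\<Sum>m = 1..n. u m) / ln (real n)) \<longlonglongrightarrow> c"
    and U0: "(\<lambda>n. (\<Sum>x = 2..n. prob (E x)) / ln (real n)) \<longlonglongrightarrow> c"
  shows "weak_conv_m (\<lambda>n. distr M borel (\<lambda>\<omega>. real (card (C \<omega> \<inter> {1..n})) / (c * ln (real n)))) Exp1"
proof -
  define N where "N n \<omega> = card (C \<omega> \<inter> {1..n})" for n \<omega>
  define N' where "N' n \<omega> = card {z \<in> {2..n}. \<omega> \<in> E z}" for n \<omega>
  have N_le: "N n \<omega> \<le> n" for n \<omega>
    unfolding N_def by (rule order_trans[OF card_mono[of "{1..n}"]]) auto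
  have N'_le: "N' n \<omega> \<le> n" for n \<omega>
    unfolding N'_def by (rule order_trans[OF card_mono[of "{2..n}"]]) auto
  have N_meas[measurable]: "N n \<in> measurable M (count_space UNIV)" for n
  proof -
    have [measurable]: "Measurable.pred M (\<lambda>\<omega>. x \<in> C \<omega>)" for x using C by (simp add: pred_def)
    have "N n = (\<lambda>\<omega>. \<Sum>x = 1..n. of_bool (x \<in> C \<omega>))"
      by (rule ext) (simp add: N_def Int_commute)
    then show ?thesis by simp
  qed
  have N'_meas[measurable]: "N' n \<in> measurable M (count_space UNIV)" for n
  proof -
    note E[measurable]
    have "N' n = (\<lambda>\<omega>. \<Sum>x = 2..n. of_bool (\<omega> \<in> E x))"
      by (rule ext) (simp add: N'_def Int_def)
    then show ?thesis by simp
  qed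
  have NN': "AE \<omega> in M. N' n \<omega> \<le> N n \<omega> \<and> N n \<omega> \<le> Suc (N' n \<omega>)" for n
    using CE
  proof eventually_elim
    case (elim \<omega>)
    have 1: "{z \<in> {2..n}. \<omega> \<in> E z} \<subseteq> C \<omega> \<inter> {1..n}" "C \<omega> \<inter> {1..n} \<subseteq> insert 1 {z \<in> {2..n}. \<omega> \<in> E z}"
      using elim by auto
    have "N n \<omega> \<le> card (insert 1 {z \<in> {2..n}. \<omega> \<in> E z})"
      unfolding N_def by (intro card_mono 1) auto
    also have "\<dots> \<le> Suc (N' n \<omega>)" unfolding N'_def by (rule card_insert_le_m1) auto
    finally show ?case using card_mono[OF _ 1(1)] by (simp add: N_def N'_def)
  qed
  have int: "integrable M (\<lambda>\<omega>. real (f \<omega> choose k))" if [measurable]: "f \<in> measurable M (count_space UNIV)" and le: "\<And>\<omega>. f \<omega> \<le> n" for f n k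
  proof (rule integrable_const_bound)
    show "AE \<omega> in M. norm (real (f \<omega> choose k)) \<le> 2 ^ n"
    proof (rule AE_I2)
      fix \<omega>
      have "real (f \<omega> choose k) \<le> 2 ^ f \<omega>"
        using binomial_le_pow2[of "f \<omega>" k] by (metis of_nat_le_iff of_nat_numeral of_nat_power)
      also have "\<dots> \<le> 2 ^ n" using le[of \<omega>] by (intro power_increasing) auto
      finally show "norm (real (f \<omega> choose k)) \<le> 2 ^ n" by simp
    qed
  qed measurable
  define b where "b k n = expectation (\<lambda>\<omega>. real (N' n \<omega> choose k)) / (c * ln (real n)) ^ k" for k n
  have b: "(\<lambda>n. b k n) \<longlonglongrightarrow> 1" for k
    unfolding b_def N'_def by (rule renewal_binomial_moments[OF E u c renewal U U0])
  have lnc: "filterlim (\<lambda>n. c * ln (real n)) at_top sequentially"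
    by (intro filterlim_tendsto_pos_mult_at_top[OF tendsto_const c] filterlim_compose[OF ln_at_top filterlim_real_sequentially])
  have binom: "(\<lambda>n. expectation (\<lambda>\<omega>. real (N n \<omega> choose k)) / (c * ln (real n)) ^ k) \<longlonglongrightarrow> 1" for k
  proof (cases k)
    case 0
    then show ?thesis by (simp add: prob_space)
  next
    case (Suc l)
    have lo: "expectation (\<lambda>\<omega>. real (N' n \<omega> choose k)) \<le> expectation (\<lambda>\<omega>. real (N n \<omega> choose k))" for n
      by (rule integral_mono_AE[OF int[OF N'_meas N'_le] int[OF N_meas N_le]])
         (use NN'[of n] in \<open>eventually_elim, simp add: binomial_right_mono\<close>)
    \<comment> \<open>By Pascal's rule the possible extra point adds the binomial moment of degree
      \<open>l = k - 1\<close>, which is smaller by one logarithm.\<close>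
    have up: "expectation (\<lambda>\<omega>. real (N n \<omega> choose k)) \<le> expectation (\<lambda>\<omega>. real (N' n \<omega> choose k)) + expectation (\<lambda>\<omega>. real (N' n \<omega> choose l))" for n
    proof -
      have "expectation (\<lambda>\<omega>. real (N n \<omega> choose k)) \<le> expectation (\<lambda>\<omega>. real (N' n \<omega> choose k) + real (N' n \<omega> choose l))"
      proof (rule integral_mono_AE[OF int[OF N_meas N_le]])
        show "integrable M (\<lambda>\<omega>. real (N' n \<omega> choose k) + real (N' n \<omega> choose l))"
          by (intro Bochner_Integration.integrable_add int[OF N'_meas N'_le])
        show "AE \<omega> in M. real (N n \<omega> choose k) \<le> real (N' n \<omega> choose k) + real (N' n \<omega> choose l)"
          using NN'[of n]
        proof eventually_elim
          case (elim \<omega>)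
          have "N n \<omega> choose k \<le> Suc (N' n \<omega>) choose k" using elim by (intro binomial_right_mono) simp
          also have "\<dots> = (N' n \<omega> choose k) + (N' n \<omega> choose l)" unfolding Suc by simp
          finally show ?case by (metis of_nat_add of_nat_mono)
        qed
      qed
      also have "\<dots> = expectation (\<lambda>\<omega>. real (N' n \<omega> choose k)) + expectation (\<lambda>\<omega>. real (N' n \<omega> choose l))"
        by (intro Bochner_Integration.integral_add int[OF N'_meas N'_le])
      finally show ?thesis .
    qed
    have "(\<lambda>n. b k n + b l n * inverse (c * ln (real n))) \<longlonglongrightarrow> 1 + 1 * 0"
      by (intro tendsto_add tendsto_mult b tendsto_inverse_0_at_top lnc)
    then have lim: "(\<lambda>n. b k n + b l n * inverse (c * ln (real n))) \<longlonglongrightarrow> 1" by simp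
    show ?thesis
    proof (rule tendsto_sandwich[OF _ _ b[of k] lim])
      show "\<forall>\<^sub>F n in sequentially. b k n \<le> expectation (\<lambda>\<omega>. real (N n \<omega> choose k)) / (c * ln (real n)) ^ k"
        using eventually_ge_at_top[of 1]
      proof eventually_elim
        case (elim n)
        show ?case unfolding b_def using c elim by (intro divide_right_mono lo zero_le_power mult_nonneg_nonneg) auto
      qed
      show "\<forall>\<^sub>F n in sequentially. expectation (\<lambda>\<omega>. real (N n \<omega> choose k)) / (c * ln (real n)) ^ k \<le> b k n + b l n * inverse (c * ln (real n))"
        using eventually_ge_at_top[of 1]
      proof eventually_elim
        case (elim n)
        have "expectation (\<lambda>\<omega>. real (N n \<omega> choose k)) / (c * ln (real n)) ^ k
           \<le> (expectation (\<lambda>\<omega>. real (N' n \<omega> choose k)) + expectation (\<lambda>\<omega>. real (N' n \<omega> choose l))) / (c * ln (real n)) ^ k"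
          using c elim by (intro divide_right_mono up zero_le_power mult_nonneg_nonneg) auto
        also have "\<dots> = b k n + b l n * inverse (c * ln (real n))"
          unfolding b_def Suc by (simp add: divide_inverse distrib_right)
        finally show ?case .
      qed
    qed
  qed
  have mom: "(\<lambda>n. expectation (\<lambda>\<omega>. (real (N n \<omega>) / (c * ln (real n))) ^ k)) \<longlonglongrightarrow> fact k" for k
    by (rule moments_of_binomial_moments[OF N_meas N_le lnc binom])
  define Y where "Y n \<omega> = real (N n \<omega>) / (c * ln (real n))" for n \<omega>
  have Y_meas[measurable]: "Y n \<in> borel_measurable M" for n unfolding Y_def[abs_def] by measurable
  have Y0: "0 \<le> Y n \<omega>" for n \<omega> unfolding Y_def using c by (cases "n = 0") auto
  have Yint: "integrable M (\<lambda>\<omega>. Y n \<omega> ^ k)" for n k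
  proof (rule integrable_const_bound)
    show "AE \<omega> in M. norm (Y n \<omega> ^ k) \<le> (real n / (c * ln (real n))) ^ k"
    proof (rule AE_I2)
      fix \<omega>
      have "Y n \<omega> \<le> real n / (c * ln (real n))"
        unfolding Y_def using c N_le[of n \<omega>] by (cases "n = 0") (auto intro!: divide_right_mono)
      then show "norm (Y n \<omega> ^ k) \<le> (real n / (c * ln (real n))) ^ k"
        using Y0[of n \<omega>] by (simp add: power_mono)
    qed
  qed measurable
  have "weak_conv_m (\<lambda>n. distr M borel (Y n)) Exp1"
  proof (rule weak_conv_m_method_of_moments)
    show "real_distribution (distr M borel (Y n))" for n
      unfolding real_distribution_def real_distribution_axioms_def by (simp add: prob_space_distr)
    show "AE x in distr M borel (Y n). 0 \<le> x" for n
      using Y0 by (subst AE_distr_iff) auto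
    show "integrable (distr M borel (Y n)) (\<lambda>x. x ^ k)" for n k
      using Yint by (subst integrable_distr_eq) auto
    show "(\<lambda>n. \<integral>x. x ^ k \<partial>distr M borel (Y n)) \<longlonglongrightarrow> (\<integral>x. x ^ k \<partial>Exp1)" for k
      using mom[of k] by (subst integral_distr) (auto simp: Exp1_moments Y_def)
  qed (simp_all add: Exp1_moments)
  then show ?thesis unfolding Y_def N_def .
qed

section \<open>The critical geometric branching process with immigration\<close>

lemma neg_binomial_sums:
  fixes x :: real
  assumes "\<bar>x\<bar> < 1"
  shows "(\<lambda>j. real ((d + j) choose d) * x ^ j) sums (1 / (1 - x) ^ (d + 1))"
proof -
  have "(\<lambda>j. ((- real (d + 1)) gchoose j) * (- x) ^ j) sums (1 + - x) powr (- real (d + 1))"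
    using assms by (intro gen_binomial_real) auto
  also have "(\<lambda>j. ((- real (d + 1)) gchoose j) * (- x) ^ j) = (\<lambda>j. real ((d + j) choose d) * x ^ j)"
  proof
    fix j
    have "(- real (d + 1)) gchoose j = (- 1) ^ j * (real (d + j) gchoose j)"
      unfolding gbinomial_minus by (simp add: algebra_simps)
    also have "real (d + j) gchoose j = real ((d + j) choose d)"
      using binomial_symmetric[of d "d + j"] by (simp add: binomial_gbinomial)
    finally have "((- real (d + 1)) gchoose j) * (- x) ^ j = real ((d + j) choose d) * ((- 1) ^ j * (- x) ^ j)"
      by simp
    also have "(- 1) ^ j * (- x) ^ j = x ^ j"
      by (simp flip: power_mult_distrib)
    finally show "((- real (d + 1)) gchoose j) * (- x) ^ j = real ((d + j) choose d) * x ^ j" .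
  qed
  also have "(1 + - x) powr (- real (d + 1)) = 1 / (1 - x) ^ (d + 1)"
    using assms by (subst powr_minus) (simp add: powr_realpow inverse_eq_divide del: of_nat_Suc of_nat_add)
  finally show ?thesis .
qed

text \<open>The law of a sum of \<open>i + 1\<close> independent geometric variables of ratio 1/2:
  \<open>i\<close> individuals and one immigrant, each with mean offspring 1. Equivalently, the
  number of successes of a fair coin before failure number \<open>i + 1\<close>.\<close>

definition step_prob :: "nat \<Rightarrow> nat \<Rightarrow> real" where
  "step_prob i j = real ((i + j) choose i) / 2 ^ (i + j + 1)"

lemma step_prob_nonneg: "0 \<le> step_prob i j"
  by (simp add: step_prob_def)

lemma step_prob_sym: "step_prob i j = step_prob j i"
  using binomial_symmetric[of i "i + j"] by (simp add: step_prob_def add.commute)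

lemma step_prob_0_left: "step_prob 0 j = 1 / 2 ^ Suc j"
  by (simp add: step_prob_def)

lemma step_prob_0_right: "step_prob i 0 = 1 / 2 ^ Suc i"
  by (simp add: step_prob_def)

lemma step_prob_Suc_Suc: "2 * step_prob (Suc i) (Suc j) = step_prob i (Suc j) + step_prob (Suc i) j"
proof -
  have "real ((Suc i + Suc j) choose Suc i) = real ((i + Suc j) choose i) + real ((Suc i + j) choose Suc i)"
    by (simp only: add_Suc add_Suc_right binomial_Suc_Suc of_nat_add)
  moreover have "(2::real) ^ (Suc i + Suc j + 1) = 2 * 2 ^ (i + j + 2)"
    "(2::real) ^ (i + Suc j + 1) = 2 ^ (i + j + 2)" "(2::real) ^ (Suc i + j + 1) = 2 ^ (i + j + 2)"
    by simp_all
  moreover have "2 * ((b + c) / (2 * e)) = b / e + c / e" for b c e :: real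
    by (simp add: add_divide_distrib)
  ultimately show ?thesis unfolding step_prob_def by (simp only:)
qed

lemma step_prob_sums: "(\<lambda>j. step_prob i j) sums 1"
proof -
  have "(\<lambda>j. (1/2) ^ (i + 1) * (real ((i + j) choose i) * (1/2) ^ j)) sums ((1/2) ^ (i + 1) * (1 / (1 - 1/2) ^ (i + 1)))"
    by (intro sums_mult neg_binomial_sums) auto
  moreover have "(1/2) ^ (i + 1) * (real ((i + j) choose i) * (1/2) ^ j) = step_prob i j" for j
    by (simp add: step_prob_def power_add power_divide)
  ultimately show ?thesis by (simp add: power_divide)
qed

text \<open>Invariance of counting measure. Since entries of powers are at most 1, it also dominates
  all the series that define those powers.\<close>

lemma step_prob_sums_left: "(\<lambda>i. step_prob i j) sums 1"
  using step_prob_sums[of j] by (simp only: step_prob_sym[of j])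

section \<open>Powers of the transition matrix\<close>

fun step_prob_pow :: "nat \<Rightarrow> nat \<Rightarrow> nat \<Rightarrow> real" where
  "step_prob_pow 0 i j = of_bool (i = j)"
| "step_prob_pow (Suc m) i j = (\<Sum>k. step_prob_pow m i k * step_prob k j)"

lemma summable_mult_step_prob:
  assumes "\<And>k. 0 \<le> f k" "\<And>k. f k \<le> (1::real)"
  shows "summable (\<lambda>k. f k * step_prob k j)"
  by (rule summable_comparison_test'[OF sums_summable[OF step_prob_sums_left[of j]], of 0])
     (use assms in \<open>auto simp: step_prob_nonneg abs_mult intro!: mult_left_le_one_le\<close>)

lemma step_prob_pow_bounds: "0 \<le> step_prob_pow m i j \<and> step_prob_pow m i j \<le> 1"
proof (induction m arbitrary: j)
  case (Suc m)
  have "summable (\<lambda>k. step_prob_pow m i k * step_prob k j)" using Suc by (intro summable_mult_step_prob) auto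
  moreover have "(\<Sum>k. step_prob_pow m i k * step_prob k j) \<le> (\<Sum>k. step_prob k j)"
    using Suc calculation step_prob_sums_left[of j]
    by (intro suminf_le) (auto simp: sums_iff step_prob_nonneg mult_left_le_one_le)
  ultimately show ?case using Suc step_prob_sums_left[of j]
    by (auto simp: sums_iff step_prob_nonneg intro!: suminf_nonneg)
qed auto

lemma step_prob_pow_nonneg: "0 \<le> step_prob_pow m i j" and step_prob_pow_le_1: "step_prob_pow m i j \<le> 1"
  using step_prob_pow_bounds by auto

lemma step_prob_pow_Suc_sums: "(\<lambda>k. step_prob_pow m i k * step_prob k j) sums step_prob_pow (Suc m) i j"
  using summable_mult_step_prob[of "step_prob_pow m i" j] step_prob_pow_bounds by (auto simp: summable_sums)

lemma step_prob_pow_1: "step_prob_pow 1 i j = step_prob i j"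
proof -
  have "(\<lambda>k. step_prob_pow 0 i k * step_prob k j) sums (\<Sum>k\<in>{i}. step_prob_pow 0 i k * step_prob k j)"
    by (intro sums_finite) auto
  then show ?thesis using step_prob_pow_Suc_sums[of 0 i j] by (auto simp: sums_iff)
qed

text \<open>These compare coefficients in \<open>\<Sum>j. P\<^sup>m(i, j) s ^ j = (m - (m - 1) s) ^ i / (m + 1 - m s) ^ (i + 1)\<close>.\<close>

lemma step_prob_pow_recursions:
  "real (Suc m) * step_prob_pow m 0 0 = 1"
  "real (Suc m) * step_prob_pow m 0 (Suc j) = real m * step_prob_pow m 0 j"
  "real (Suc m) * step_prob_pow m (Suc i) 0 = real m * step_prob_pow m i 0"
  "real (Suc m) * step_prob_pow m (Suc i) (Suc j) - real m * step_prob_pow m (Suc i) j = real m * step_prob_pow m i (Suc j) - (real m - 1) * step_prob_pow m i j"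
proof -
  define P where "P m \<longleftrightarrow> real (Suc m) * step_prob_pow m 0 0 = 1 \<and>
    (\<forall>j. real (Suc m) * step_prob_pow m 0 (Suc j) = real m * step_prob_pow m 0 j) \<and>
    (\<forall>i. real (Suc m) * step_prob_pow m (Suc i) 0 = real m * step_prob_pow m i 0) \<and>
    (\<forall>i j. real (Suc m) * step_prob_pow m (Suc i) (Suc j) - real m * step_prob_pow m (Suc i) j = real m * step_prob_pow m i (Suc j) - (real m - 1) * step_prob_pow m i j)" for m
  have step: "P (Suc m)" if "P m" for m
  proof -
    have IH: "real (Suc m) * step_prob_pow m 0 0 = 1" "real (Suc m) * step_prob_pow m 0 (Suc j) = real m * step_prob_pow m 0 j"
      "real (Suc m) * step_prob_pow m (Suc i) 0 = real m * step_prob_pow m i 0" 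
      "real (Suc m) * step_prob_pow m (Suc i) (Suc j) - real m * step_prob_pow m (Suc i) j = real m * step_prob_pow m i (Suc j) - (real m - 1) * step_prob_pow m i j" for i j
      using that unfolding P_def by blast+
    \<comment> \<open>The row \<open>k\<close> of \<open>step_prob\<close> has generating function
      \<open>1 / (2 - s) ^ (k + 1)\<close>, so \<open>T\<close> is the next power divided by
      \<open>2 - s\<close>; \<open>T0\<close> and \<open>TS\<close> state this coefficientwise. The
      recursions for \<open>m\<close> become relations between the next power and \<open>T\<close>
      (\<open>R0\<close>, \<open>RS\<close>), and eliminating \<open>T\<close> gives the recursions
      for \<open>Suc m\<close>.\<close>
    define T where "T i j = (\<Sum>k. step_prob_pow m i k * step_prob (Suc k) j)" for i j
    have sT: "(\<lambda>k. step_prob_pow m i k * step_prob (Suc k) j) sums T i j" for i j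
    proof -
      have "summable (\<lambda>k. step_prob_pow m i (k - 1) * step_prob k j)"
        by (intro summable_mult_step_prob step_prob_pow_nonneg step_prob_pow_le_1)
      then show ?thesis unfolding T_def by (subst (asm) summable_Suc_iff[symmetric]) (auto simp: summable_sums)
    qed
    have sE: "(\<lambda>k. step_prob_pow m i (Suc k) * step_prob (Suc k) j) sums (step_prob_pow (Suc m) i j - step_prob_pow m i 0 * step_prob 0 j)" for i j
      using step_prob_pow_Suc_sums[of m i j] by (subst sums_Suc_iff) simp
    have T0: "2 * T i 0 = step_prob_pow (Suc m) i 0" for i
      using sums_mult[OF sT[of i 0], of 2] step_prob_pow_Suc_sums[of m i 0]
      by (intro sums_unique2) (auto simp: step_prob_0_right)
    have TS: "2 * T i (Suc j) = step_prob_pow (Suc m) i (Suc j) + T i j" for i j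
    proof (rule sums_unique2)
      show "(\<lambda>k. 2 * (step_prob_pow m i k * step_prob (Suc k) (Suc j))) sums (2 * T i (Suc j))"
        by (intro sums_mult sT)
      have "(\<lambda>k. step_prob_pow m i k * step_prob k (Suc j) + step_prob_pow m i k * step_prob (Suc k) j) sums (step_prob_pow (Suc m) i (Suc j) + T i j)"
        by (intro sums_add step_prob_pow_Suc_sums sT)
      moreover have "2 * (step_prob_pow m i k * step_prob (Suc k) (Suc j)) = step_prob_pow m i k * step_prob k (Suc j) + step_prob_pow m i k * step_prob (Suc k) j" for k
        using arg_cong[OF step_prob_Suc_Suc[of k j], of "\<lambda>z. step_prob_pow m i k * z"] by (simp add: algebra_simps)
      ultimately show "(\<lambda>k. 2 * (step_prob_pow m i k * step_prob (Suc k) (Suc j))) sums (step_prob_pow (Suc m) i (Suc j) + T i j)"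
        by simp
    qed
    have R0: "real (Suc m) * step_prob_pow (Suc m) 0 j - real m * T 0 j = step_prob 0 j" for j
    proof -
      have "(\<lambda>k. real (Suc m) * (step_prob_pow m 0 (Suc k) * step_prob (Suc k) j) - real m * (step_prob_pow m 0 k * step_prob (Suc k) j))
         sums (real (Suc m) * (step_prob_pow (Suc m) 0 j - step_prob_pow m 0 0 * step_prob 0 j) - real m * T 0 j)"
        by (intro sums_diff sums_mult sE sT)
      moreover have "real (Suc m) * (step_prob_pow m 0 (Suc k) * step_prob (Suc k) j) - real m * (step_prob_pow m 0 k * step_prob (Suc k) j) = 0" for k
        using IH(2)[of k] by (simp only: mult.assoc[symmetric])
      ultimately have "(\<lambda>k. 0) sums (real (Suc m) * (step_prob_pow (Suc m) 0 j - step_prob_pow m 0 0 * step_prob 0 j) - real m * T 0 j)"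
        by (simp only:)
      from sums_unique2[OF this sums_zero]
      have "real (Suc m) * (step_prob_pow (Suc m) 0 j - step_prob_pow m 0 0 * step_prob 0 j) - real m * T 0 j = 0" .
      then show ?thesis using IH(1) by (simp add: right_diff_distrib mult.assoc[symmetric] del: step_prob_pow.simps)
    qed
    have RS: "real (Suc m) * step_prob_pow (Suc m) (Suc i) j - real m * T (Suc i) j = real m * step_prob_pow (Suc m) i j - (real m - 1) * T i j" for i j
    proof -
      have 1: "(\<lambda>k. real (Suc m) * (step_prob_pow m (Suc i) (Suc k) * step_prob (Suc k) j) - real m * (step_prob_pow m (Suc i) k * step_prob (Suc k) j))
         sums (real (Suc m) * (step_prob_pow (Suc m) (Suc i) j - step_prob_pow m (Suc i) 0 * step_prob 0 j) - real m * T (Suc i) j)"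
        by (intro sums_diff sums_mult sE sT)
      have 2: "(\<lambda>k. real m * (step_prob_pow m i (Suc k) * step_prob (Suc k) j) - (real m - 1) * (step_prob_pow m i k * step_prob (Suc k) j))
         sums (real m * (step_prob_pow (Suc m) i j - step_prob_pow m i 0 * step_prob 0 j) - (real m - 1) * T i j)"
        by (intro sums_diff sums_mult sE sT)
      have "real (Suc m) * (step_prob_pow m (Suc i) (Suc k) * step_prob (Suc k) j) - real m * (step_prob_pow m (Suc i) k * step_prob (Suc k) j)
         = real m * (step_prob_pow m i (Suc k) * step_prob (Suc k) j) - (real m - 1) * (step_prob_pow m i k * step_prob (Suc k) j)" for k
        using arg_cong[OF IH(4)[of i k], of "\<lambda>z. z * step_prob (Suc k) j"]
        by (simp only: left_diff_distrib mult.assoc)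
      then have "real (Suc m) * (step_prob_pow (Suc m) (Suc i) j - step_prob_pow m (Suc i) 0 * step_prob 0 j) - real m * T (Suc i) j
         = real m * (step_prob_pow (Suc m) i j - step_prob_pow m i 0 * step_prob 0 j) - (real m - 1) * T i j"
        using 1 2 by (simp only: sums_unique2)
      then show ?thesis using arg_cong[OF IH(3)[of i], of "\<lambda>z. z * step_prob 0 j"]
        by (simp only: right_diff_distrib mult.assoc)
    qed
    have m: "real (Suc m) = real m + 1" "real (Suc (Suc m)) = real m + 2" by simp_all
    have 1: "real (Suc (Suc m)) * step_prob_pow (Suc m) 0 0 = 1"
      using R0[of 0] T0[of 0] by (simp add: step_prob_0_left algebra_simps del: step_prob_pow.simps)
    have 2: "real (Suc (Suc m)) * step_prob_pow (Suc m) 0 (Suc j) = real (Suc m) * step_prob_pow (Suc m) 0 j" for j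
    proof -
      have "2 * step_prob 0 (Suc j) = step_prob 0 j" by (simp add: step_prob_0_left)
      moreover have "(m' + 2) * a1 = (m' + 1) * a0"
        if "(m' + 1) * a1 - m' * t1 = k1" "(m' + 1) * a0 - m' * t0 = k0" "2 * t1 = a1 + t0" "2 * k1 = k0"
        for m' a0 a1 t0 t1 k0 k1 :: real
      proof -
        have t: "t1 = (a1 + t0) / 2" "k1 = ((m' + 1) * a0 - m' * t0) / 2" using that by auto
        show ?thesis using that(1) unfolding t by (simp add: field_simps)
      qed
      ultimately show ?thesis using R0[of "Suc j"] R0[of j] TS[of 0 j] unfolding m by blast
    qed
    have 3: "real (Suc (Suc m)) * step_prob_pow (Suc m) (Suc i) 0 = real (Suc m) * step_prob_pow (Suc m) i 0" for i
    proof -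
      have "(m' + 2) * b = (m' + 1) * a"
        if "(m' + 1) * b - m' * t1 = m' * a - (m' - 1) * t0" "2 * t1 = b" "2 * t0 = a"
        for m' a b t0 t1 :: real
        using that(1) unfolding that(2,3)[symmetric] by (simp add: algebra_simps)
      then show ?thesis using RS[of i 0] T0[of "Suc i"] T0[of i] unfolding m by blast
    qed
    have 4: "real (Suc (Suc m)) * step_prob_pow (Suc m) (Suc i) (Suc j) - real (Suc m) * step_prob_pow (Suc m) (Suc i) j
        = real (Suc m) * step_prob_pow (Suc m) i (Suc j) - (real (Suc m) - 1) * step_prob_pow (Suc m) i j" for i j
    proof -
      have "(m' + 2) * b1 - (m' + 1) * b0 = (m' + 1) * a1 - (m' + 1 - 1) * a0"
        if "(m' + 1) * b1 - m' * t1 = m' * a1 - (m' - 1) * s1" "(m' + 1) * b0 - m' * t0 = m' * a0 - (m' - 1) * s0"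
          "2 * t1 = b1 + t0" "2 * s1 = a1 + s0"
        for m' a0 a1 b0 b1 s0 s1 t0 t1 :: real
      proof -
        have t: "b1 = 2 * t1 - t0" "a1 = 2 * s1 - s0" using that by auto
        show ?thesis using that(1,2) unfolding t by (simp add: algebra_simps)
      qed
      then show ?thesis using RS[of i "Suc j"] RS[of i j] TS[of "Suc i" j] TS[of i j] unfolding m by blast
    qed
    show ?thesis unfolding P_def using 1 2 3 4 by blast
  qed
  have "P 0" unfolding P_def by simp
  then have "P m" by (induction m) (auto intro: step)
  then show "real (Suc m) * step_prob_pow m 0 0 = 1"
    "real (Suc m) * step_prob_pow m 0 (Suc j) = real m * step_prob_pow m 0 j"
    "real (Suc m) * step_prob_pow m (Suc i) 0 = real m * step_prob_pow m i 0"
    "real (Suc m) * step_prob_pow m (Suc i) (Suc j) - real m * step_prob_pow m (Suc i) j = real m * step_prob_pow m i (Suc j) - (real m - 1) * step_prob_pow m i j"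
    unfolding P_def by blast+
qed

lemma step_prob_pow_0_0: "step_prob_pow m 0 0 = 1 / real (Suc m)"
  using step_prob_pow_recursions(1)[of m] by (simp add: field_simps)

text \<open>After scaling by \<open>Suc m\<close> the recursions tend to
  \<open>l(i+1, j+1) = l(i+1, j) + l(i, j+1) - l(i, j)\<close> with constant boundary values 1, and
  the constant 1 solves this. Every entry is determined by entries of smaller
  \<open>i + j\<close>.\<close>

lemma LIMSEQ_step_prob_pow: "(\<lambda>m. real (Suc m) * step_prob_pow m i j) \<longlonglongrightarrow> 1"
proof (induction "i + j" arbitrary: i j rule: less_induct)
  case less
  have r: "(\<lambda>m. real m / real (Suc m)) \<longlonglongrightarrow> 1" by (rule LIMSEQ_n_over_Suc_n)
  have r': "(\<lambda>m. (real m - 1) / real (Suc m)) \<longlonglongrightarrow> 1"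
    using tendsto_diff[OF r LIMSEQ_inverse_real_of_nat] by (simp add: diff_divide_distrib inverse_eq_divide)
  have eq: "real m * x = real m / real (Suc m) * (real (Suc m) * x)"
    "(real m - 1) * x = (real m - 1) / real (Suc m) * (real (Suc m) * x)" for m x
    by (auto simp del: of_nat_Suc)
  show ?case
  proof (cases i)
    case 0
    show ?thesis
    proof (cases j)
      case 0
      then show ?thesis using \<open>i = 0\<close> step_prob_pow_recursions(1) by (simp del: of_nat_Suc)
    next
      case (Suc j')
      have "(\<lambda>m. real m / real (Suc m) * (real (Suc m) * step_prob_pow m 0 j')) \<longlonglongrightarrow> 1 * 1"
        using less[of 0 j'] \<open>i = 0\<close> Suc by (intro tendsto_mult r) auto
      then show ?thesis unfolding \<open>i = 0\<close> Suc step_prob_pow_recursions(2) eq(1)[symmetric] by simp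
    qed
  next
    case (Suc i')
    show ?thesis
    proof (cases j)
      case 0
      have "(\<lambda>m. real m / real (Suc m) * (real (Suc m) * step_prob_pow m i' 0)) \<longlonglongrightarrow> 1 * 1"
        using less[of i' 0] 0 Suc by (intro tendsto_mult r) auto
      then show ?thesis unfolding 0 Suc step_prob_pow_recursions(3) eq(1)[symmetric] by simp
    next
      case (Suc j')
      have "(\<lambda>m. real m / real (Suc m) * (real (Suc m) * step_prob_pow m (Suc i') j')
           + real m / real (Suc m) * (real (Suc m) * step_prob_pow m i' (Suc j'))
           - (real m - 1) / real (Suc m) * (real (Suc m) * step_prob_pow m i' j')) \<longlonglongrightarrow> 1 * 1 + 1 * 1 - 1 * 1"
        using less[of "Suc i'" j'] less[of i' "Suc j'"] less[of i' j'] \<open>i = Suc i'\<close> Suc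
        by (intro tendsto_mult tendsto_add tendsto_diff r r') auto
      moreover have "real (Suc m) * step_prob_pow m (Suc i') (Suc j') = real m * step_prob_pow m (Suc i') j' + real m * step_prob_pow m i' (Suc j') - (real m - 1) * step_prob_pow m i' j'" for m
        using step_prob_pow_recursions(4)[of m i' j'] by linarith
      ultimately show ?thesis unfolding \<open>i = Suc i'\<close> Suc eq[symmetric] by simp
    qed
  qed
qed

section \<open>Exit stacks of nearest-neighbour paths\<close>

definition exit_stack :: "(nat \<Rightarrow> nat) \<Rightarrow> nat \<Rightarrow> nat \<Rightarrow> bool list" where
  "exit_stack w k y = map (\<lambda>i. w (Suc i) = Suc y) (filter (\<lambda>i. w i = y) [0..<k])"

lemma exit_stack_0[simp]: "exit_stack w 0 y = []"
  by (simp add: exit_stack_def)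

lemma exit_stack_Suc: "exit_stack w (Suc k) y = exit_stack w k y @ (if w k = y then [w (Suc k) = Suc y] else [])"
  by (simp add: exit_stack_def)

lemma exit_stack_cong: "(\<And>i. i \<le> k \<Longrightarrow> w i = w' i) \<Longrightarrow> exit_stack w k y = exit_stack w' k y"
  by (induction k) (simp_all add: exit_stack_Suc)

lemma exit_stack_mono:
  assumes "k \<le> l" shows "\<exists>r. exit_stack w l y = exit_stack w k y @ r"
  using assms by (induction l rule: dec_induct) (auto simp: exit_stack_Suc)

definition ups :: "bool list \<Rightarrow> nat" where "ups s = count_list s True"
definition downs :: "bool list \<Rightarrow> nat" where "downs s = count_list s False"

lemma ups_simps[simp]: "ups [] = 0" "ups (b # s) = of_bool b + ups s" "ups (s @ t) = ups s + ups t"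
  by (auto simp: ups_def)

lemma downs_simps[simp]: "downs [] = 0" "downs (b # s) = of_bool (\<not> b) + downs s" "downs (s @ t) = downs s + downs t"
  by (auto simp: downs_def)

lemma ups_plus_downs: "ups s + downs s = length s"
  by (induction s) auto

definition ends_up :: "bool list \<Rightarrow> bool" where "ends_up s \<longleftrightarrow> s \<noteq> [] \<and> last s"

lemma ends_up_ups: "ends_up s \<Longrightarrow> 0 < ups s"
  by (cases s rule: rev_cases) (auto simp: ends_up_def)

lemma exit_stack_length: "length (exit_stack w k y) = card {i. i < k \<and> w i = y}"
proof (induction k)
  case (Suc k)
  have "{i. i < Suc k \<and> w i = y} = {i. i < k \<and> w i = y} \<union> (if w k = y then {k} else {})"
    by (auto simp: less_Suc_eq)
  then show ?case using Suc by (simp add: exit_stack_Suc)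
qed simp

lemma exit_stack_ups: "ups (exit_stack w k y) = card {i. i < k \<and> w i = y \<and> w (Suc i) = y + 1}"
proof (induction k)
  case (Suc k)
  have "{i. i < Suc k \<and> w i = y \<and> w (Suc i) = y + 1} = {i. i < k \<and> w i = y \<and> w (Suc i) = y + 1} \<union> (if w k = y \<and> w (Suc k) = y + 1 then {k} else {})"
    by (auto simp: less_Suc_eq)
  then show ?case using Suc by (simp add: exit_stack_Suc)
qed simp

definition nn_path :: "(nat \<Rightarrow> nat) \<Rightarrow> nat \<Rightarrow> bool" where
  "nn_path h k \<longleftrightarrow> h 0 = 0 \<and> (\<forall>i<k. h (Suc i) = Suc (h i) \<or> (0 < h i \<and> h (Suc i) = h i - 1))"

text \<open>Here \<open>r y\<close> lists the exits still to be made from \<open>y\<close> by a walker at \<open>x\<close> heading for \<open>L\<close>. The balance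
  of up- and down-crossings keeps the list at the current site nonempty until \<open>L\<close> is reached.\<close>

lemma complete_path:
  assumes "nn_path h k" "h k = x" "x \<le> L" "\<And>i. i < k \<Longrightarrow> h i < L"
    and "\<And>y. y < L \<Longrightarrow> r y = [] \<or> ends_up (r y)"
    and "downs (r 0) = 0" "\<And>y. L \<le> y \<Longrightarrow> r y = []"
    and "\<And>y. y < L \<Longrightarrow> ups (r y) = downs (r (Suc y)) + of_bool (x \<le> y)"
  shows "\<exists>h' k'. nn_path h' k' \<and> h' k' = L \<and> (\<forall>i<k'. h' i < L) \<and> (\<forall>y<L. exit_stack h' k' y = exit_stack h k y @ r y)"
  using assms
proof (induction "\<Sum>y<L. length (r y)" arbitrary: h k x r rule: less_induct)
  case less
  note path = less.prems(1-4) and r = less.prems(5) and r0 = less.prems(6) and rL = less.prems(7) and bal = less.prems(8)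
  show ?case
  proof (cases "x = L")
    case True
    \<comment> \<open>At \<open>L\<close> nothing is left to cross: downwards from \<open>L\<close>,
      an empty list at \<open>Suc y\<close> leaves no up-step at \<open>y\<close>, and a nonempty
      list would end with one.\<close>
    have "r y = []" if "y \<le> L" for y
      using that
    proof (induction y rule: inc_induct)
      case base
      show ?case by (rule rL) simp
    next
      case (step y)
      then have "ups (r y) = 0" using bal[of y] True by simp
      then show ?case using r[of y] step(2) ends_up_ups[of "r y"] by auto
    qed
    then show ?thesis using path True by (intro exI[of _ h] exI[of _ k]) auto
  next
    case False
    then have x: "x < L" using path by simp
    \<comment> \<open>The walker is still below \<open>L\<close>, so the edge above \<open>x\<close>
      has one upward crossing more to come than downward ones.\<close>
    have "0 < ups (r x)" using bal[of x] x by simp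
    then obtain b t where bt: "r x = b # t" by (cases "r x") auto
    define x' where "x' = (if b then Suc x else x - 1)"
    have x0: "0 < x" if "\<not> b" using that r0 bt by (cases x) auto
    define h' where "h' = h(Suc k := x')"
    define r' where "r' = r(x := t)"
    have exit_stack': "exit_stack h' (Suc k) y = exit_stack h k y @ (if y = x then [b] else [])" for y
    proof -
      have "exit_stack h' k y = exit_stack h k y" by (rule exit_stack_cong) (simp add: h'_def)
      then show ?thesis using path(2) by (auto simp: exit_stack_Suc h'_def x'_def)
    qed
    have "\<exists>g l. nn_path g l \<and> g l = L \<and> (\<forall>i<l. g i < L) \<and> (\<forall>y<L. exit_stack g l y = exit_stack h' (Suc k) y @ r' y)"
    proof (rule less.hyps)
      show "(\<Sum>y<L. length (r' y)) < (\<Sum>y<L. length (r y))"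
        using x bt by (intro sum_strict_mono_ex1) (auto simp: r'_def)
      show "nn_path h' (Suc k)"
        using path x0 unfolding nn_path_def by (auto simp: h'_def x'_def less_Suc_eq)
      show "h' (Suc k) = x'" by (simp add: h'_def)
      show "x' \<le> L" using x by (auto simp: x'_def)
      show "h' i < L" if "i < Suc k" for i using that path x by (auto simp: h'_def less_Suc_eq)
      show "r' y = [] \<or> ends_up (r' y)" if "y < L" for y
        using r[OF that] bt by (auto simp: r'_def ends_up_def split: if_splits)
      show "downs (r' 0) = 0" using r0 bt by (auto simp: r'_def)
      show "r' y = []" if "L \<le> y" for y using rL[OF that] x that by (auto simp: r'_def)
      show "ups (r' y) = downs (r' (Suc y)) + of_bool (x' \<le> y)" if "y < L" for y
        using bal[OF that] bt x0 by (cases b) (auto simp: r'_def x'_def split: if_splits)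
    qed
    moreover have "exit_stack h' (Suc k) y @ r' y = exit_stack h k y @ r y" for y
      by (simp add: exit_stack' r'_def bt)
    ultimately show ?thesis by simp
  qed
qed

text \<open>The path stops on reaching \<open>L\<close>, so the edge into \<open>L\<close> is
  crossed once; this is the last hypothesis. Empty lists are put at \<open>L\<close> and above to
  start the construction.\<close>

lemma consistent_stacks_path:
  assumes "0 < L" "\<And>y. y < L \<Longrightarrow> ends_up (s y)" "downs (s 0) = 0"
    and "\<And>y. Suc y < L \<Longrightarrow> ups (s y) = downs (s (Suc y)) + 1" and "ups (s (L - 1)) = 1"
  shows "\<exists>h k. nn_path h k \<and> h k = L \<and> (\<forall>i<k. h i < L) \<and> (\<forall>y<L. exit_stack h k y = s y)"
proof -
  have "\<exists>h k. nn_path h k \<and> h k = L \<and> (\<forall>i<k. h i < L) \<and>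
     (\<forall>y<L. exit_stack h k y = exit_stack (\<lambda>_. 0) 0 y @ (\<lambda>y. if y < L then s y else []) y)"
  proof (rule complete_path[where x = 0])
    fix y assume "y < L"
    then show "ups (if y < L then s y else []) = downs (if Suc y < L then s (Suc y) else []) + of_bool (0 \<le> y)"
    proof (cases "Suc y < L")
      case False
      with \<open>y < L\<close> have "y = L - 1" by simp
      with False \<open>y < L\<close> show ?thesis using assms(5) by simp
    qed (use assms(4)[of y] in simp)
  next
    show "nn_path (\<lambda>_. 0) 0" by (simp add: nn_path_def)
  qed (use assms(1-3) in simp_all)
  then show ?thesis by auto
qed

text \<open>The value is \<open>[]\<close> also if \<open>y\<close> is visited infinitely often.\<close>

definition final_stack :: "(nat \<Rightarrow> nat) \<Rightarrow> nat \<Rightarrow> bool list" where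
  "final_stack w y = (if \<exists>s k0. \<forall>k\<ge>k0. exit_stack w k y = s then (THE s. \<exists>k0. \<forall>k\<ge>k0. exit_stack w k y = s) else [])"

lemma final_stack_eqI:
  assumes "\<And>k. k0 \<le> k \<Longrightarrow> exit_stack w k y = s"
  shows "final_stack w y = s"
proof -
  have "(THE s. \<exists>k0. \<forall>k\<ge>k0. exit_stack w k y = s) = s"
  proof (rule the_equality)
    show "\<exists>k0. \<forall>k\<ge>k0. exit_stack w k y = s" using assms by blast
    fix s' assume "\<exists>k0. \<forall>k\<ge>k0. exit_stack w k y = s'"
    then obtain k1 where "\<forall>k\<ge>k1. exit_stack w k y = s'" by blast
    then show "s' = s" using assms[of "max k0 k1"] by auto
  qed
  moreover have "\<exists>s k0. \<forall>k\<ge>k0. exit_stack w k y = s" using assms by blast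
  ultimately show ?thesis by (simp add: final_stack_def)
qed

lemma final_stack_nonempty_iff:
  assumes "s \<noteq> []"
  shows "final_stack w y = s \<longleftrightarrow> (\<exists>k0. \<forall>k\<ge>k0. exit_stack w k y = s)"
proof
  assume final_stack: "final_stack w y = s"
  have "\<exists>s k0. \<forall>k\<ge>k0. exit_stack w k y = s"
  proof (rule ccontr)
    assume "\<not> ?thesis"
    then have "final_stack w y = []" unfolding final_stack_def by (rule if_not_P)
    with final_stack assms show False by simp
  qed
  then obtain s' k0 where "\<forall>k\<ge>k0. exit_stack w k y = s'" by blast
  moreover from this have "s' = s" using final_stack_eqI[of k0 w y s'] final_stack by simp
  ultimately show "\<exists>k0. \<forall>k\<ge>k0. exit_stack w k y = s" by blast
qed (auto intro: final_stack_eqI)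

lemma final_stack_visits:
  assumes "final_stack w x \<noteq> []"
  obtains k0 where "exit_stack w k0 x = final_stack w x" "\<And>i. w i = x \<Longrightarrow> i < k0"
proof -
  obtain k0 where k0: "\<And>k. k \<ge> k0 \<Longrightarrow> exit_stack w k x = final_stack w x"
    using final_stack_nonempty_iff[OF assms, of w x] by auto
  have "i < k0" if "w i = x" for i
  proof (rule ccontr)
    assume "\<not> i < k0"
    then have "exit_stack w (Suc i) x = exit_stack w i x" using k0[of i] k0[of "Suc i"] by simp
    then show False using that by (simp add: exit_stack_Suc)
  qed
  with k0[of k0] show ?thesis by (intro that) auto
qed

section \<open>Reading the three sets off the lists\<close>

lemma Cab_iff_final_stack:
  assumes "final_stack w x \<noteq> []"
  shows "x \<in> Cab w a b \<longleftrightarrow> length (final_stack w x) = a \<and> ups (final_stack w x) = b"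
    and "x \<in> Cstar w a \<longleftrightarrow> ups (final_stack w x) = a"
proof -
  obtain k0 where k0: "exit_stack w k0 x = final_stack w x" "\<And>i. w i = x \<Longrightarrow> i < k0"
    using final_stack_visits[OF assms] by blast
  have "visits w x = {i. i < k0 \<and> w i = x}" "upvisits w x = {i. i < k0 \<and> w i = x \<and> w (Suc i) = x + 1}"
    using k0(2) by (auto simp: visits_def upvisits_def)
  then show "x \<in> Cab w a b \<longleftrightarrow> length (final_stack w x) = a \<and> ups (final_stack w x) = b" "x \<in> Cstar w a \<longleftrightarrow> ups (final_stack w x) = a"
    using exit_stack_length[of w k0 x] exit_stack_ups[of w k0 x] by (simp_all add: Cab_def Cstar_def k0(1))
qed

text \<open>Since \<open>False\<close> precedes \<open>True\<close>, being sorted means that no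
  down-step follows an up-step.\<close>

lemma sorted_exit_stack:
  "sorted (exit_stack w k y) \<longleftrightarrow>
    (\<forall>i j. i < j \<and> j < k \<and> w i = y \<and> w j = y \<and> w (Suc i) = Suc y \<longrightarrow> w (Suc j) = Suc y)"
proof (induction k)
  case (Suc k)
  have mem: "True \<in> set (exit_stack w k y) \<longleftrightarrow> (\<exists>i<k. w i = y \<and> w (Suc i) = Suc y)"
    by (auto simp: exit_stack_def)
  have "sorted (exit_stack w (Suc k) y) \<longleftrightarrow> sorted (exit_stack w k y) \<and> (w k = y \<longrightarrow> True \<in> set (exit_stack w k y) \<longrightarrow> w (Suc k) = Suc y)"
    by (auto simp: exit_stack_Suc sorted_append le_bool_def)
  then show ?case unfolding Suc mem less_Suc_eq by blast
qed simp

text \<open>At a cut time \<open>k\<close>, up-steps from \<open>R\<close> happen only from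
  \<open>k\<close> on and down-steps only before \<open>k\<close>. Conversely the first up-step from
  \<open>R\<close> serves as the cut time: until then the walk has not been above \<open>R\<close>,
  and afterwards it could get below \<open>R\<close> only by a down-step from \<open>R\<close> that
  follows an up-step.\<close>

lemma Cw_iff_sorted:
  assumes nn: "\<And>k. nn_path w k" and R: "0 < R" and final_stack: "ends_up (final_stack w R)"
  shows "R \<in> Cw w \<longleftrightarrow> sorted (final_stack w R)"
proof -
  have ne: "final_stack w R \<noteq> []" using final_stack by (auto simp: ends_up_def)
  obtain k0 where k0: "exit_stack w k0 R = final_stack w R" "\<And>i. w i = R \<Longrightarrow> i < k0"
    using final_stack_visits[OF ne] by blast
  have nnstep: "w (Suc i) = Suc (w i) \<or> (0 < w i \<and> w (Suc i) = w i - 1)" and w0: "w 0 = 0" for i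
    using nn[of "Suc i"] by (auto simp: nn_path_def)
  have srt: "sorted (final_stack w R) \<longleftrightarrow> (\<forall>i j. i < j \<and> w i = R \<and> w j = R \<and> w (Suc i) = Suc R \<longrightarrow> w (Suc j) = Suc R)"
    unfolding k0(1)[symmetric] sorted_exit_stack using k0(2) by blast
  show ?thesis
  proof
    assume "R \<in> Cw w"
    then obtain k where k: "w k = R" "\<And>i. i < k \<Longrightarrow> w i \<le> R" "\<And>i. i > k \<Longrightarrow> w i \<ge> R"
      by (auto simp: Cw_def)
    have "w (Suc j) = Suc R" if ij: "i < j" "w i = R" "w j = R" "w (Suc i) = Suc R" for i j
    proof (cases "j < k")
      case True
      then show ?thesis using k(2)[of "Suc i"] ij by auto
    next
      case False
      then show ?thesis using k(3)[of "Suc j"] nnstep[of j] ij R by auto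
    qed
    then show "sorted (final_stack w R)" unfolding srt by blast
  next
    assume s: "sorted (final_stack w R)"
    have "True \<in> set (final_stack w R)" using final_stack last_in_set[OF ne] by (simp add: ends_up_def)
    then have ex: "\<exists>i. w i = R \<and> w (Suc i) = Suc R" unfolding k0(1)[symmetric] by (auto simp: exit_stack_def)
    define k where "k = (LEAST i. w i = R \<and> w (Suc i) = Suc R)"
    have k: "w k = R" "w (Suc k) = Suc R" using LeastI_ex[OF ex] by (auto simp: k_def)
    have k': "\<not> (w i = R \<and> w (Suc i) = Suc R)" if "i < k" for i
      using not_less_Least that unfolding k_def by blast
    have "w i \<le> R" if "i < k" for i
      using that
    proof (induction i)
      case (Suc i)
      then show ?case using nnstep[of i] k'[of i] by auto
    qed (simp add: w0)
    moreover have "R \<le> w i" if "Suc k \<le> i" for i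
      using that
    proof (induction i rule: dec_induct)
      case (step i)
      show ?case
      proof (cases "w i = R")
        case True
        then show ?thesis using s[unfolded srt, rule_format, of k i] k step by auto
      next
        case False
        then show ?thesis using nnstep[of i] step by auto
      qed
    qed (simp add: k)
    ultimately show "R \<in> Cw w" using k by (auto simp: Cw_def intro!: exI[of _ k])
  qed
qed

text \<open>Expresses the counts in the definitions by countable quantifiers over finite times, from
  which measurability follows.\<close>

lemma finite_card_iff_eventually:
  fixes S :: "nat set"
  shows "finite S \<and> card S = a \<longleftrightarrow> (\<exists>k0. \<forall>k\<ge>k0. card {i. i < k \<and> i \<in> S} = a)"
proof
  assume S: "finite S \<and> card S = a"
  then obtain k0 where "\<forall>i\<in>S. i < k0" using finite_nat_set_iff_bounded by blast
  then have "{i. i < k \<and> i \<in> S} = S" if "k0 \<le> k" for k using that by auto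
  then have "\<forall>k\<ge>k0. card {i. i < k \<and> i \<in> S} = a" using S by simp
  then show "\<exists>k0. \<forall>k\<ge>k0. card {i. i < k \<and> i \<in> S} = a" by blast
next
  assume "\<exists>k0. \<forall>k\<ge>k0. card {i. i < k \<and> i \<in> S} = a"
  then obtain k0 where k0: "\<And>k. k0 \<le> k \<Longrightarrow> card {i. i < k \<and> i \<in> S} = a" by blast
  have fin: "finite S"
  proof (rule ccontr)
    assume "infinite S"
    then obtain B where B: "finite B" "card B = Suc a" "B \<subseteq> S" using infinite_arbitrarily_large by blast
    obtain k1 where k1: "\<forall>i\<in>B. i < k1" using finite_nat_set_iff_bounded B(1) by blast
    have "B \<subseteq> {i. i < max k0 k1 \<and> i \<in> S}" using B(3) k1 by auto
    then have "card B \<le> card {i. i < max k0 k1 \<and> i \<in> S}" by (intro card_mono) auto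
    then show False using k0[of "max k0 k1"] B(2) by simp
  qed
  then obtain k1 where k1: "\<forall>i\<in>S. i < k1" using finite_nat_set_iff_bounded by blast
  then have "{i. i < max k0 k1 \<and> i \<in> S} = S" by auto
  then show "finite S \<and> card S = a" using k0[of "max k0 k1"] fin by simp
qed

section \<open>Weights of exit stacks\<close>

text \<open>The last up-step is never undone, so \<open>j\<close> counts the up-steps that are
  followed by a return, and \<open>d\<close> is the corresponding number one site lower: these are
  two consecutive states of \<open>V\<close>.\<close>

definition closed_stacks :: "nat \<Rightarrow> nat \<Rightarrow> bool list set" where
  "closed_stacks d j = {s. ends_up s \<and> downs s = d \<and> ups s = Suc j}"

lemma card_lists_ups_downs: "finite {t. downs t = d \<and> ups t = j} \<and> card {t. downs t = d \<and> ups t = j} = (d + j) choose d"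
proof (induction "d + j" arbitrary: d j)
  case 0
  have "{t. downs t = 0 \<and> ups t = 0} = {[]}"
  proof -
    have "t = []" if "downs t = 0" "ups t = 0" for t using ups_plus_downs[of t] that by simp
    then show ?thesis by auto
  qed
  with 0 show ?case by simp
next
  case (Suc n)
  define A where "A d j = {t. downs t = d \<and> ups t = j}" for d j
  have IH: "finite (A d' j') \<and> card (A d' j') = (d' + j') choose d'" if "n = d' + j'" for d' j'
    unfolding A_def by (rule Suc.hyps(1)[OF that])
  have eq: "A d j = (case d of 0 \<Rightarrow> {} | Suc d' \<Rightarrow> (#) False ` A d' j) \<union> (case j of 0 \<Rightarrow> {} | Suc j' \<Rightarrow> (#) True ` A d j')"
  proof (intro set_eqI iffI)
    fix t assume "t \<in> A d j"
    then obtain b u where t: "t = b # u" "downs t = d" "ups t = j"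
      using Suc(2) by (cases t) (auto simp: A_def)
    then show "t \<in> (case d of 0 \<Rightarrow> {} | Suc d' \<Rightarrow> (#) False ` A d' j) \<union> (case j of 0 \<Rightarrow> {} | Suc j' \<Rightarrow> (#) True ` A d j')"
      by (cases b) (auto simp: A_def)
  next
    fix t assume "t \<in> (case d of 0 \<Rightarrow> {} | Suc d' \<Rightarrow> (#) False ` A d' j) \<union> (case j of 0 \<Rightarrow> {} | Suc j' \<Rightarrow> (#) True ` A d j')"
    then show "t \<in> A d j" by (auto simp: A_def split: nat.splits)
  qed
  have "finite (A d j) \<and> card (A d j) = (d + j) choose d"
  proof (cases d)
    case 0
    then obtain j' where j: "j = Suc j'" using Suc(2) by (cases j) auto
    show ?thesis unfolding eq using IH[of 0 j'] 0 j Suc(2) by (simp add: card_image)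
  next
    case d: (Suc d')
    show ?thesis
    proof (cases j)
      case 0
      show ?thesis unfolding eq using IH[of d' 0] 0 d Suc(2) by (simp add: card_image)
    next
      case (Suc j')
      have n: "n = d' + j" "n = d + j'" using d Suc \<open>Suc n = d + j\<close> by auto
      have "(d + j) choose d = ((d' + j) choose d') + ((d + j') choose d)"
        unfolding d Suc by (simp only: add_Suc add_Suc_right binomial_Suc_Suc)
      moreover have "card (A d j) = card ((#) False ` A d' j) + card ((#) True ` A d j')"
        unfolding eq using d Suc IH[OF n(1)] IH[OF n(2)] by (simp, subst card_Un_disjoint) auto
      moreover have "finite (A d j)"
        unfolding eq using d Suc IH[OF n(1)] IH[OF n(2)] by simp
      ultimately show ?thesis using IH[OF n(1)] IH[OF n(2)] by (simp add: card_image)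
    qed
  qed
  then show ?case unfolding A_def .
qed

lemma closed_stacks_finite_card: "finite (closed_stacks d j)" "card (closed_stacks d j) = (d + j) choose d"
proof -
  have "closed_stacks d j = (\<lambda>t. t @ [True]) ` {t. downs t = d \<and> ups t = j}"
  proof (intro set_eqI iffI)
    fix s assume s: "s \<in> closed_stacks d j"
    then obtain t where "s = t @ [True]" by (cases s rule: rev_cases) (auto simp: closed_stacks_def ends_up_def)
    with s show "s \<in> (\<lambda>t. t @ [True]) ` {t. downs t = d \<and> ups t = j}" by (auto simp: closed_stacks_def)
  qed (auto simp: closed_stacks_def ends_up_def)
  then show "finite (closed_stacks d j)" "card (closed_stacks d j) = (d + j) choose d"
    using card_lists_ups_downs[of d j] by (auto simp: card_image inj_on_def)
qed

text \<open>Being a weak cutpoint selects one list out of the binomially many that realise a given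
  transition of \<open>V\<close>.\<close>

lemma closed_stacks_sorted: "{s \<in> closed_stacks d j. sorted s} = {replicate d False @ replicate (Suc j) True}"
proof (intro set_eqI iffI)
  fix s assume s: "s \<in> {s \<in> closed_stacks d j. sorted s}"
  have "s = replicate (downs s) False @ replicate (ups s) True" if "sorted s" for s
    using that
  proof (induction s)
    case (Cons b s)
    show ?case
    proof (cases b)
      case True
      then have "\<forall>x\<in>set s. x" using Cons.prems by (auto simp: le_bool_def)
      then have "downs s = 0" by (induction s) auto
      then show ?thesis using Cons True by simp
    qed (use Cons in auto)
  qed simp
  from this[of s] s show "s \<in> {replicate d False @ replicate (Suc j) True}" by (simp add: closed_stacks_def)
next
  have "downs (replicate d b) = (if b then 0 else d)" "ups (replicate d b) = (if b then d else 0)" for d b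
    by (induction d) auto
  moreover have "sorted (replicate d False @ replicate (Suc j) True)"
    by (simp add: sorted_append)
  ultimately show "s \<in> {s \<in> closed_stacks d j. sorted s}" if "s \<in> {replicate d False @ replicate (Suc j) True}" for s
    using that by (auto simp: closed_stacks_def ends_up_def simp del: replicate_Suc)
qed

text \<open>Because of this lemma it suffices to bound the probabilities of stacks from below, that is, to exhibit
  a path realising each of them; no other path has to be excluded.\<close>

lemma (in prob_space) stack_family:
  fixes F :: "bool list \<Rightarrow> 'a set" and g :: "nat \<Rightarrow> real"
  assumes F: "\<And>t. F t \<in> sets M" "\<And>t. F t \<subseteq> D" "\<And>t t'. t \<noteq> t' \<Longrightarrow> F t \<inter> F t' = {}" and D: "D \<in> sets M"
    and ge: "\<And>j t. t \<in> closed_stacks d j \<Longrightarrow> g j \<le> prob (F t)"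
    and sums: "(\<lambda>j. real ((d + j) choose d) * g j) sums c"
  shows "c \<le> prob D"
    and "prob D = c \<Longrightarrow> t \<in> closed_stacks d j \<Longrightarrow> prob (F t) = g j"
    and "prob D = c \<Longrightarrow> prob (D - (\<Union>j. \<Union>t\<in>closed_stacks d j. F t)) = 0"
proof -
  define A where "A j = (\<Union>t\<in>closed_stacks d j. F t)" for j
  have A: "A j \<in> sets M" for j unfolding A_def using F closed_stacks_finite_card(1) by auto
  have LL: "j = j'" if "t \<in> closed_stacks d j" "t \<in> closed_stacks d j'" for t j j' using that by (auto simp: closed_stacks_def)
  have disj: "disjoint_family A"
    unfolding disjoint_family_on_def
  proof (intro ballI impI equals0I)
    fix i j \<omega> assume "i \<noteq> j" "\<omega> \<in> A i \<inter> A j"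
    then obtain t t' where t: "t \<in> closed_stacks d i" "t' \<in> closed_stacks d j" "\<omega> \<in> F t \<inter> F t'" by (auto simp: A_def)
    then have "t = t'" using F(3)[of t t'] by auto
    with t LL \<open>i \<noteq> j\<close> show False by auto
  qed
  have PA: "prob (A j) = (\<Sum>t\<in>closed_stacks d j. prob (F t))" for j
    unfolding A_def using F closed_stacks_finite_card(1)[of d j]
    by (intro finite_measure_finite_Union) (auto simp: disjoint_family_on_def)
  have PAge: "real ((d + j) choose d) * g j \<le> prob (A j)" for j
    unfolding PA using sum_mono[of "closed_stacks d j" "\<lambda>_. g j" "\<lambda>t. prob (F t)"] ge closed_stacks_finite_card(2)[of d j] by simp
  have sA: "(\<lambda>j. prob (A j)) sums prob (\<Union>j. A j)"
    using A disj by (intro finite_measure_UNION) auto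
  have le: "c \<le> prob (\<Union>j. A j)" by (rule sums_le[OF PAge sums sA])
  have le2: "prob (\<Union>j. A j) \<le> prob D" using A F D by (intro finite_measure_mono) (auto simp: A_def)
  show "c \<le> prob D" using le le2 by simp
  { assume eq: "prob D = c"
    then have eqA: "prob (\<Union>j. A j) = c" using le le2 by simp
    \<comment> \<open>The lower bounds add up to the whole mass of \<open>D\<close>, so the
      nonnegative differences sum to 0 and each of them vanishes.\<close>
    have "(\<lambda>j. prob (A j) - real ((d + j) choose d) * g j) sums (c - c)"
      using sA sums unfolding eqA by (rule sums_diff)
    then have z: "prob (A j) - real ((d + j) choose d) * g j = 0" for j
      using PAge suminf_eq_zero_iff[of "\<lambda>j. prob (A j) - real ((d + j) choose d) * g j"]
      by (auto simp: sums_iff)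
    show "prob (F t) = g j" if t: "t \<in> closed_stacks d j"
    proof -
      have "(\<Sum>t\<in>closed_stacks d j. prob (F t) - g j) = 0"
        using z[of j] closed_stacks_finite_card[of d j] unfolding PA by (simp add: sum_subtractf)
      then have "\<forall>t\<in>closed_stacks d j. prob (F t) - g j = 0"
        using ge closed_stacks_finite_card(1)[of d j] by (subst (asm) sum_nonneg_eq_0_iff) auto
      then show ?thesis using t by auto
    qed
    have "prob (D - (\<Union>j. A j)) = prob D - prob (\<Union>j. A j)"
      using A D F by (intro finite_measure_Diff) (auto simp: A_def)
    then have "prob (D - (\<Union>j. A j)) = 0" using eqA eq by simp
    then show "prob (D - (\<Union>j. \<Union>t\<in>closed_stacks d j. F t)) = 0" unfolding A_def .
  }
qed

text \<open>The events attached to different levels \<open>L\<close> are not nested, hence the limit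
  superior in place of a monotone limit.\<close>

lemma (in prob_space) prob_limsup_ge:
  assumes A: "\<And>L. A L \<in> sets M" and ge: "\<forall>\<^sub>F L in sequentially. a L \<le> prob (A L)" and lim: "a \<longlonglongrightarrow> l"
  shows "l \<le> prob (\<Inter>m. \<Union>L\<in>{m..}. A L)"
proof -
  have "(\<lambda>m. prob (\<Union>L\<in>{m..}. A L)) \<longlonglongrightarrow> prob (\<Inter>m. \<Union>L\<in>{m..}. A L)"
    by (rule finite_Lim_measure_decseq) (use A in \<open>auto simp: decseq_def, force\<close>)
  moreover have "l \<le> prob (\<Union>L\<in>{m..}. A L)" for m
  proof (rule tendsto_upperbound[OF lim])
    show "\<forall>\<^sub>F L in sequentially. a L \<le> prob (\<Union>L\<in>{m..}. A L)"
      using ge eventually_ge_at_top[of m]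
    proof eventually_elim
      case (elim L)
      have "prob (A L) \<le> prob (\<Union>L\<in>{m..}. A L)"
        using A elim by (intro finite_measure_mono) auto
      then show ?case using elim by simp
    qed
  qed simp
  ultimately show ?thesis by (intro LIMSEQ_le_const) auto
qed

lemma (in prob_space) prob_sums_nat:
  assumes f: "f \<in> measurable M (count_space UNIV)" and A: "A \<in> sets M"
  shows "(\<lambda>n::nat. prob (A \<inter> {\<omega> \<in> space M. f \<omega> = n})) sums prob A"
proof -
  have m: "A \<inter> {\<omega> \<in> space M. f \<omega> = n} \<in> sets M" for n using f A by measurable
  have "(\<Union>n. A \<inter> {\<omega> \<in> space M. f \<omega> = n}) = A" using sets.sets_into_space[OF A] by auto
  moreover have "(\<lambda>n. prob (A \<inter> {\<omega> \<in> space M. f \<omega> = n})) sums prob (\<Union>n. A \<inter> {\<omega> \<in> space M. f \<omega> = n})"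
    using m by (intro finite_measure_UNION) (auto simp: disjoint_family_on_def)
  ultimately show ?thesis by simp
qed

lemma (in prob_space) prob_sums_countable:
  fixes f :: "'a \<Rightarrow> 'b :: countable"
  assumes [measurable]: "f \<in> measurable M (count_space UNIV)" and A: "A \<in> sets M"
  shows "(\<lambda>n. prob (A \<inter> {\<omega> \<in> space M. to_nat (f \<omega>) = n})) sums prob A"
  by (rule prob_sums_nat[OF _ A]) measurable

lemma (in prob_space) prob_eq_countable:
  fixes f :: "'a \<Rightarrow> 'b :: countable"
  assumes f: "f \<in> measurable M (count_space UNIV)" and A: "A \<in> sets M" and B: "B \<in> sets M"
    and eq: "\<And>v. prob (A \<inter> {\<omega> \<in> space M. f \<omega> = v}) = prob (B \<inter> {\<omega> \<in> space M. f \<omega> = v}) * c"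
  shows "prob A = prob B * c"
proof -
  have "prob (A \<inter> {\<omega> \<in> space M. to_nat (f \<omega>) = n}) = prob (B \<inter> {\<omega> \<in> space M. to_nat (f \<omega>) = n}) * c" for n
  proof (cases "\<exists>v::'b. to_nat v = n")
    case True
    then obtain v :: 'b where "n = to_nat v" by blast
    then show ?thesis using eq[of v] by simp
  next
    case False
    then have "{\<omega> \<in> space M. to_nat (f \<omega>) = n} = {}" by auto
    then show ?thesis by (simp only: Int_empty_right measure_empty mult_zero_left)
  qed
  then show ?thesis
    using prob_sums_countable[OF f A] sums_mult2[OF prob_sums_countable[OF f B], of c] by (simp add: sums_iff)
qed

section \<open>Weights of lists and gambler's ruin probabilities\<close>

definition exit_weight :: "nat \<Rightarrow> bool list \<Rightarrow> real" where
  "exit_weight y s = p_seq y ^ ups s * (1 - p_seq y) ^ downs s"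

lemma exit_weight_simps[simp]: "exit_weight y [] = 1" "exit_weight y (s @ t) = exit_weight y s * exit_weight y t"
  "exit_weight y [b] = (if b then p_seq y else 1 - p_seq y)"
  by (auto simp: exit_weight_def power_add)

lemma exit_weight_closed_stacks: "s \<in> closed_stacks d j \<Longrightarrow> exit_weight y s = p_seq y ^ Suc j * (1 - p_seq y) ^ d"
  by (simp add: exit_weight_def closed_stacks_def)

definition consistent_stacks :: "nat \<Rightarrow> (nat \<Rightarrow> bool list) \<Rightarrow> bool" where
  "consistent_stacks n s \<longleftrightarrow> downs (s 0) = 0 \<and> (\<forall>y\<le>n. ends_up (s y)) \<and> (\<forall>y<n. ups (s y) = downs (s (Suc y)) + 1)"

lemma consistent_stacks_Suc:
  "consistent_stacks (Suc n) s \<longleftrightarrow> consistent_stacks n s \<and> ends_up (s (Suc n)) \<and> ups (s n) = downs (s (Suc n)) + 1"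
  by (auto simp: consistent_stacks_def le_Suc_eq less_Suc_eq)

lemma consistent_stacks_cong:
  "(\<And>y. y \<le> n \<Longrightarrow> s y = s' y) \<Longrightarrow> consistent_stacks n s = consistent_stacks n s'"
  by (auto simp: consistent_stacks_def)

lemma consistent_stacks_extend:
  assumes "consistent_stacks n s" "t \<in> closed_stacks (ups (s n) - 1) j"
  shows "consistent_stacks (Suc n) (s(Suc n := t))"
  using assms ends_up_ups[of "s n"] consistent_stacks_cong[of n s "s(Suc n := t)"]
  by (auto simp: consistent_stacks_Suc closed_stacks_def consistent_stacks_def)

text \<open>From \<open>y\<close> the walk reaches \<open>y - 1\<close> before \<open>L\<close> with probability \<open>ret_prob L y\<close> and \<open>L\<close> before \<open>y - 1\<close>
  with probability \<open>esc_prob L y\<close>: \<open>1 / y\<close> is harmonic at \<open>y \<ge> 2\<close>, and site 1 is special because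
  \<open>p_seq 1 = 3 / 4\<close>. The limits \<open>L \<rightarrow> \<infinity>\<close> are \<open>ret_prob_lim y\<close> and \<open>esc_prob_lim y\<close>.\<close>

definition ret_prob :: "nat \<Rightarrow> nat \<Rightarrow> real" where
  "ret_prob L y = (if y = 1 then 2 * (real L - 1) / (5 * real L - 2)
     else (real L - real y) * (real y - 1) / (real y * (real L - real y + 1)))"

definition esc_prob :: "nat \<Rightarrow> nat \<Rightarrow> real" where
  "esc_prob L y = (if y = 1 then 3 * real L / (5 * real L - 2)
     else real L / (real y * (real L - real y + 1)))"

definition ret_prob_lim :: "nat \<Rightarrow> real" where
  "ret_prob_lim y = (if y = 1 then 2 / 5 else (real y - 1) / real y)"

definition esc_prob_lim :: "nat \<Rightarrow> real" where
  "esc_prob_lim y = (if y = 1 then 3 / 5 else 1 / real y)"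

lemma ret_prob_top: "0 < L \<Longrightarrow> ret_prob L L = 0" "0 < L \<Longrightarrow> esc_prob L L = 1"
  by (auto simp: ret_prob_def esc_prob_def)

lemma LIMSEQ_ret_prob: "(\<lambda>L. ret_prob L y) \<longlonglongrightarrow> ret_prob_lim y"
proof (cases "y = 1")
  case True
  have "(\<lambda>L. 2 * (real L - 1) / (5 * real L - 2)) \<longlonglongrightarrow> 2 / 5" by real_asymp
  with True show ?thesis by (simp add: ret_prob_def ret_prob_lim_def)
next
  case False
  have "(\<lambda>L. (real L - real y) * (real y - 1) / (real y * (real L - real y + 1))) \<longlonglongrightarrow> (real y - 1) / real y"
    if "0 < y" using that by (real_asymp simp: divide_inverse)
  with False show ?thesis by (cases "y = 0") (simp_all add: ret_prob_def[abs_def] ret_prob_lim_def)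
qed

lemma LIMSEQ_esc_prob: "(\<lambda>L. esc_prob L y) \<longlonglongrightarrow> esc_prob_lim y"
proof (cases "y = 1")
  case True
  have "(\<lambda>L. 3 * real L / (5 * real L - 2)) \<longlonglongrightarrow> 3 / 5" by real_asymp
  with True show ?thesis by (simp add: esc_prob_def esc_prob_lim_def)
next
  case False
  have "(\<lambda>L. real L / (real y * (real L - real y + 1))) \<longlonglongrightarrow> 1 / real y"
    if "0 < y" using that by (real_asymp simp: divide_inverse)
  with False show ?thesis by (cases "y = 0") (simp_all add: esc_prob_def[abs_def] esc_prob_lim_def)
qed

lemma p_seq_1: "p_seq (Suc 0) = 3/4" by (simp add: p_seq_def r_seq_def)

lemma p_seq_ge2: "2 \<le> y \<Longrightarrow> p_seq y = (real y + 1) / (2 * real y)"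
  by (simp add: p_seq_def r_seq_def field_simps)

text \<open>First-step analysis: from \<open>y\<close> the walk steps down, or it steps up and then
  either comes back to \<open>y\<close> or escapes. Solving
  \<open>ret = (1 - p) + p * ret' * ret\<close> and \<open>esc = p * esc' + p * ret' * esc\<close>,
  where primes refer to \<open>Suc y\<close>, gives the quotients, which are also the form that
  \<open>geometric_step_sums\<close> produces.\<close>

lemma ret_prob_step:
  assumes "1 \<le> y" "y < L"
  shows "0 \<le> p_seq y * ret_prob L (Suc y) \<and> p_seq y * ret_prob L (Suc y) < 1 \<and>
    ret_prob L y = (1 - p_seq y) / (1 - p_seq y * ret_prob L (Suc y)) \<and>
    esc_prob L y = p_seq y * esc_prob L (Suc y) / (1 - p_seq y * ret_prob L (Suc y))"
proof -
  \<comment> \<open>In terms of the distance to \<open>L\<close> every denominator is visibly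
    positive.\<close>
  define m where "m = real L - real y"
  have m: "1 \<le> m" "real L = m + real y" using assms by (auto simp: m_def)
  have m0: "m \<noteq> 0" "m + 1 \<noteq> 0" "5 * m + 3 \<noteq> 0" "0 < m" using m by auto
  show ?thesis
  proof (cases "y = 1")
    case True
    have 1: "ret_prob L (Suc y) = (m - 1) / (2 * m)" "esc_prob L (Suc y) = (m + 1) / (2 * m)"
      "ret_prob L y = 2 * m / (5 * m + 3)" "esc_prob L y = 3 * (m + 1) / (5 * m + 3)" "p_seq y = 3 / 4"
      using m True by (simp_all add: ret_prob_def esc_prob_def p_seq_1)
    have 2: "1 - p_seq y * ret_prob L (Suc y) = (5 * m + 3) / (8 * m)"
      unfolding 1 using m0 by (simp add: field_simps)
    have "0 \<le> p_seq y * ret_prob L (Suc y)" unfolding 1 using m by simp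
    moreover have "0 < (5 * m + 3) / (8 * m)" using m by simp
    ultimately have "0 \<le> p_seq y * ret_prob L (Suc y) \<and> p_seq y * ret_prob L (Suc y) < 1" using 2 by linarith
    moreover have "ret_prob L y = (1 - p_seq y) / (1 - p_seq y * ret_prob L (Suc y))"
      unfolding 2 unfolding 1 using m0 by (simp add: divide_simps)
    moreover have "esc_prob L y = p_seq y * esc_prob L (Suc y) / (1 - p_seq y * ret_prob L (Suc y))"
      unfolding 2 unfolding 1 using m0 by (simp add: divide_simps)
    ultimately show ?thesis by blast
  next
    case False
    then have y: "2 \<le> y" using assms by simp
    then have y0: "real y \<noteq> 0" "real y + 1 \<noteq> 0" by auto
    have 1: "ret_prob L (Suc y) = (m - 1) * real y / ((real y + 1) * m)" "esc_prob L (Suc y) = (m + real y) / ((real y + 1) * m)"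
      "ret_prob L y = m * (real y - 1) / (real y * (m + 1))" "esc_prob L y = (m + real y) / (real y * (m + 1))"
      "p_seq y = (real y + 1) / (2 * real y)"
      using m y by (simp_all add: ret_prob_def esc_prob_def p_seq_ge2 add.commute)
    have 2: "p_seq y * ret_prob L (Suc y) = (m - 1) / (2 * m)"
      unfolding 1 using m0 y0 by simp
    have 3: "1 - p_seq y * ret_prob L (Suc y) = (m + 1) / (2 * m)"
      unfolding 2 using m0 by (simp add: field_simps)
    have 4: "1 - p_seq y = (real y - 1) / (2 * real y)"
      unfolding 1 using y0 by (simp add: field_simps)
    have "0 \<le> p_seq y * ret_prob L (Suc y) \<and> p_seq y * ret_prob L (Suc y) < 1"
      unfolding 2 using m by simp
    moreover have "ret_prob L y = (1 - p_seq y) / (1 - p_seq y * ret_prob L (Suc y))"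
      unfolding 3 4 unfolding 1 using m0 y0 by simp
    moreover have "esc_prob L y = p_seq y * esc_prob L (Suc y) / (1 - p_seq y * ret_prob L (Suc y))"
      unfolding 3 unfolding 1 using m0 y0 by simp
    ultimately show ?thesis by blast
  qed
qed

lemma p_seq_ret_prob_lim: "1 \<le> y \<Longrightarrow> p_seq y * ret_prob_lim (Suc y) = (if y = 1 then 3 / 8 else 1 / 2)"
  by (auto simp: p_seq_1 p_seq_ge2 ret_prob_lim_def)

lemma ret_prob_lim_step:
  assumes "1 \<le> y"
  shows "ret_prob_lim y = (1 - p_seq y) / (1 - p_seq y * ret_prob_lim (Suc y))"
    "esc_prob_lim y = p_seq y * esc_prob_lim (Suc y) / (1 - p_seq y * ret_prob_lim (Suc y))"
proof -
  show "ret_prob_lim y = (1 - p_seq y) / (1 - p_seq y * ret_prob_lim (Suc y))"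
  proof (cases "y = 1")
    case False
    then have q: "1 - p_seq y = (real y - 1) / (2 * real y)" using assms by (simp add: p_seq_ge2 field_simps)
    show ?thesis unfolding p_seq_ret_prob_lim[OF assms] unfolding ret_prob_lim_def q using False assms by (simp add: field_simps)
  qed (simp add: p_seq_ret_prob_lim ret_prob_lim_def p_seq_1)
  show "esc_prob_lim y = p_seq y * esc_prob_lim (Suc y) / (1 - p_seq y * ret_prob_lim (Suc y))"
    unfolding p_seq_ret_prob_lim[OF assms] esc_prob_lim_def using assms by (auto simp: p_seq_1 p_seq_ge2 divide_simps)
qed

text \<open>Sums out the list at one site: the binomial coefficient counts the lists,
  \<open>p ^ Suc j * q ^ d\<close> is the weight of each, and \<open>B * A ^ j\<close> stands for
  \<open>j\<close> returns from above followed by an escape. With the quotients of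
  \<open>ret_prob_step\<close> the result has again the form escape times a power of return, one
  site lower.\<close>

lemma geometric_step_sums:
  fixes p q A B w :: real
  assumes "0 \<le> p * A" "p * A < 1"
  shows "(\<lambda>j. real ((d + j) choose d) * (w * (p ^ Suc j * q ^ d) * (B * A ^ j)))
    sums (w * (p * B / (1 - p * A) * (q / (1 - p * A)) ^ d))"
proof -
  have "(\<lambda>j. (w * q ^ d * p * B) * (real ((d + j) choose d) * (p * A) ^ j)) sums ((w * q ^ d * p * B) * (1 / (1 - p * A) ^ (d + 1)))"
    using assms by (intro sums_mult neg_binomial_sums) auto
  moreover have "(w * q ^ d * p * B) * (real ((d + j) choose d) * (p * A) ^ j) = real ((d + j) choose d) * (w * (p ^ Suc j * q ^ d) * (B * A ^ j))" for j
    by (simp add: power_mult_distrib)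
  moreover have "(w * q ^ d * p * B) * (1 / (1 - p * A) ^ (d + 1)) = w * (p * B / (1 - p * A) * (q / (1 - p * A)) ^ d)"
    by (simp add: power_divide)
  ultimately show ?thesis by simp
qed

section \<open>The law of the exit stacks\<close>

locale bd_walk = prob_space M for M :: "'w measure" +
  fixes X :: "nat \<Rightarrow> 'w \<Rightarrow> nat"
  assumes chain: "bd_chain M p_seq X"
begin

abbreviation path :: "'w \<Rightarrow> nat \<Rightarrow> nat" where "path \<omega> \<equiv> \<lambda>k. X k \<omega>"

lemma X_measurable[measurable]: "X k \<in> measurable M (count_space UNIV)"
  using chain by (simp add: bd_chain_def)

lemma exit_stack_measurable[measurable]: "(\<lambda>\<omega>. exit_stack (path \<omega>) k y) \<in> measurable M (count_space UNIV)"
proof (induction k)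
  case (Suc k)
  note Suc[measurable]
  show ?case unfolding exit_stack_Suc by measurable
qed simp

lemma final_stack_measurable[measurable]: "(\<lambda>\<omega>. final_stack (path \<omega>) y) \<in> measurable M (count_space UNIV)"
proof -
  have ne: "{\<omega> \<in> space M. final_stack (path \<omega>) y = s} \<in> sets M" if "s \<noteq> []" for s
    unfolding final_stack_nonempty_iff[OF that] by measurable
  have "{\<omega> \<in> space M. final_stack (path \<omega>) y = []} = space M - (\<Union>s\<in>-{[]}. {\<omega> \<in> space M. final_stack (path \<omega>) y = s})"
    by auto
  also have "\<dots> \<in> sets M"
    using ne by (intro sets.Diff sets.top sets.countable_UN'') auto
  finally have "{\<omega> \<in> space M. final_stack (path \<omega>) y = s} \<in> sets M" for s
    using ne by (cases "s = []") auto
  then show ?thesis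
    by (subst measurable_count_space_eq_countable) (auto simp: vimage_def Int_def conj_commute)
qed

section \<open>Lower bounds from paths stopped on reaching a high level\<close>

lemma prob_path:
  assumes "nn_path h k" "\<And>i. i < k \<Longrightarrow> h i < L"
  shows "prob {\<omega> \<in> space M. \<forall>i\<le>k. X i \<omega> = h i} = (\<Prod>y<L. exit_weight y (exit_stack h k y))"
  using assms
proof (induction k)
  case 0
  then show ?case using chain by (simp add: bd_chain_def nn_path_def)
next
  case (Suc k)
  have h: "h (Suc k) = Suc (h k) \<or> (0 < h k \<and> h (Suc k) = h k - 1)" "h k < L" "nn_path h k"
    using Suc.prems by (auto simp: nn_path_def)
  have IH: "prob {\<omega> \<in> space M. \<forall>i\<le>k. X i \<omega> = h i} = (\<Prod>y<L. exit_weight y (exit_stack h k y))"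
    using Suc h(3) by simp
  define c where "c = (if h (Suc k) = Suc (h k) then p_seq (h k) else 1 - p_seq (h k))"
  have "{\<omega> \<in> space M. \<forall>i\<le>Suc k. X i \<omega> = h i} = {\<omega> \<in> space M. (\<forall>i\<le>k. X i \<omega> = h i) \<and> X (Suc k) \<omega> = h (Suc k)}"
    by (auto simp: le_Suc_eq)
  also have "prob \<dots> = c * prob {\<omega> \<in> space M. \<forall>i\<le>k. X i \<omega> = h i}"
    using chain h(1) unfolding bd_chain_def c_def by (cases "h (Suc k) = Suc (h k)") auto
  also have "\<dots> = (\<Prod>y<L. exit_weight y (exit_stack h k y)) * (\<Prod>y<L. if y = h k then c else 1)"
    unfolding IH using h(2) by (simp add: prod.delta)
  also have "\<dots> = (\<Prod>y<L. exit_weight y (exit_stack h (Suc k) y))"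
    unfolding prod.distrib[symmetric] by (intro prod.cong) (auto simp: exit_stack_Suc c_def)
  finally show ?case .
qed

text \<open>The time \<open>k\<close> is the first hitting time of \<open>L\<close>, so it is
  unique, and different lists give disjoint events. The lists between \<open>n\<close> and
  \<open>L\<close> are left free.\<close>

definition hit_event :: "nat \<Rightarrow> nat \<Rightarrow> (nat \<Rightarrow> bool list) \<Rightarrow> 'w set" where
  "hit_event L n s = {\<omega> \<in> space M. \<exists>k. X k \<omega> = L \<and> (\<forall>i<k. X i \<omega> < L) \<and> (\<forall>y\<le>n. exit_stack (path \<omega>) k y = s y)}"

lemma hit_event_sets[measurable]: "hit_event L n s \<in> sets M"
  unfolding hit_event_def by measurable

lemma hit_event_disjoint:
  assumes "s n \<noteq> s' n"
  shows "hit_event L n s \<inter> hit_event L n s' = {}"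
proof (rule equals0I)
  fix \<omega> assume "\<omega> \<in> hit_event L n s \<inter> hit_event L n s'"
  then obtain k k' where k: "X k \<omega> = L" "\<forall>i<k. X i \<omega> < L" "exit_stack (path \<omega>) k n = s n"
      "X k' \<omega> = L" "\<forall>i<k'. X i \<omega> < L" "exit_stack (path \<omega>) k' n = s' n"
    by (auto simp: hit_event_def)
  then have "k = k'" by (metis less_irrefl linorder_neqE_nat)
  with k assms show False by simp
qed

text \<open>Induction downwards from \<open>n = L - 1\<close>, where a path is exhibited; each step
  sums over the list at \<open>Suc n\<close>. The factor after the product says that of the arrivals
  at \<open>Suc n\<close> from \<open>n\<close>, all but the last are followed by a return to
  \<open>n\<close> before \<open>L\<close>, and the last by an escape to \<open>L\<close>.\<close>

lemma prob_hit_event_ge: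
  assumes "consistent_stacks n s" "n < L"
  shows "(\<Prod>y\<le>n. exit_weight y (s y)) * (esc_prob L (Suc n) * ret_prob L (Suc n) ^ (ups (s n) - 1)) \<le> prob (hit_event L n s)"
  using assms
proof (induction "L - 1 - n" arbitrary: n s)
  case 0
  then have L: "L = Suc n" by simp
  show ?case
  proof (cases "ups (s n) = 1")
    case True
    obtain h k where h: "nn_path h k" "h k = L" "\<forall>i<k. h i < L" "\<forall>y<L. exit_stack h k y = s y"
      using consistent_stacks_path[of L s] 0 True L by (auto simp: consistent_stacks_def)
    have "(\<Prod>y\<le>n. exit_weight y (s y)) = (\<Prod>y<L. exit_weight y (exit_stack h k y))"
      unfolding L lessThan_Suc_atMost using h(4) L by (intro prod.cong) auto
    also have "\<dots> = prob {\<omega> \<in> space M. \<forall>i\<le>k. X i \<omega> = h i}"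
      using h by (intro prob_path[symmetric]) auto
    also have "\<dots> \<le> prob (hit_event L n s)"
    proof (intro finite_measure_mono hit_event_sets subsetI)
      fix \<omega> assume \<omega>: "\<omega> \<in> {\<omega> \<in> space M. \<forall>i\<le>k. X i \<omega> = h i}"
      then have "exit_stack (path \<omega>) k y = exit_stack h k y" for y by (intro exit_stack_cong) auto
      then show "\<omega> \<in> hit_event L n s" using \<omega> h L unfolding hit_event_def by (auto intro!: exI[of _ k])
    qed
    finally show ?thesis using True ret_prob_top[of L] L by simp
  next
    case False
    \<comment> \<open>More than one up-step from \<open>L - 1\<close> is impossible before
      \<open>L\<close> is hit; the formula agrees, since \<open>ret_prob L L = 0\<close> makes the
      bound 0.\<close>
    have "0 < ups (s n)" using 0 ends_up_ups by (auto simp: consistent_stacks_def)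
    with False have "0 < ups (s n) - 1" by simp
    then have "ret_prob L (Suc n) ^ (ups (s n) - 1) = 0" using ret_prob_top[of L] L by (simp add: zero_power)
    then show ?thesis by (simp only: mult_zero_right measure_nonneg)
  qed
next
  case (Suc m)
  define d where "d = ups (s n) - 1"
  define w where "w = (\<Prod>y\<le>n. exit_weight y (s y))"
  have nL: "Suc n < L" using Suc(2) by simp
  have "w * (p_seq (Suc n) * esc_prob L (Suc (Suc n)) / (1 - p_seq (Suc n) * ret_prob L (Suc (Suc n)))
      * ((1 - p_seq (Suc n)) / (1 - p_seq (Suc n) * ret_prob L (Suc (Suc n)))) ^ d) \<le> prob (hit_event L n s)"
  proof (rule stack_family(1)[where F = "\<lambda>t. hit_event L (Suc n) (s(Suc n := t))" and d = d])
    show "hit_event L (Suc n) (s(Suc n := t)) \<subseteq> hit_event L n s" for t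
      by (force simp: hit_event_def)
    show "hit_event L (Suc n) (s(Suc n := t)) \<inter> hit_event L (Suc n) (s(Suc n := t')) = {}" if "t \<noteq> t'" for t t'
      using that by (intro hit_event_disjoint) simp
    fix j t assume t: "t \<in> closed_stacks d j"
    have "(\<Prod>y\<le>Suc n. exit_weight y ((s(Suc n := t)) y)) * (esc_prob L (Suc (Suc n)) * ret_prob L (Suc (Suc n)) ^ (ups ((s(Suc n := t)) (Suc n)) - 1))
        \<le> prob (hit_event L (Suc n) (s(Suc n := t)))"
      using Suc(2) Suc.prems nL t by (intro Suc(1) consistent_stacks_extend) (auto simp: d_def)
    moreover have "(\<Prod>y\<le>Suc n. exit_weight y ((s(Suc n := t)) y)) = w * (p_seq (Suc n) ^ Suc j * (1 - p_seq (Suc n)) ^ d)"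
      using exit_weight_closed_stacks[OF t, of "Suc n"] by (simp add: w_def)
    moreover have "ups ((s(Suc n := t)) (Suc n)) - 1 = j" using t by (simp add: closed_stacks_def)
    ultimately show "w * (p_seq (Suc n) ^ Suc j * (1 - p_seq (Suc n)) ^ d) * (esc_prob L (Suc (Suc n)) * ret_prob L (Suc (Suc n)) ^ j)
        \<le> prob (hit_event L (Suc n) (s(Suc n := t)))" by simp
  next
    show "(\<lambda>j. real ((d + j) choose d) * (w * (p_seq (Suc n) ^ Suc j * (1 - p_seq (Suc n)) ^ d) * (esc_prob L (Suc (Suc n)) * ret_prob L (Suc (Suc n)) ^ j)))
     sums (w * (p_seq (Suc n) * esc_prob L (Suc (Suc n)) / (1 - p_seq (Suc n) * ret_prob L (Suc (Suc n)))
      * ((1 - p_seq (Suc n)) / (1 - p_seq (Suc n) * ret_prob L (Suc (Suc n)))) ^ d))"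
      using ret_prob_step[of "Suc n" L] nL by (intro geometric_step_sums) auto
  qed (rule hit_event_sets)+
  then show ?case
    using ret_prob_step[of "Suc n" L] nL unfolding w_def d_def by simp
qed

definition stack_event :: "nat \<Rightarrow> (nat \<Rightarrow> bool list) \<Rightarrow> 'w set" where
  "stack_event n s = {\<omega> \<in> space M. \<forall>y\<le>n. final_stack (path \<omega>) y = s y}"

lemma stack_event_sets[measurable]: "stack_event n s \<in> sets M"
  unfolding stack_event_def by measurable

text \<open>High levels are hit late, so the lists agree with \<open>s\<close> at arbitrarily late
  times. Lists only grow by appending, so they cannot change between two such times.\<close>

lemma limsup_hit_event_subset:
  "(\<Inter>m. \<Union>L\<in>{m..}. hit_event L n s) \<subseteq> stack_event n s"
proof
  fix \<omega> assume \<omega>: "\<omega> \<in> (\<Inter>m. \<Union>L\<in>{m..}. hit_event L n s)"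
  have large: "\<exists>k\<ge>k1. \<forall>y\<le>n. exit_stack (path \<omega>) k y = s y" for k1
  proof -
    define m where "m = Suc (Max (path \<omega> ` {..k1}))"
    obtain L where L: "L \<ge> m" "\<omega> \<in> hit_event L n s" using \<omega> by auto
    then obtain k where k: "X k \<omega> = L" "\<forall>y\<le>n. exit_stack (path \<omega>) k y = s y" by (auto simp: hit_event_def)
    have "\<not> k \<le> k1"
    proof
      assume "k \<le> k1"
      then have "X k \<omega> \<le> Max (path \<omega> ` {..k1})" by (intro Max_ge) auto
      then show False using L(1) k(1) by (simp add: m_def)
    qed
    with k show ?thesis by (intro exI[of _ k]) auto
  qed
  obtain k0 where k0: "\<forall>y\<le>n. exit_stack (path \<omega>) k0 y = s y" using large[of 0] by blast
  have "final_stack (path \<omega>) y = s y" if y: "y \<le> n" for y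
  proof (rule final_stack_eqI)
    fix k assume "k0 \<le> k"
    obtain k1 where k1: "k1 \<ge> k" "\<forall>y\<le>n. exit_stack (path \<omega>) k1 y = s y" using large[of k] by blast
    obtain r r' where "exit_stack (path \<omega>) k y = exit_stack (path \<omega>) k0 y @ r" "exit_stack (path \<omega>) k1 y = exit_stack (path \<omega>) k y @ r'"
      using exit_stack_mono[OF \<open>k0 \<le> k\<close>, of "path \<omega>" y] exit_stack_mono[OF k1(1), of "path \<omega>" y] by blast
    then show "exit_stack (path \<omega>) k y = s y" using k0 k1 y by simp
  qed
  moreover have "\<omega> \<in> space M" using \<omega> by (auto simp: hit_event_def)
  ultimately show "\<omega> \<in> stack_event n s" by (simp add: stack_event_def)
qed

definition stack_weight :: "nat \<Rightarrow> (nat \<Rightarrow> bool list) \<Rightarrow> real" where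
  "stack_weight n s = (\<Prod>y\<le>n. exit_weight y (s y)) * (esc_prob_lim (Suc n) * ret_prob_lim (Suc n) ^ (ups (s n) - 1))"

lemma prob_stack_event_ge:
  assumes "consistent_stacks n s"
  shows "stack_weight n s \<le> prob (stack_event n s)"
proof -
  have "stack_weight n s \<le> prob (\<Inter>m. \<Union>L\<in>{m..}. hit_event L n s)"
  proof (rule prob_limsup_ge)
    show "\<forall>\<^sub>F L in sequentially. (\<Prod>y\<le>n. exit_weight y (s y)) * (esc_prob L (Suc n) * ret_prob L (Suc n) ^ (ups (s n) - 1)) \<le> prob (hit_event L n s)"
      using eventually_gt_at_top[of n] by eventually_elim (rule prob_hit_event_ge[OF assms])
    show "(\<lambda>L. (\<Prod>y\<le>n. exit_weight y (s y)) * (esc_prob L (Suc n) * ret_prob L (Suc n) ^ (ups (s n) - 1))) \<longlonglongrightarrow> stack_weight n s"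
      unfolding stack_weight_def by (intro tendsto_intros LIMSEQ_ret_prob LIMSEQ_esc_prob)
  qed simp
  also have "\<dots> \<le> prob (stack_event n s)"
    by (intro finite_measure_mono limsup_hit_event_subset stack_event_sets)
  finally show ?thesis .
qed

lemma stack_weight_extend:
  assumes "t \<in> closed_stacks (ups (s n) - 1) j"
  shows "stack_weight (Suc n) (s(Suc n := t)) = (\<Prod>y\<le>n. exit_weight y (s y)) * (p_seq (Suc n) ^ Suc j * (1 - p_seq (Suc n)) ^ (ups (s n) - 1))
     * (esc_prob_lim (Suc (Suc n)) * ret_prob_lim (Suc (Suc n)) ^ j)"
proof -
  have "ups t - 1 = j" using assms by (simp add: closed_stacks_def)
  then show ?thesis unfolding stack_weight_def using exit_weight_closed_stacks[OF assms, of "Suc n"] by simp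
qed

text \<open>Consistency of the weights: the extensions of a family by one site share out its weight
  completely. This is what turns lower bounds into equalities.\<close>

lemma stack_weight_sums:
  "(\<lambda>j. real (((ups (s n) - 1) + j) choose (ups (s n) - 1)) * ((\<Prod>y\<le>n. exit_weight y (s y)) * (p_seq (Suc n) ^ Suc j * (1 - p_seq (Suc n)) ^ (ups (s n) - 1))
     * (esc_prob_lim (Suc (Suc n)) * ret_prob_lim (Suc (Suc n)) ^ j))) sums stack_weight n s"
proof -
  have "0 \<le> p_seq (Suc n) * ret_prob_lim (Suc (Suc n))" "p_seq (Suc n) * ret_prob_lim (Suc (Suc n)) < 1"
    by (simp_all add: p_seq_ret_prob_lim)
  note geometric_step_sums[OF this, of "ups (s n) - 1" "\<Prod>y\<le>n. exit_weight y (s y)" "1 - p_seq (Suc n)" "esc_prob_lim (Suc (Suc n))"]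
  moreover have "ret_prob_lim (Suc n) = (1 - p_seq (Suc n)) / (1 - p_seq (Suc n) * ret_prob_lim (Suc (Suc n)))"
    "esc_prob_lim (Suc n) = p_seq (Suc n) * esc_prob_lim (Suc (Suc n)) / (1 - p_seq (Suc n) * ret_prob_lim (Suc (Suc n)))"
    by (intro ret_prob_lim_step, simp)+
  ultimately show ?thesis unfolding stack_weight_def by (simp only:)
qed

section \<open>From lower bounds to the exact law\<close>

lemma stack_event_disjoint: "s n \<noteq> s' n \<Longrightarrow> stack_event n s \<inter> stack_event n s' = {}"
  by (auto simp: stack_event_def)

text \<open>Site 0 has only up-steps, hence one list for each \<open>j\<close>. From site 1 the walk
  returns to 0 with probability 2/5 and escapes with probability 3/5, so these lower bounds already
  sum to 1.\<close>

lemma prob_stack_event_0: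
  shows "t \<in> closed_stacks 0 j \<Longrightarrow> prob (stack_event 0 (\<lambda>_. t)) = stack_weight 0 (\<lambda>_. t)"
    and "prob (space M - (\<Union>j. \<Union>t\<in>closed_stacks 0 j. stack_event 0 (\<lambda>_. t))) = 0"
proof -
  have W0: "stack_weight 0 (\<lambda>_. t) = 3 / 5 * (2 / 5) ^ j" if "t \<in> closed_stacks 0 j" for t j
    using that by (simp add: stack_weight_def exit_weight_def p_seq_def closed_stacks_def esc_prob_lim_def ret_prob_lim_def)
  have ge: "3 / 5 * (2 / 5) ^ j \<le> prob (stack_event 0 (\<lambda>_. t))" if "t \<in> closed_stacks 0 j" for t j
  proof -
    have "consistent_stacks 0 (\<lambda>_. t)" using that by (simp add: consistent_stacks_def closed_stacks_def)
    from prob_stack_event_ge[OF this] show ?thesis unfolding W0[OF that] .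
  qed
  have "(\<lambda>j. 3 / 5 * (2 / 5) ^ j) sums (3 / 5 * (1 / (1 - 2 / 5)) :: real)"
    by (intro sums_mult geometric_sums) auto
  then have sums: "(\<lambda>j. real ((0 + j) choose 0) * (3 / 5 * (2 / 5) ^ j)) sums 1" by simp
  have sub: "stack_event 0 (\<lambda>_. t) \<subseteq> space M" for t by (auto simp: stack_event_def)
  have disj: "stack_event 0 (\<lambda>_. t) \<inter> stack_event 0 (\<lambda>_. t') = {}" if "t \<noteq> t'" for t t'
    using that by (intro stack_event_disjoint) simp
  show "prob (stack_event 0 (\<lambda>_. t)) = stack_weight 0 (\<lambda>_. t)" if "t \<in> closed_stacks 0 j"
    unfolding W0[OF that]
    by (rule stack_family(2)[where F = "\<lambda>t. stack_event 0 (\<lambda>_. t)" and D = "space M", OF stack_event_sets sub disj sets.top ge sums prob_space that])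
  show "prob (space M - (\<Union>j. \<Union>t\<in>closed_stacks 0 j. stack_event 0 (\<lambda>_. t))) = 0"
    by (rule stack_family(3)[where F = "\<lambda>t. stack_event 0 (\<lambda>_. t)" and D = "space M", OF stack_event_sets sub disj sets.top ge sums prob_space])
qed

lemma prob_stack_event_Suc:
  assumes c: "consistent_stacks n s" and eq: "prob (stack_event n s) = stack_weight n s"
  shows "t \<in> closed_stacks (ups (s n) - 1) j \<Longrightarrow> prob (stack_event (Suc n) (s(Suc n := t))) = stack_weight (Suc n) (s(Suc n := t))"
    and "prob (stack_event n s - (\<Union>j. \<Union>t\<in>closed_stacks (ups (s n) - 1) j. stack_event (Suc n) (s(Suc n := t)))) = 0"
proof -
  have ge: "(\<Prod>y\<le>n. exit_weight y (s y)) * (p_seq (Suc n) ^ Suc j * (1 - p_seq (Suc n)) ^ (ups (s n) - 1))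
      * (esc_prob_lim (Suc (Suc n)) * ret_prob_lim (Suc (Suc n)) ^ j) \<le> prob (stack_event (Suc n) (s(Suc n := t)))"
    if "t \<in> closed_stacks (ups (s n) - 1) j" for t j
    using prob_stack_event_ge[OF consistent_stacks_extend[OF c that]] unfolding stack_weight_extend[of t s n j, OF that] .
  have sub: "stack_event (Suc n) (s(Suc n := t)) \<subseteq> stack_event n s" for t by (force simp: stack_event_def)
  have disj: "stack_event (Suc n) (s(Suc n := t)) \<inter> stack_event (Suc n) (s(Suc n := t')) = {}" if "t \<noteq> t'" for t t'
    using that by (intro stack_event_disjoint) simp
  show "prob (stack_event (Suc n) (s(Suc n := t))) = stack_weight (Suc n) (s(Suc n := t))" if "t \<in> closed_stacks (ups (s n) - 1) j"
    unfolding stack_weight_extend[of t s n j, OF that]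
    by (rule stack_family(2)[where F = "\<lambda>t. stack_event (Suc n) (s(Suc n := t))" and D = "stack_event n s", OF stack_event_sets sub disj stack_event_sets ge stack_weight_sums eq that])
  show "prob (stack_event n s - (\<Union>j. \<Union>t\<in>closed_stacks (ups (s n) - 1) j. stack_event (Suc n) (s(Suc n := t)))) = 0"
    by (rule stack_family(3)[where F = "\<lambda>t. stack_event (Suc n) (s(Suc n := t))" and D = "stack_event n s", OF stack_event_sets sub disj stack_event_sets ge stack_weight_sums eq])
qed

lemma prob_stack_event: "consistent_stacks n s \<Longrightarrow> prob (stack_event n s) = stack_weight n s"
proof (induction n arbitrary: s)
  case 0
  have "s 0 \<in> closed_stacks 0 (ups (s 0) - 1)"
    using 0 ends_up_ups[of "s 0"] by (auto simp: consistent_stacks_def closed_stacks_def)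
  from prob_stack_event_0(1)[OF this] show ?case by (simp add: stack_weight_def stack_event_def)
next
  case (Suc n)
  have c: "consistent_stacks n s" using Suc.prems by (simp add: consistent_stacks_Suc)
  have "s (Suc n) \<in> closed_stacks (ups (s n) - 1) (ups (s (Suc n)) - 1)"
    using Suc.prems ends_up_ups[of "s (Suc n)"] by (auto simp: consistent_stacks_Suc closed_stacks_def)
  from prob_stack_event_Suc(1)[OF c Suc.IH[OF c] this] show ?case by simp
qed

text \<open>Transience and the balance of crossings are obtained here from masses alone: the
  consistent families exhaust the probability space, site by site.\<close>

lemma AE_consistent_stacks: "AE \<omega> in M. consistent_stacks n (final_stack (path \<omega>))"
proof (induction n)
  case 0
  have "space M - (\<Union>j. \<Union>t\<in>closed_stacks 0 j. stack_event 0 (\<lambda>_. t)) \<in> null_sets M"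
    using prob_stack_event_0(2) closed_stacks_finite_card(1)[of 0]
    by (intro null_setsI) (auto simp: emeasure_eq_measure intro!: sets.countable_UN'' countable_finite)
  from AE_not_in[OF this] AE_space show ?case
  proof eventually_elim
    case (elim \<omega>)
    then obtain j t where "t \<in> closed_stacks 0 j" "\<omega> \<in> stack_event 0 (\<lambda>_. t)" by auto
    then show ?case by (simp add: stack_event_def consistent_stacks_def closed_stacks_def)
  qed
next
  case (Suc n)
  \<comment> \<open>Families up to \<open>n\<close> are coded as finite lists, a countable type, so
    that the exceptional null sets can be united.\<close>
  have "AE \<omega> in M. \<forall>\<sigma>::bool list list. consistent_stacks n ((!) \<sigma>) \<longrightarrow>
     \<omega> \<notin> stack_event n ((!) \<sigma>) - (\<Union>j. \<Union>t\<in>closed_stacks (ups (\<sigma> ! n) - 1) j. stack_event (Suc n) (((!) \<sigma>)(Suc n := t)))"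
    unfolding AE_all_countable
  proof
    fix \<sigma> :: "bool list list"
    show "AE \<omega> in M. consistent_stacks n ((!) \<sigma>) \<longrightarrow>
     \<omega> \<notin> stack_event n ((!) \<sigma>) - (\<Union>j. \<Union>t\<in>closed_stacks (ups (\<sigma> ! n) - 1) j. stack_event (Suc n) (((!) \<sigma>)(Suc n := t)))"
    proof (cases "consistent_stacks n ((!) \<sigma>)")
      case True
      have "stack_event n ((!) \<sigma>) - (\<Union>j. \<Union>t\<in>closed_stacks (ups (\<sigma> ! n) - 1) j. stack_event (Suc n) (((!) \<sigma>)(Suc n := t))) \<in> null_sets M"
        using prob_stack_event_Suc(2)[OF True prob_stack_event[OF True]] closed_stacks_finite_card(1)
        by (intro null_setsI) (auto simp: emeasure_eq_measure intro!: sets.countable_UN'' countable_finite)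
      from AE_not_in[OF this] show ?thesis by (rule AE_mp) simp
    qed simp
  qed
  with Suc AE_space show ?case
  proof eventually_elim
    case (elim \<omega>)
    define \<sigma> where "\<sigma> = map (final_stack (path \<omega>)) [0..<Suc n]"
    have \<sigma>: "\<sigma> ! y = final_stack (path \<omega>) y" if "y \<le> n" for y
      using that unfolding \<sigma>_def by (subst nth_map) (auto simp del: upt_Suc)
    have c: "consistent_stacks n ((!) \<sigma>)" using elim(1) consistent_stacks_cong[of n "(!) \<sigma>" "final_stack (path \<omega>)"] \<sigma> by simp
    have "\<omega> \<in> stack_event n ((!) \<sigma>)" using \<sigma> elim by (simp add: stack_event_def)
    then obtain j t where t: "t \<in> closed_stacks (ups (\<sigma> ! n) - 1) j" "\<omega> \<in> stack_event (Suc n) (((!) \<sigma>)(Suc n := t))"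
      using elim(3) c by blast
    then have "final_stack (path \<omega>) (Suc n) = t" by (simp add: stack_event_def)
    moreover have "0 < ups (\<sigma> ! n)" using c ends_up_ups by (auto simp: consistent_stacks_def)
    ultimately show ?case unfolding consistent_stacks_Suc using elim(1) t(1) \<sigma>[of n] by (auto simp: closed_stacks_def)
  qed
qed

section \<open>Markov property of the number of returns\<close>

definition stack_history :: "nat \<Rightarrow> 'w \<Rightarrow> bool list list" where
  "stack_history n \<omega> = map (final_stack (path \<omega>)) [0..<Suc n]"

lemma stack_history_measurable[measurable]: "stack_history n \<in> measurable M (count_space UNIV)"
proof -
  have "(\<lambda>\<omega>. map (final_stack (path \<omega>)) [0..<n]) \<in> measurable M (count_space UNIV)" for n
  proof (induction n)
    case (Suc n)
    note Suc[measurable]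
    show ?case by simp
  qed simp
  then show ?thesis unfolding stack_history_def[abs_def] .
qed

lemma stack_history_nth: "y \<le> n \<Longrightarrow> stack_history n \<omega> ! y = final_stack (path \<omega>) y"
  unfolding stack_history_def by (subst nth_map) (auto simp del: upt_Suc)

lemma stack_history_eq_iff:
  assumes "length \<sigma> = Suc n"
  shows "{\<omega> \<in> space M. stack_history n \<omega> = \<sigma>} = stack_event n ((!) \<sigma>)"
proof -
  have "stack_history n \<omega> = \<sigma> \<longleftrightarrow> (\<forall>y\<le>n. final_stack (path \<omega>) y = \<sigma> ! y)" for \<omega>
    unfolding list_eq_iff_nth_eq using assms by (auto simp: stack_history_nth less_Suc_eq_le stack_history_def simp del: upt_Suc)
  then show ?thesis by (auto simp: stack_event_def)
qed

definition returns :: "nat \<Rightarrow> 'w \<Rightarrow> nat" where "returns x \<omega> = ups (final_stack (path \<omega>) x) - 1"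

lemma returns_measurable[measurable]: "returns x \<in> measurable M (count_space UNIV)"
  unfolding returns_def[abs_def] by measurable

text \<open>The events decided by the lists up to site \<open>x\<close>. Histories take countably
  many values, so every predicate \<open>Q\<close> gives a measurable event, and product formulas
  can be checked for one history at a time.\<close>

definition history_events :: "nat \<Rightarrow> 'w set set" where
  "history_events x = {A. \<exists>Q. A = {\<omega> \<in> space M. Q (stack_history x \<omega>)}}"

lemma history_events_sets: "A \<in> history_events x \<Longrightarrow> A \<in> sets M"
  by (auto simp: history_events_def)

lemma history_events_mono:
  assumes "A \<in> history_events x" "x \<le> y" shows "A \<in> history_events y"
proof -
  obtain Q where Q: "A = {\<omega> \<in> space M. Q (stack_history x \<omega>)}" using assms by (auto simp: history_events_def)
  have "stack_history x \<omega> = take (Suc x) (stack_history y \<omega>)" for \<omega>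
    unfolding stack_history_def take_map using assms(2) by (subst take_upt) (auto simp del: upt_Suc)
  with Q have "A = {\<omega> \<in> space M. Q (take (Suc x) (stack_history y \<omega>))}" by simp
  then show ?thesis unfolding history_events_def by (intro CollectI exI[of _ "\<lambda>\<tau>. Q (take (Suc x) \<tau>)"])
qed

lemma history_events_Int: "A \<in> history_events x \<Longrightarrow> B \<in> history_events x \<Longrightarrow> A \<inter> B \<in> history_events x"
  unfolding history_events_def
proof safe
  fix Q R
  show "\<exists>S. {\<omega> \<in> space M. Q (stack_history x \<omega>)} \<inter> {\<omega> \<in> space M. R (stack_history x \<omega>)} = {\<omega> \<in> space M. S (stack_history x \<omega>)}"
    by (rule exI[of _ "\<lambda>\<tau>. Q \<tau> \<and> R \<tau>"]) auto
qed

lemma history_events_final_stack: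
  "{\<omega> \<in> space M. \<Phi> (\<lambda>y. if y \<le> x then final_stack (path \<omega>) y else [])} \<in> history_events x"
proof -
  have "(\<lambda>y. if y \<le> x then final_stack (path \<omega>) y else []) = (\<lambda>y. if y \<le> x then stack_history x \<omega> ! y else [])" for \<omega>
    by (auto simp: stack_history_nth)
  then show ?thesis unfolding history_events_def by (intro CollectI exI[of _ "\<lambda>\<tau>. \<Phi> (\<lambda>y. if y \<le> x then \<tau> ! y else [])"]) simp
qed

text \<open>The fair coin in exact form: given any past with \<open>returns x \<omega> = i\<close>,
  an admissible list of length \<open>i + j + 1\<close> has probability 1/2 per exit, whatever the
  site and the order of its steps.\<close>

lemma prob_next_stack:
  assumes A: "A \<in> history_events x" and x: "1 \<le> x" and t: "t \<in> closed_stacks i j"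
  shows "prob (A \<inter> {\<omega> \<in> space M. final_stack (path \<omega>) (Suc x) = t}) = prob (A \<inter> {\<omega> \<in> space M. returns x \<omega> = i}) * (1 / 2 ^ (i + j + 1))"
proof (rule prob_eq_countable[where f = "stack_history x"])
  show "A \<inter> {\<omega> \<in> space M. final_stack (path \<omega>) (Suc x) = t} \<in> sets M" "A \<inter> {\<omega> \<in> space M. returns x \<omega> = i} \<in> sets M"
    using history_events_sets[OF A] by measurable
  obtain Q where Q: "A = {\<omega> \<in> space M. Q (stack_history x \<omega>)}" using A by (auto simp: history_events_def)
  \<comment> \<open>Histories that violate the balance of crossings are null, so only consistent
    ones have to be computed.\<close>
  have null: "prob S = 0" if "S \<in> sets M" "\<And>\<omega>. \<omega> \<in> S \<Longrightarrow> \<not> consistent_stacks n (final_stack (path \<omega>))" for S n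
  proof -
    have "AE \<omega> in M. \<omega> \<notin> S" using AE_consistent_stacks[of n] by eventually_elim (use that(2) in blast)
    then show ?thesis using that(1) by (simp add: prob_eq_0)
  qed
  fix \<sigma> :: "bool list list"
  let ?H = "{\<omega> \<in> space M. stack_history x \<omega> = \<sigma>}"
  let ?l = "A \<inter> {\<omega> \<in> space M. final_stack (path \<omega>) (Suc x) = t} \<inter> ?H"
  let ?r = "A \<inter> {\<omega> \<in> space M. returns x \<omega> = i} \<inter> ?H"
  have ms: "?l \<in> sets M" "?r \<in> sets M" using history_events_sets[OF A] by measurable
  show "prob ?l = prob ?r * (1 / 2 ^ (i + j + 1))"
  proof (cases "Q \<sigma> \<and> length \<sigma> = Suc x")
    case False
    then have "?l = {}" "?r = {}" by (auto simp: Q stack_history_def)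
    then show ?thesis by (simp only: measure_empty mult_zero_left)
  next
    case True
    then have H: "?H = stack_event x ((!) \<sigma>)" and QT: "Q \<sigma>" by (auto simp: stack_history_eq_iff)
    have fsH: "final_stack (path \<omega>) y = \<sigma> ! y" if "\<omega> \<in> ?H" "y \<le> x" for \<omega> y
      using that unfolding H by (simp add: stack_event_def)
    have cH: "consistent_stacks x (final_stack (path \<omega>)) = consistent_stacks x ((!) \<sigma>)" if "\<omega> \<in> ?H" for \<omega>
      using fsH[OF that] by (intro consistent_stacks_cong)
    show ?thesis
    proof (cases "consistent_stacks x ((!) \<sigma>)")
      case c: True
      show ?thesis
      proof (cases "ups (\<sigma> ! x) - 1 = i")
        case i: True
        have "?l = stack_event (Suc x) (((!) \<sigma>)(Suc x := t))"
          unfolding Int_assoc H Q using QT fsH H True by (auto simp: stack_event_def le_Suc_eq stack_history_eq_iff[symmetric])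
        moreover have "?r = stack_event x ((!) \<sigma>)"
          using QT fsH i unfolding H[symmetric] Q by (auto simp: returns_def)
        moreover have "prob (stack_event (Suc x) (((!) \<sigma>)(Suc x := t))) = stack_weight (Suc x) (((!) \<sigma>)(Suc x := t))"
          using prob_stack_event_Suc(1)[OF c prob_stack_event[OF c]] t i by simp
        moreover have "stack_weight (Suc x) (((!) \<sigma>)(Suc x := t)) = stack_weight x ((!) \<sigma>) * (1 / 2 ^ (i + j + 1))"
        proof -
          \<comment> \<open>Each up-step but the last is paired with a return from above
            (\<open>e1\<close>), the last with the escape (\<open>e2\<close>), and each down-step
            absorbs one return factor of the old weight (\<open>e3\<close>). Every exit thus leaves
            a factor 1/2. All three identities hold from \<open>y = 2\<close> on.\<close>
          define y where "y = Suc x"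
          have y: "2 \<le> y" using x by (simp add: y_def)
          have e1: "p_seq y * ret_prob_lim (Suc y) = 1 / 2" using y by (simp add: p_seq_ret_prob_lim)
          have e2: "p_seq y * esc_prob_lim (Suc y) = esc_prob_lim y / 2" using y by (simp add: p_seq_ge2 esc_prob_lim_def field_simps)
          have e3: "1 - p_seq y = ret_prob_lim y / 2" using y by (simp add: p_seq_ge2 ret_prob_lim_def field_simps)
          have "p_seq y ^ Suc j * (1 - p_seq y) ^ i * (esc_prob_lim (Suc y) * ret_prob_lim (Suc y) ^ j)
             = (p_seq y * ret_prob_lim (Suc y)) ^ j * (p_seq y * esc_prob_lim (Suc y)) * (1 - p_seq y) ^ i"
            by (simp add: power_mult_distrib)
          also have "\<dots> = esc_prob_lim y * ret_prob_lim y ^ i * (1 / 2 ^ (i + j + 1))"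
            unfolding e1 e2 e3 by (simp add: power_divide power_add)
          finally have "p_seq y ^ Suc j * (1 - p_seq y) ^ i * (esc_prob_lim (Suc y) * ret_prob_lim (Suc y) ^ j) = esc_prob_lim y * ret_prob_lim y ^ i * (1 / 2 ^ (i + j + 1))" .
          then show ?thesis using stack_weight_extend[of t "(!) \<sigma>" x j] t i unfolding stack_weight_def[of x] y_def
            by (simp only: mult.assoc)
        qed
        ultimately show ?thesis using prob_stack_event[OF c] by (simp only:)
      next
        case i: False
        have "?r = {}" using fsH i by (auto simp: returns_def)
        moreover have "prob ?l = 0"
        proof (rule null[OF ms(1), of "Suc x"])
          fix \<omega> assume \<omega>: "\<omega> \<in> ?l"
          then have "final_stack (path \<omega>) x = \<sigma> ! x" using fsH by blast
          then show "\<not> consistent_stacks (Suc x) (final_stack (path \<omega>))"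
            using \<omega> i t unfolding consistent_stacks_Suc by (auto simp: closed_stacks_def)
        qed
        ultimately show ?thesis by (simp only: measure_empty mult_zero_left)
      qed
    next
      case False
      have "prob ?l = 0" "prob ?r = 0"
        using cH False by (auto intro!: null[OF ms(1), of x] null[OF ms(2), of x])
      then show ?thesis by simp
    qed
  qed
qed simp

text \<open>Up to a null set, the list at \<open>Suc x\<close> also reveals
  \<open>returns x\<close>: this is its number of down-steps.\<close>

lemma split_next_stack:
  assumes A[measurable]: "A \<in> sets M"
  shows "prob (A \<inter> {\<omega> \<in> space M. returns x \<omega> = i} \<inter> {\<omega> \<in> space M. returns (Suc x) \<omega> = j \<and> \<Phi> (final_stack (path \<omega>) (Suc x))})
    = (\<Sum>t\<in>{t \<in> closed_stacks i j. \<Phi> t}. prob (A \<inter> {\<omega> \<in> space M. final_stack (path \<omega>) (Suc x) = t}))"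
proof -
  have "(\<Sum>t\<in>{t \<in> closed_stacks i j. \<Phi> t}. prob (A \<inter> {\<omega> \<in> space M. final_stack (path \<omega>) (Suc x) = t}))
    = prob (\<Union>t\<in>{t \<in> closed_stacks i j. \<Phi> t}. A \<inter> {\<omega> \<in> space M. final_stack (path \<omega>) (Suc x) = t})"
    using closed_stacks_finite_card(1)[of i j]
    by (intro finite_measure_finite_Union[symmetric]) (auto simp: disjoint_family_on_def)
  also have "\<dots> = prob (A \<inter> {\<omega> \<in> space M. returns x \<omega> = i} \<inter> {\<omega> \<in> space M. returns (Suc x) \<omega> = j \<and> \<Phi> (final_stack (path \<omega>) (Suc x))})"
  proof (rule finite_measure_eq_AE)
    show "AE \<omega> in M. (\<omega> \<in> (\<Union>t\<in>{t \<in> closed_stacks i j. \<Phi> t}. A \<inter> {\<omega> \<in> space M. final_stack (path \<omega>) (Suc x) = t}))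
      = (\<omega> \<in> A \<inter> {\<omega> \<in> space M. returns x \<omega> = i} \<inter> {\<omega> \<in> space M. returns (Suc x) \<omega> = j \<and> \<Phi> (final_stack (path \<omega>) (Suc x))})"
      using AE_consistent_stacks[of "Suc x"]
    proof eventually_elim
      case (elim \<omega>)
      have "0 < ups (final_stack (path \<omega>) (Suc x))" using elim ends_up_ups by (auto simp: consistent_stacks_Suc)
      then have "final_stack (path \<omega>) (Suc x) \<in> closed_stacks i j \<longleftrightarrow> returns x \<omega> = i \<and> returns (Suc x) \<omega> = j"
        using elim by (auto simp: consistent_stacks_Suc closed_stacks_def returns_def)
      then show ?case by blast
    qed
    show "(\<Union>t\<in>{t \<in> closed_stacks i j. \<Phi> t}. A \<inter> {\<omega> \<in> space M. final_stack (path \<omega>) (Suc x) = t}) \<in> sets M"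
      using closed_stacks_finite_card(1)[of i j] by (intro sets.finite_UN) auto
  qed measurable
  finally show ?thesis by simp
qed

lemma prob_step:
  assumes A: "A \<in> history_events x" and x: "1 \<le> x"
  shows "prob (A \<inter> {\<omega> \<in> space M. returns x \<omega> = i} \<inter> {\<omega> \<in> space M. returns (Suc x) \<omega> = j \<and> \<Phi> (final_stack (path \<omega>) (Suc x))})
    = prob (A \<inter> {\<omega> \<in> space M. returns x \<omega> = i}) * (real (card {t \<in> closed_stacks i j. \<Phi> t}) / 2 ^ (i + j + 1))"
proof -
  have "(\<Sum>t\<in>{t \<in> closed_stacks i j. \<Phi> t}. prob (A \<inter> {\<omega> \<in> space M. final_stack (path \<omega>) (Suc x) = t}))
    = (\<Sum>t\<in>{t \<in> closed_stacks i j. \<Phi> t}. prob (A \<inter> {\<omega> \<in> space M. returns x \<omega> = i}) * (1 / 2 ^ (i + j + 1)))"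
    using prob_next_stack[OF A x] by (intro sum.cong) auto
  then show ?thesis unfolding split_next_stack[OF history_events_sets[OF A]] by simp
qed

lemma prob_step_returns:
  assumes A: "A \<in> history_events x" and x: "1 \<le> x"
  shows "prob (A \<inter> {\<omega> \<in> space M. returns x \<omega> = i} \<inter> {\<omega> \<in> space M. returns (Suc x) \<omega> = j})
    = prob (A \<inter> {\<omega> \<in> space M. returns x \<omega> = i}) * step_prob i j"
  using prob_step[OF A x, of i j "\<lambda>_. True"] by (simp add: step_prob_def closed_stacks_finite_card(2))

lemma prob_step_sorted:
  assumes A: "A \<in> history_events x" and x: "1 \<le> x"
  shows "prob (A \<inter> {\<omega> \<in> space M. returns x \<omega> = i} \<inter> {\<omega> \<in> space M. returns (Suc x) \<omega> = j \<and> sorted (final_stack (path \<omega>) (Suc x))})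
    = prob (A \<inter> {\<omega> \<in> space M. returns x \<omega> = i}) * (1 / 2 ^ (i + j + 1))"
  using prob_step[OF A x, of i j sorted] by (simp add: closed_stacks_sorted)

text \<open>The walk goes back from 2 to 1 with probability \<open>ret_prob_lim 2 = 1 / 2\<close>
  after each arrival from 1, so \<open>returns 1\<close> is geometric. From site 1 on,
  \<open>V\<close> therefore behaves as if it had been started with \<open>V 0 = 0\<close>, although
  \<open>returns 0\<close> is random.\<close>

lemma prob_returns_1: "prob {\<omega> \<in> space M. returns 1 \<omega> = j} = step_prob 0 j"
proof -
  have Pt: "prob {\<omega> \<in> space M. final_stack (path \<omega>) 1 = t} = (1/4) ^ d * (3/8) ^ Suc j" if t: "t \<in> closed_stacks d j" for d t
  proof -
    \<comment> \<open>Only up-steps are possible at 0, so the \<open>d\<close> down-steps in the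
      list at 1 force the list at 0.\<close>
    define s :: "nat \<Rightarrow> bool list" where "s = (\<lambda>_. replicate (Suc d) True)"
    have rep: "downs (replicate d True) = 0" "ups (replicate d True) = d" for d by (induction d) auto
    have s0: "consistent_stacks 0 s" by (simp add: consistent_stacks_def s_def ends_up_def rep)
    have d: "ups (s 0) - 1 = d" by (simp add: s_def rep)
    have "prob {\<omega> \<in> space M. final_stack (path \<omega>) 1 = t} = prob (stack_event (Suc 0) (s(Suc 0 := t)))"
    proof (rule finite_measure_eq_AE)
      show "AE \<omega> in M. (\<omega> \<in> {\<omega> \<in> space M. final_stack (path \<omega>) 1 = t}) = (\<omega> \<in> stack_event (Suc 0) (s(Suc 0 := t)))"
        using AE_consistent_stacks[of "Suc 0"] AE_space
      proof eventually_elim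
        case (elim \<omega>)
        have rep': "u = replicate (ups u) True" if "downs u = 0" for u
          using that by (induction u) auto
        have "final_stack (path \<omega>) 0 = s 0" if "final_stack (path \<omega>) (Suc 0) = t"
          using rep'[of "final_stack (path \<omega>) 0"] elim that t by (simp add: consistent_stacks_def closed_stacks_def s_def)
        then show ?case using elim by (auto simp: stack_event_def le_Suc_eq)
      qed
    qed measurable
    also have "\<dots> = stack_weight (Suc 0) (s(Suc 0 := t))"
      using consistent_stacks_extend[OF s0, of t j] t d by (intro prob_stack_event) simp
    also have "\<dots> = (3/4) ^ Suc j * (1/4) ^ d * (1/2 * (1/2) ^ j)"
    proof -
      have "p_seq 0 = 1" by (simp add: p_seq_def)
      then show ?thesis
        using stack_weight_extend[of t s 0 j] t d by (simp add: p_seq_1 esc_prob_lim_def ret_prob_lim_def exit_weight_def s_def rep)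
    qed
    also have "\<dots> = (1/4) ^ d * ((3/4) ^ Suc j * (1/2) ^ Suc j)" by simp
    also have "((3/4) ^ Suc j * (1/2) ^ Suc j :: real) = (3/8) ^ Suc j"
      unfolding power_mult_distrib[symmetric] by simp
    finally show ?thesis .
  qed
  have P: "prob ({\<omega> \<in> space M. returns 1 \<omega> = j} \<inter> {\<omega> \<in> space M. returns 0 \<omega> = d}) = real ((d + j) choose d) * ((1/4) ^ d * (3/8) ^ Suc j)" for d
  proof -
    have "(\<Sum>t\<in>closed_stacks d j. prob {\<omega> \<in> space M. final_stack (path \<omega>) 1 = t}) = (\<Sum>t\<in>closed_stacks d j. (1/4) ^ d * (3/8) ^ Suc j)"
      by (intro sum.cong refl Pt)
    then have "(\<Sum>t\<in>closed_stacks d j. prob {\<omega> \<in> space M. final_stack (path \<omega>) 1 = t}) = real ((d + j) choose d) * ((1/4) ^ d * (3/8) ^ Suc j)"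
      unfolding sum_constant closed_stacks_finite_card(2) .
    then show ?thesis using split_next_stack[of "space M" 0 d j "\<lambda>_. True"]
      by (simp add: Int_commute Int_absorb1)
  qed
  have "(\<lambda>d. prob ({\<omega> \<in> space M. returns 1 \<omega> = j} \<inter> {\<omega> \<in> space M. returns 0 \<omega> = d})) sums prob {\<omega> \<in> space M. returns 1 \<omega> = j}"
    by (rule prob_sums_nat) measurable
  moreover have "(\<lambda>d. (3/8) ^ Suc j * (real ((j + d) choose j) * (1/4) ^ d)) sums ((3/8) ^ Suc j * (1 / (1 - 1/4) ^ (j + 1)))"
    by (intro sums_mult neg_binomial_sums) auto
  moreover have "(3/8) ^ Suc j * (real ((j + d) choose j) * (1/4) ^ d) = prob ({\<omega> \<in> space M. returns 1 \<omega> = j} \<inter> {\<omega> \<in> space M. returns 0 \<omega> = d})" for d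
    unfolding P using binomial_symmetric[of d "d + j"] by (simp add: add.commute)
  ultimately have "prob {\<omega> \<in> space M. returns 1 \<omega> = j} = (3/8) ^ Suc j * (1 / (1 - 1/4) ^ (j + 1))"
    by (simp only: sums_unique2)
  also have "\<dots> = ((3/8) / (3/4)) ^ Suc j"
    unfolding power_divide[of "3/8 :: real" "3/4"] by (simp only: Suc_eq_plus1 times_divide_eq_right mult_1_right) simp
  also have "\<dots> = step_prob 0 j" by (simp add: step_prob_0_left power_divide)
  finally show ?thesis .
qed

text \<open>The offset \<open>r\<close> permits a start from a law instead of a state:
  \<open>r = 0\<close> is used at a known state \<open>v\<close>, and \<open>r = 1\<close> with
  \<open>v = 0\<close> after a weak cutpoint or at site 1.\<close>

lemma returns_propagate:
  assumes A: "A \<in> history_events x" and x: "1 \<le> x"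
    and init: "\<And>j. prob (A \<inter> {\<omega> \<in> space M. returns x \<omega> = j}) = c * step_prob_pow r v j"
  shows "prob (A \<inter> {\<omega> \<in> space M. returns (x + m) \<omega> = i}) = c * step_prob_pow (r + m) v i"
proof (induction m arbitrary: i)
  case 0
  show ?case using init by simp
next
  case (Suc m)
  note history_events_sets[OF A, measurable]
  have "(\<lambda>k. prob (A \<inter> {\<omega> \<in> space M. returns (Suc (x + m)) \<omega> = i} \<inter> {\<omega> \<in> space M. returns (x + m) \<omega> = k}))
     sums prob (A \<inter> {\<omega> \<in> space M. returns (Suc (x + m)) \<omega> = i})"
    by (rule prob_sums_nat) measurable
  moreover have "prob (A \<inter> {\<omega> \<in> space M. returns (Suc (x + m)) \<omega> = i} \<inter> {\<omega> \<in> space M. returns (x + m) \<omega> = k}) = c * (step_prob_pow (r + m) v k * step_prob k i)" for k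
    using prob_step_returns[OF history_events_mono[OF A, of "x + m"], of k i] x Suc[of k] by (simp add: Int_ac)
  ultimately have "(\<lambda>k. c * (step_prob_pow (r + m) v k * step_prob k i)) sums prob (A \<inter> {\<omega> \<in> space M. returns (Suc (x + m)) \<omega> = i})"
    by simp
  moreover have "(\<lambda>k. c * (step_prob_pow (r + m) v k * step_prob k i)) sums (c * step_prob_pow (Suc (r + m)) v i)"
    by (intro sums_mult step_prob_pow_Suc_sums)
  ultimately show ?case by (simp only: sums_unique2 add_Suc_right)
qed

lemma space_in_history_events: "space M \<in> history_events x"
  unfolding history_events_def by (intro CollectI exI[of _ "\<lambda>_. True"]) simp

lemma prob_returns: "1 \<le> x \<Longrightarrow> prob {\<omega> \<in> space M. returns x \<omega> = v} = step_prob_pow x 0 v"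
proof -
  assume "1 \<le> x"
  have "prob (space M \<inter> {\<omega> \<in> space M. returns 1 \<omega> = j}) = 1 * step_prob_pow 1 0 j" for j
    unfolding step_prob_pow_1 using prob_returns_1[of j] by (simp add: Int_absorb1)
  from returns_propagate[OF space_in_history_events order.refl this, of "x - 1" v] \<open>1 \<le> x\<close>
  show ?thesis by (simp add: Int_absorb1)
qed

lemma returns_in_history_events: "{\<omega> \<in> space M. returns x \<omega> = v} \<in> history_events x"
  using history_events_final_stack[of "\<lambda>f. ups (f x) - 1 = v" x] by (simp add: returns_def)

lemma renewal_returns:
  assumes A: "A \<in> history_events x" and x: "1 \<le> x"
  shows "prob (A \<inter> {\<omega> \<in> space M. returns x \<omega> = v} \<inter> {\<omega> \<in> space M. returns (x + m) \<omega> = i})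
    = prob (A \<inter> {\<omega> \<in> space M. returns x \<omega> = v}) * step_prob_pow m v i"
proof -
  have "prob (A \<inter> {\<omega> \<in> space M. returns x \<omega> = v} \<inter> {\<omega> \<in> space M. returns x \<omega> = j}) = prob (A \<inter> {\<omega> \<in> space M. returns x \<omega> = v}) * step_prob_pow 0 v j" for j
  proof (cases "v = j")
    case True
    then show ?thesis by (simp add: Int_assoc)
  next
    case False
    then have "A \<inter> {\<omega> \<in> space M. returns x \<omega> = v} \<inter> {\<omega> \<in> space M. returns x \<omega> = j} = {}" by auto
    then show ?thesis using False by (simp only: measure_empty) simp
  qed
  from returns_propagate[OF history_events_Int[OF A returns_in_history_events] x this, of m i] show ?thesis by simp
qed

text \<open>The single sorted list for the transition from \<open>i\<close> to \<open>j\<close> has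
  probability \<open>2 ^ -(i + j + 1)\<close>, which is \<open>step_prob i 0\<close> times
  \<open>2 ^ -j\<close>. The dependence on the past and on \<open>j\<close> separates: given that
  the list is sorted, \<open>returns (Suc x)\<close> is independent of the past and geometric.
  Summing \<open>2 ^ -j\<close> over \<open>j\<close> gives the factor 2.\<close>

lemma prob_sorted:
  assumes A: "A \<in> history_events x" and x: "1 \<le> x"
  shows "prob (A \<inter> {\<omega> \<in> space M. sorted (final_stack (path \<omega>) (Suc x))} \<inter> {\<omega> \<in> space M. returns (Suc x) \<omega> = j})
      = prob (A \<inter> {\<omega> \<in> space M. sorted (final_stack (path \<omega>) (Suc x))}) * step_prob 0 j"
    and "prob (A \<inter> {\<omega> \<in> space M. sorted (final_stack (path \<omega>) (Suc x))}) = 2 * prob (A \<inter> {\<omega> \<in> space M. returns (Suc x) \<omega> = 0})"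
proof -
  note history_events_sets[OF A, measurable]
  define a where "a = prob (A \<inter> {\<omega> \<in> space M. returns (Suc x) \<omega> = 0})"
  let ?S = "{\<omega> \<in> space M. sorted (final_stack (path \<omega>) (Suc x))}"
  have 1: "(\<lambda>i. prob (A \<inter> {\<omega> \<in> space M. returns (Suc x) \<omega> = 0} \<inter> {\<omega> \<in> space M. returns x \<omega> = i})) sums a"
    unfolding a_def by (rule prob_sums_nat) measurable
  have 2: "prob (A \<inter> {\<omega> \<in> space M. returns (Suc x) \<omega> = 0} \<inter> {\<omega> \<in> space M. returns x \<omega> = i}) = prob (A \<inter> {\<omega> \<in> space M. returns x \<omega> = i}) * step_prob i 0" for i
    using prob_step_returns[OF A x, of i 0] by (simp add: Int_ac)
  have 3: "prob (A \<inter> ?S \<inter> {\<omega> \<in> space M. returns (Suc x) \<omega> = j}) = a * (1 / 2 ^ j)" for j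
  proof -
    have "(\<lambda>i. prob (A \<inter> ?S \<inter> {\<omega> \<in> space M. returns (Suc x) \<omega> = j} \<inter> {\<omega> \<in> space M. returns x \<omega> = i}))
       sums prob (A \<inter> ?S \<inter> {\<omega> \<in> space M. returns (Suc x) \<omega> = j})"
      by (rule prob_sums_nat) measurable
    moreover have "prob (A \<inter> ?S \<inter> {\<omega> \<in> space M. returns (Suc x) \<omega> = j} \<inter> {\<omega> \<in> space M. returns x \<omega> = i})
       = prob (A \<inter> {\<omega> \<in> space M. returns (Suc x) \<omega> = 0} \<inter> {\<omega> \<in> space M. returns x \<omega> = i}) * (1 / 2 ^ j)" for i
    proof -
      have "A \<inter> ?S \<inter> {\<omega> \<in> space M. returns (Suc x) \<omega> = j} \<inter> {\<omega> \<in> space M. returns x \<omega> = i}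
         = A \<inter> {\<omega> \<in> space M. returns x \<omega> = i} \<inter> {\<omega> \<in> space M. returns (Suc x) \<omega> = j \<and> sorted (final_stack (path \<omega>) (Suc x))}" by auto
      then show ?thesis using prob_step_sorted[OF A x, of i j] unfolding 2 by (simp add: step_prob_0_right power_add)
    qed
    ultimately show ?thesis using sums_mult2[OF 1, of "1 / 2 ^ j"] by (simp only: sums_unique2)
  qed
  have "(\<lambda>j. prob (A \<inter> ?S \<inter> {\<omega> \<in> space M. returns (Suc x) \<omega> = j})) sums prob (A \<inter> ?S)"
    by (rule prob_sums_nat) measurable
  moreover have "(\<lambda>j. 2 * a * step_prob 0 j) sums (2 * a * 1)" by (intro sums_mult step_prob_sums)
  moreover have "2 * a * step_prob 0 j = a * (1 / 2 ^ j)" for j by (simp add: step_prob_0_left)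
  ultimately have 4: "prob (A \<inter> ?S) = 2 * a" unfolding 3 by (simp add: sums_iff)
  then show "prob (A \<inter> ?S) = 2 * prob (A \<inter> {\<omega> \<in> space M. returns (Suc x) \<omega> = 0})" unfolding a_def .
  show "prob (A \<inter> ?S \<inter> {\<omega> \<in> space M. returns (Suc x) \<omega> = j}) = prob (A \<inter> ?S) * step_prob 0 j"
    unfolding 3 4 by (simp add: step_prob_0_left)
qed

lemma sorted_in_history_events: "{\<omega> \<in> space M. sorted (final_stack (path \<omega>) x)} \<in> history_events x"
  using history_events_final_stack[of "\<lambda>f. sorted (f x)" x] by simp

text \<open>A sorted list at \<open>x\<close> leaves the law \<open>step_prob 0\<close>, as if
  \<open>V\<close> had been 0 one site earlier. Hence \<open>Suc (y - x)\<close> steps lead to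
  \<open>y\<close>, and the factor 2 is that of \<open>prob_sorted\<close> at
  \<open>y\<close>.\<close>

lemma renewal_sorted:
  assumes A: "A \<in> history_events (x - 1)" and x: "2 \<le> x" "x < y"
  shows "prob (A \<inter> {\<omega> \<in> space M. sorted (final_stack (path \<omega>) x)} \<inter> {\<omega> \<in> space M. sorted (final_stack (path \<omega>) y)})
    = prob (A \<inter> {\<omega> \<in> space M. sorted (final_stack (path \<omega>) x)}) * (2 * step_prob_pow (Suc (y - x)) 0 0)"
proof -
  define B where "B = A \<inter> {\<omega> \<in> space M. sorted (final_stack (path \<omega>) x)}"
  have B: "B \<in> history_events x" unfolding B_def using history_events_mono[OF A] by (intro history_events_Int sorted_in_history_events) auto
  obtain x' where x': "x = Suc x'" "1 \<le> x'" using x by (cases x) auto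
  obtain y' where y': "y = Suc y'" "1 \<le> y'" "x \<le> y'" using x by (cases y) auto
  have "prob (B \<inter> {\<omega> \<in> space M. sorted (final_stack (path \<omega>) y)}) = 2 * prob (B \<inter> {\<omega> \<in> space M. returns y \<omega> = 0})"
    unfolding y'(1) using prob_sorted(2)[OF history_events_mono[OF B y'(3)] y'(2)] .
  moreover have "prob (B \<inter> {\<omega> \<in> space M. returns (x + (y - x)) \<omega> = 0}) = prob B * step_prob_pow (1 + (y - x)) 0 0"
  proof (rule returns_propagate[OF B])
    show "prob (B \<inter> {\<omega> \<in> space M. returns x \<omega> = j}) = prob B * step_prob_pow 1 0 j" for j
      unfolding B_def step_prob_pow_1 using prob_sorted(1)[of A x' j] A x' by simp
  qed (use x in simp)
  ultimately show ?thesis using x unfolding B_def by simp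
qed

section \<open>The three renewal sets\<close>

lemma C_sets:
  "{\<omega> \<in> space M. x \<in> Cab (path \<omega>) a b} \<in> sets M"
  "{\<omega> \<in> space M. x \<in> Cstar (path \<omega>) a} \<in> sets M"
  "{\<omega> \<in> space M. x \<in> Cw (path \<omega>)} \<in> sets M"
proof -
  have v: "finite (visits w x) \<and> card (visits w x) = a \<longleftrightarrow> (\<exists>k0. \<forall>k\<ge>k0. length (exit_stack w k x) = a)" for w a
    unfolding finite_card_iff_eventually exit_stack_length visits_def by simp
  have u: "finite (upvisits w x) \<and> card (upvisits w x) = b \<longleftrightarrow> (\<exists>k0. \<forall>k\<ge>k0. ups (exit_stack w k x) = b)" for w b
    unfolding finite_card_iff_eventually exit_stack_ups upvisits_def by simp
  have "{\<omega> \<in> space M. x \<in> Cab (path \<omega>) a b} = {\<omega> \<in> space M. (\<exists>k0. \<forall>k\<ge>k0. length (exit_stack (path \<omega>) k x) = a) \<and> (\<exists>k0. \<forall>k\<ge>k0. ups (exit_stack (path \<omega>) k x) = b)}"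
    unfolding v[symmetric] u[symmetric] by (auto simp: Cab_def)
  also have "\<dots> \<in> sets M" by measurable
  finally show "{\<omega> \<in> space M. x \<in> Cab (path \<omega>) a b} \<in> sets M" .
  have "{\<omega> \<in> space M. x \<in> Cstar (path \<omega>) a} = {\<omega> \<in> space M. \<exists>k0. \<forall>k\<ge>k0. ups (exit_stack (path \<omega>) k x) = a}"
    unfolding u[symmetric] by (auto simp: Cstar_def)
  also have "\<dots> \<in> sets M" by measurable
  finally show "{\<omega> \<in> space M. x \<in> Cstar (path \<omega>) a} \<in> sets M" .
  show "{\<omega> \<in> space M. x \<in> Cw (path \<omega>)} \<in> sets M"
    unfolding Cw_def mem_Collect_eq by measurable
qed

text \<open>The chain axioms prescribe only the masses of up- and down-steps. Within each cylinder
  these add up to the whole, so every other step is null; at 0 the up-step has all the mass.\<close>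

lemma AE_nn_path: "AE \<omega> in M. \<forall>k. nn_path (path \<omega>) k"
proof -
  have "AE \<omega> in M. X 0 \<omega> = 0"
    using chain by (subst prob_Collect_eq_1[symmetric]) (auto simp: bd_chain_def)
  moreover have "AE \<omega> in M. X (Suc k) \<omega> = Suc (X k \<omega>) \<or> (0 < X k \<omega> \<and> X (Suc k) \<omega> = X k \<omega> - 1)" for k
  proof -
    have "AE \<omega> in M. \<forall>\<sigma>::nat list. \<not> ((\<forall>i\<le>k. X i \<omega> = \<sigma> ! i) \<and>
        \<not> (X (Suc k) \<omega> = Suc (\<sigma> ! k) \<or> (0 < \<sigma> ! k \<and> X (Suc k) \<omega> = \<sigma> ! k - 1)))"
      unfolding AE_all_countable
    proof
      fix \<sigma> :: "nat list"
      define D where "D = {\<omega> \<in> space M. \<forall>i\<le>k. X i \<omega> = \<sigma> ! i}"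
      define A where "A = {\<omega> \<in> space M. (\<forall>i\<le>k. X i \<omega> = \<sigma> ! i) \<and> X (Suc k) \<omega> = \<sigma> ! k + 1}"
      define B where "B = {\<omega> \<in> space M. (\<forall>i\<le>k. X i \<omega> = \<sigma> ! i) \<and> 0 < \<sigma> ! k \<and> X (Suc k) \<omega> = \<sigma> ! k - 1}"
      have sets: "A \<in> sets M" "B \<in> sets M" "D \<in> sets M" unfolding A_def B_def D_def by measurable
      have "prob A = p_seq (\<sigma> ! k) * prob D"
        using chain unfolding bd_chain_def A_def D_def by blast
      moreover have "prob B = (1 - p_seq (\<sigma> ! k)) * prob D"
      proof (cases "0 < \<sigma> ! k")
        case True
        have B: "B = {\<omega> \<in> space M. (\<forall>i\<le>k. X i \<omega> = \<sigma> ! i) \<and> X (Suc k) \<omega> = \<sigma> ! k - 1}"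
          using True by (simp add: B_def)
        have "\<forall>h. 0 < h k \<longrightarrow> prob {\<omega> \<in> space M. (\<forall>i\<le>k. X i \<omega> = h i) \<and> X (Suc k) \<omega> = h k - 1}
            = (1 - p_seq (h k)) * prob {\<omega> \<in> space M. \<forall>i\<le>k. X i \<omega> = h i}"
          using chain unfolding bd_chain_def by blast
        from this[rule_format, of "(!) \<sigma>", OF True] show ?thesis unfolding B D_def .
      next
        case False
        then have "B = {}" "p_seq (\<sigma> ! k) = 1" by (auto simp: B_def p_seq_def)
        then show ?thesis by simp
      qed
      ultimately have "prob A + prob B = prob D" by (simp add: algebra_simps)
      moreover have "prob (A \<union> B) = prob A + prob B"
        using sets by (intro finite_measure_Union) (auto simp: A_def B_def)
      moreover have "A \<union> B \<subseteq> D" by (auto simp: A_def B_def D_def)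
      ultimately have "prob (D - (A \<union> B)) = 0"
        using sets by (subst finite_measure_Diff) auto
      then have "D - (A \<union> B) \<in> null_sets M"
        using sets by (intro null_setsI) (auto simp: emeasure_eq_measure)
      from AE_not_in[OF this] AE_space
      show "AE \<omega> in M. \<not> ((\<forall>i\<le>k. X i \<omega> = \<sigma> ! i) \<and>
        \<not> (X (Suc k) \<omega> = Suc (\<sigma> ! k) \<or> (0 < \<sigma> ! k \<and> X (Suc k) \<omega> = \<sigma> ! k - 1)))"
        by eventually_elim (auto simp: A_def B_def D_def)
    qed
    then show ?thesis
    proof eventually_elim
      case (elim \<omega>)
      have "map (path \<omega>) [0..<Suc k] ! i = X i \<omega>" if "i \<le> k" for i
        using that by (subst nth_map) (auto simp del: upt_Suc)
      then show ?case using elim[rule_format, of "map (path \<omega>) [0..<Suc k]"] by auto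
    qed
  qed
  then have "AE \<omega> in M. \<forall>k. X (Suc k) \<omega> = Suc (X k \<omega>) \<or> (0 < X k \<omega> \<and> X (Suc k) \<omega> = X k \<omega> - 1)"
    by (simp add: AE_all_countable)
  ultimately show ?thesis by eventually_elim (auto simp: nn_path_def)
qed

lemma AE_all_consistent: "AE \<omega> in M. \<forall>n. consistent_stacks n (final_stack (path \<omega>))"
  using AE_consistent_stacks by (simp add: AE_all_countable)

lemma count_in_history_events:
  assumes "\<And>z. z < x \<Longrightarrow> E z \<in> history_events z" "2 \<le> x"
  shows "{\<omega> \<in> space M. card {z \<in> {2..<x}. \<omega> \<in> E z} = r} \<in> history_events (x - 1)"
proof -
  have "\<exists>Q. E z = {\<omega> \<in> space M. Q (stack_history (x - 1) \<omega>)}" if "z < x" for z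
    using history_events_mono[OF assms(1)[OF that], of "x - 1"] that by (auto simp: history_events_def)
  then obtain Q where Q: "\<And>z. z < x \<Longrightarrow> E z = {\<omega> \<in> space M. Q z (stack_history (x - 1) \<omega>)}" by metis
  have "{\<omega> \<in> space M. card {z \<in> {2..<x}. \<omega> \<in> E z} = r}
      = {\<omega> \<in> space M. card {z \<in> {2..<x}. Q z (stack_history (x - 1) \<omega>)} = r}"
  proof (intro Collect_cong conj_cong refl)
    fix \<omega> assume "\<omega> \<in> space M"
    then have "{z \<in> {2..<x}. \<omega> \<in> E z} = {z \<in> {2..<x}. Q z (stack_history (x - 1) \<omega>)}" using Q by auto
    then show "(card {z \<in> {2..<x}. \<omega> \<in> E z} = r) = (card {z \<in> {2..<x}. Q z (stack_history (x - 1) \<omega>)} = r)" by simp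
  qed
  then show ?thesis unfolding history_events_def by (intro CollectI exI[of _ "\<lambda>\<tau>. card {z \<in> {2..<x}. Q z \<tau>} = r"])
qed

lemma Cstar_limit:
  assumes a: "1 \<le> a"
  shows "weak_conv_m (\<lambda>n. distr M borel (\<lambda>\<omega>. real (card (Cstar (path \<omega>) a \<inter> {1..n})) / (1 * ln (real n)))) Exp1"
proof (rule renewal_set_exponential_limit[where E = "\<lambda>x. {\<omega> \<in> space M. returns x \<omega> = a - 1}" and u = "\<lambda>m. step_prob_pow m (a - 1) (a - 1)"])
  show "AE \<omega> in M. \<forall>x\<ge>2. (x \<in> Cstar (path \<omega>) a) = (\<omega> \<in> {\<omega> \<in> space M. returns x \<omega> = a - 1})"
    using AE_all_consistent AE_space
  proof eventually_elim
    case (elim \<omega>)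
    show ?case
    proof (intro allI impI)
      fix x
      have e: "ends_up (final_stack (path \<omega>) x)" using elim by (auto simp: consistent_stacks_def)
      then have "final_stack (path \<omega>) x \<noteq> []" by (simp add: ends_up_def)
      then show "(x \<in> Cstar (path \<omega>) a) = (\<omega> \<in> {\<omega> \<in> space M. returns x \<omega> = a - 1})"
        using Cab_iff_final_stack(2)[of "path \<omega>" x a] ends_up_ups[OF e] elim a by (auto simp: returns_def)
    qed
  qed
  show "prob ({\<omega> \<in> space M. card {z \<in> {2..<x}. \<omega> \<in> {\<omega> \<in> space M. returns z \<omega> = a - 1}} = r} \<inter> {\<omega> \<in> space M. returns x \<omega> = a - 1} \<inter> {\<omega> \<in> space M. returns y \<omega> = a - 1})
     = prob ({\<omega> \<in> space M. card {z \<in> {2..<x}. \<omega> \<in> {\<omega> \<in> space M. returns z \<omega> = a - 1}} = r} \<inter> {\<omega> \<in> space M. returns x \<omega> = a - 1}) * step_prob_pow (y - x) (a - 1) (a - 1)"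
    if "2 \<le> x" "x < y" for x y r
  proof -
    have "{\<omega> \<in> space M. card {z \<in> {2..<x}. \<omega> \<in> {\<omega> \<in> space M. returns z \<omega> = a - 1}} = r} \<in> history_events x"
      using that by (intro history_events_mono[OF count_in_history_events, of x] returns_in_history_events) auto
    from renewal_returns[OF this, of "a - 1" "y - x" "a - 1"] that show ?thesis by simp
  qed
  show "(\<lambda>n. (\<Sum>m = 1..n. step_prob_pow m (a - 1) (a - 1)) / ln (real n)) \<longlonglongrightarrow> 1"
    by (intro LIMSEQ_sum_over_ln LIMSEQ_step_prob_pow)
  have "(\<Sum>x = 2..n. prob {\<omega> \<in> space M. returns x \<omega> = a - 1}) = (\<Sum>x = 2..n. step_prob_pow x 0 (a - 1))" for n
    by (intro sum.cong refl prob_returns) auto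
  then show "(\<lambda>n. (\<Sum>x = 2..n. prob {\<omega> \<in> space M. returns x \<omega> = a - 1}) / ln (real n)) \<longlonglongrightarrow> 1"
    using LIMSEQ_sum_over_ln(2)[OF LIMSEQ_step_prob_pow[of 0 "a - 1"]] by simp
qed (auto intro: C_sets step_prob_pow_nonneg)

text \<open>An index shift for \<open>Cab_limit\<close>, where the last of the \<open>m\<close>
  steps is a prescribed transition of probability \<open>c\<close>.\<close>

lemma LIMSEQ_step_prob_pow_pred: "(\<lambda>m. real (Suc m) * (step_prob_pow (m - 1) i j * c)) \<longlonglongrightarrow> c"
proof -
  have "(\<lambda>m. real (Suc m) * step_prob_pow m i j * c + inverse (real (Suc m)) * (real (Suc m) * step_prob_pow m i j) * c) \<longlonglongrightarrow> 1 * c + 0 * 1 * c"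
    by (intro tendsto_intros LIMSEQ_step_prob_pow LIMSEQ_inverse_real_of_nat)
  moreover have "real (Suc m) * step_prob_pow m i j * c + inverse (real (Suc m)) * (real (Suc m) * step_prob_pow m i j) * c
      = real (Suc (Suc m)) * (step_prob_pow (Suc m - 1) i j * c)" for m
  proof -
    have "inverse (real (Suc m)) * (real (Suc m) * step_prob_pow m i j) = step_prob_pow m i j" by (simp del: of_nat_Suc)
    then show ?thesis by (simp add: algebra_simps)
  qed
  ultimately have "(\<lambda>m. real (Suc (Suc m)) * (step_prob_pow (Suc m - 1) i j * c)) \<longlonglongrightarrow> c" by simp
  then show ?thesis by (rule LIMSEQ_imp_Suc)
qed

text \<open>\<open>E x\<close> is the transition from \<open>d\<close> to \<open>v\<close> on
  arrival at \<open>x\<close>. After it, \<open>V\<close> must lead from \<open>v\<close> back to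
  \<open>d\<close> at \<open>y - 1\<close>, in \<open>y - x - 1\<close> steps, and then repeat the
  transition; the case \<open>y = x + 1\<close> is the power 0.\<close>

lemma Cab_limit:
  assumes ab: "b \<le> a" "1 \<le> b"
  shows "weak_conv_m (\<lambda>n. distr M borel (\<lambda>\<omega>. real (card (Cab (path \<omega>) a b \<inter> {1..n})) / (step_prob (a - b) (b - 1) * ln (real n)))) Exp1"
proof -
  define d where "d = a - b"
  define v where "v = b - 1"
  define E where "E x = {\<omega> \<in> space M. returns (x - 1) \<omega> = d} \<inter> {\<omega> \<in> space M. returns x \<omega> = v}" for x
  have EF: "E x \<in> history_events x" for x
    unfolding E_def by (intro history_events_Int returns_in_history_events history_events_mono[OF returns_in_history_events]) simp
  have next_E: "prob (A \<inter> E y) = prob (A \<inter> {\<omega> \<in> space M. returns (y - 1) \<omega> = d}) * step_prob d v" if "A \<in> history_events (y - 1)" "2 \<le> y" for A y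
    using prob_step_returns[OF that(1), of d v] that(2) by (simp add: E_def Int_assoc)
  have "weak_conv_m (\<lambda>n. distr M borel (\<lambda>\<omega>. real (card (Cab (path \<omega>) a b \<inter> {1..n})) / (step_prob d v * ln (real n)))) Exp1"
  proof (rule renewal_set_exponential_limit[where E = E and u = "\<lambda>m. step_prob_pow (m - 1) v d * step_prob d v"])
    show "AE \<omega> in M. \<forall>x\<ge>2. (x \<in> Cab (path \<omega>) a b) = (\<omega> \<in> E x)"
      using AE_all_consistent AE_space
    proof eventually_elim
      case (elim \<omega>)
      show ?case
      proof (intro allI impI)
        fix x :: nat assume "2 \<le> x"
        then obtain x' where x': "x = Suc x'" by (cases x) auto
        have e: "ends_up (final_stack (path \<omega>) x)" using elim by (auto simp: consistent_stacks_def)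
        then have ne: "final_stack (path \<omega>) x \<noteq> []" by (simp add: ends_up_def)
        have "ups (final_stack (path \<omega>) x') = downs (final_stack (path \<omega>) x) + 1"
          using elim(1)[rule_format, of x] unfolding x' consistent_stacks_Suc by simp
        then have "returns (x - 1) \<omega> = downs (final_stack (path \<omega>) x)" unfolding x' by (simp add: returns_def)
        moreover have "ups (final_stack (path \<omega>) x) = returns x \<omega> + 1" using ends_up_ups[OF e] by (simp add: returns_def)
        ultimately show "(x \<in> Cab (path \<omega>) a b) = (\<omega> \<in> E x)"
          unfolding Cab_iff_final_stack(1)[OF ne] E_def ups_plus_downs[of "final_stack (path \<omega>) x", symmetric]
          using ab elim by (auto simp: d_def v_def)
      qed
    qed
    show "E x \<in> sets M" for x by (rule history_events_sets[OF EF])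
    show "0 < step_prob d v" by (simp add: step_prob_def)
    show "prob ({\<omega> \<in> space M. card {z \<in> {2..<x}. \<omega> \<in> E z} = r} \<inter> E x \<inter> E y)
        = prob ({\<omega> \<in> space M. card {z \<in> {2..<x}. \<omega> \<in> E z} = r} \<inter> E x) * (step_prob_pow (y - x - 1) v d * step_prob d v)"
      if xy: "2 \<le> x" "x < y" for x y r
    proof -
      define A where "A = {\<omega> \<in> space M. card {z \<in> {2..<x}. \<omega> \<in> E z} = r}"
      have A: "A \<in> history_events x" unfolding A_def using xy by (intro history_events_mono[OF count_in_history_events[OF EF]]) auto
      have "prob (A \<inter> E x \<inter> E y) = prob (A \<inter> E x \<inter> {\<omega> \<in> space M. returns (y - 1) \<omega> = d}) * step_prob d v"
        using xy by (intro next_E history_events_mono[OF history_events_Int[OF A EF]]) auto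
      also have "prob (A \<inter> E x \<inter> {\<omega> \<in> space M. returns (y - 1) \<omega> = d}) = prob (A \<inter> E x) * step_prob_pow (y - x - 1) v d"
        using renewal_returns[of "A \<inter> {\<omega> \<in> space M. returns (x - 1) \<omega> = d}" x v "y - x - 1" d] xy
          history_events_Int[OF A history_events_mono[OF returns_in_history_events, of "x - 1" x d]] by (simp add: E_def Int_assoc)
      finally show ?thesis unfolding A_def by simp
    qed
    show "(\<lambda>n. (\<Sum>m = 1..n. step_prob_pow (m - 1) v d * step_prob d v) / ln (real n)) \<longlonglongrightarrow> step_prob d v"
      by (intro LIMSEQ_sum_over_ln LIMSEQ_step_prob_pow_pred)
    have "prob (E x) = step_prob_pow (x - 1) 0 d * step_prob d v" if "2 \<le> x" for x
      using next_E[OF space_in_history_events that] prob_returns[of "x - 1" d] that sets.sets_into_space[OF history_events_sets[OF EF[of x]]]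
      by (simp add: Int_absorb1)
    then have "(\<Sum>x = 2..n. prob (E x)) = (\<Sum>x = 2..n. step_prob_pow (x - 1) 0 d * step_prob d v)" for n
      by (intro sum.cong) auto
    then show "(\<lambda>n. (\<Sum>x = 2..n. prob (E x)) / ln (real n)) \<longlonglongrightarrow> step_prob d v"
      using LIMSEQ_sum_over_ln(2)[OF LIMSEQ_step_prob_pow_pred[of 0 d "step_prob d v"]] by simp
  qed (auto intro!: C_sets mult_nonneg_nonneg step_prob_pow_nonneg step_prob_nonneg)
  then show ?thesis unfolding d_def v_def .
qed

lemma Cw_limit:
  "weak_conv_m (\<lambda>n. distr M borel (\<lambda>\<omega>. real (card (Cw (path \<omega>) \<inter> {1..n})) / (2 * ln (real n)))) Exp1"
proof (rule renewal_set_exponential_limit[where E = "\<lambda>x. {\<omega> \<in> space M. sorted (final_stack (path \<omega>) x)}" and u = "\<lambda>m. 2 * step_prob_pow (Suc m) 0 0"])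
  show "AE \<omega> in M. \<forall>x\<ge>2. (x \<in> Cw (path \<omega>)) = (\<omega> \<in> {\<omega> \<in> space M. sorted (final_stack (path \<omega>) x)})"
    using AE_all_consistent AE_nn_path AE_space
  proof eventually_elim
    case (elim \<omega>)
    show ?case
    proof (intro allI impI)
      fix x :: nat assume "2 \<le> x"
      have "ends_up (final_stack (path \<omega>) x)" using elim by (auto simp: consistent_stacks_def)
      then show "(x \<in> Cw (path \<omega>)) = (\<omega> \<in> {\<omega> \<in> space M. sorted (final_stack (path \<omega>) x)})"
        using Cw_iff_sorted[of "path \<omega>" x] elim \<open>2 \<le> x\<close> by simp
    qed
  qed
  show "prob ({\<omega> \<in> space M. card {z \<in> {2..<x}. \<omega> \<in> {\<omega> \<in> space M. sorted (final_stack (path \<omega>) z)}} = r}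
          \<inter> {\<omega> \<in> space M. sorted (final_stack (path \<omega>) x)} \<inter> {\<omega> \<in> space M. sorted (final_stack (path \<omega>) y)})
     = prob ({\<omega> \<in> space M. card {z \<in> {2..<x}. \<omega> \<in> {\<omega> \<in> space M. sorted (final_stack (path \<omega>) z)}} = r}
          \<inter> {\<omega> \<in> space M. sorted (final_stack (path \<omega>) x)}) * (2 * step_prob_pow (Suc (y - x)) 0 0)"
    if "2 \<le> x" "x < y" for x y r
    by (rule renewal_sorted[OF count_in_history_events[OF sorted_in_history_events that(1)] that])
  have "(\<lambda>m. real (Suc m) * (2 * step_prob_pow (Suc m) 0 0)) \<longlonglongrightarrow> 2"
    unfolding step_prob_pow_0_0 by real_asymp
  then show "(\<lambda>n. (\<Sum>m = 1..n. 2 * step_prob_pow (Suc m) 0 0) / ln (real n)) \<longlonglongrightarrow> 2"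
    by (rule LIMSEQ_sum_over_ln)
  have "prob {\<omega> \<in> space M. sorted (final_stack (path \<omega>) x)} = 2 * step_prob_pow x 0 0" if x: "2 \<le> x" for x
  proof -
    obtain x' where x': "x = Suc x'" "1 \<le> x'" using x by (cases x) auto
    show ?thesis using prob_sorted(2)[OF space_in_history_events x'(2)] prob_returns[of x 0] x unfolding x'(1)
      by (simp add: Int_absorb1)
  qed
  then have "(\<Sum>x = 2..n. prob {\<omega> \<in> space M. sorted (final_stack (path \<omega>) x)}) = (\<Sum>x = 2..n. 2 * step_prob_pow x 0 0)" for n
    by (intro sum.cong) auto
  moreover have "(\<lambda>m. real (Suc m) * (2 * step_prob_pow m 0 0)) \<longlonglongrightarrow> 2"
    unfolding step_prob_pow_0_0 by real_asymp
  ultimately show "(\<lambda>n. (\<Sum>x = 2..n. prob {\<omega> \<in> space M. sorted (final_stack (path \<omega>) x)}) / ln (real n)) \<longlonglongrightarrow> 2"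
    using LIMSEQ_sum_over_ln(2)[of "\<lambda>m. 2 * step_prob_pow m 0 0" 2] by simp
qed (auto intro: C_sets step_prob_pow_nonneg simp del: step_prob_pow.simps)

end

theorem theorem2:
  fixes M :: "'w measure" and X :: "nat \<Rightarrow> 'w \<Rightarrow> nat" and a b :: nat
  assumes "bd_chain M p_seq X"
    and "a \<ge> b" and "b \<ge> 1"
  shows "weak_conv_m
           (\<lambda>n. distr M borel (\<lambda>\<omega>. real (card (Cab (\<lambda>k. X k \<omega>) a b \<inter> {1..n}))
                 / (2 powi (- int a) * real ((a - 1) choose (b - 1)) * ln (real n))))
           Exp1
       \<and> weak_conv_m
           (\<lambda>n. distr M borel (\<lambda>\<omega>. real (card (Cstar (\<lambda>k. X k \<omega>) a \<inter> {1..n})) / ln (real n)))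
           Exp1
       \<and> weak_conv_m
           (\<lambda>n. distr M borel (\<lambda>\<omega>. real (card (Cw (\<lambda>k. X k \<omega>) \<inter> {1..n})) / (2 * ln (real n))))
           Exp1"
proof -
  interpret bd_walk M X
    using assms(1) by (simp add: bd_walk_def bd_walk_axioms_def bd_chain_def)
  \<comment> \<open>The states are \<open>a - b\<close> and \<open>b - 1\<close>, so the list has
    length \<open>(a - b) + (b - 1) + 1 = a\<close>, and the binomial coefficient is read from the
    other end.\<close>
  have "2 powi (- int a) * real ((a - 1) choose (b - 1)) = step_prob (a - b) (b - 1)"
  proof -
    have "(a - 1) choose (b - 1) = (a - 1) choose (a - b)"
      using binomial_symmetric[of "b - 1" "a - 1"] assms by simp
    then show ?thesis
      using assms by (simp add: step_prob_def power_int_minus divide_inverse)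
  qed
  then show ?thesis
    using Cab_limit[OF assms(2,3)] Cstar_limit[of a] Cw_limit assms(2,3) by simp
qed

end
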